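(* Let $n\ge 4$, $\ell=n-3$ and $Z=\{0,1,\infty,t_1,\dots,t_\ell\}$. Then the quotient $\mathcal{P}_Z/I_Z$ is isomorphic to $H^{\ell}(\mathfrak{M}_{0,n})$, and a basis of $H^\ell(\mathfrak{M}_{0,n})$ is given by the set of (classes of) 01-cell forms $$\{[0,1,\sigma(\infty,t_1,\dots,t_\ell)]\;:\;\sigma\in\mathfrak{S}_{n-2}\},$$ where $\sigma$ runs over all permutations of the $n-2$ elements $\infty,t_1,\dots,t_\ell$.
   Context: $\mathfrak{M}_{0,n}$ is the moduli space of genus $0$ curves with $n$ ordered distinct marked points; modulo $\mathrm{PSL}_2$ a point is represented by $(0,t_1,\dots,t_\ell,1,\infty)$, so $\mathfrak{M}_{0,n}\cong\{(t_1,\dots,t_\ell)\in(\mathbb{P}^1\setminus\{0,1,\infty\})^\ell: t_i\ne t_j \text{ for } i\neq j\}$. $H^\ell(\mathfrak{M}_{0,n})$ denotes de Rham cohomology with $\mathbb{Q}$-coefficients. $\mathcal{P}_Z$ is the $\mathbb{Q}$-vector space generated by oriented $n$-gons whose edges are decorated by the elements of $Z$, i.e. by cyclic orderings $[s_1,\dots,s_n]$ of $Z$. $I_Z\subset\mathcal{P}_Z$ is the subspace generated by the shuffle sums with respect to $\infty$, i.e. by the sums $\sum_{W\in A\,\text{ш}\,B}[W,\infty]$, where $A$ and $B$ are nonempty sequences of distinct elements whose underlying sets partition $\{0,t_1,\dots,t_\ell,1\}$, and $A\,\text{ш}\,B$ is the sum of all permutations of the concatenation of $A$ and $B$ preserving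 the order of $A$ and the order of $B$. The cell form attached to the cyclic ordering $[s_1,\dots,s_n]$ is $$[s_1,\dots,s_n]=\frac{dt_1\wedge\cdots\wedge dt_\ell}{\prod (s_i-s_{i-1})},$$ where indices are modulo $n$ and the two factors involving $\infty$ are omitted. A 01-cell form is a cell form attached to a cyclic ordering in which $0$ is immediately followed by $1$. *)

theory Defs
  imports
    Complex_Main
    "HOL-Library.Poly_Mapping"
    "HOL-Library.Function_Algebras"
    "HOL-Library.Set_Algebras"
    "HOL-Computational_Algebra.Fraction_Field"
    "HOL-Combinatorics.Permutations"
    "HOL-Algebra.Module"
begin

section \<open>Rational vector spaces and their quotients\<close>

definition qscale :: "rat \<Rightarrow> ('a \<Rightarrow> 'b::field_char_0) \<Rightarrow> 'a \<Rightarrow> 'b" where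
  "qscale c f = (\<lambda>x. of_rat c * f x)"

global_interpretation Q: vector_space "qscale :: rat \<Rightarrow> ('a \<Rightarrow> 'b::field_char_0) \<Rightarrow> 'a \<Rightarrow> 'b"
  by unfold_locales
    (auto simp: qscale_def fun_eq_iff algebra_simps of_rat_add of_rat_mult)

text \<open>The quotient of a subspace \<open>V\<close> by a subspace \<open>W \<subseteq> V\<close>; its elements are the cosets \<open>v + W\<close>.
  Adding \<open>W\<close> to the scaled coset matters only for the scalar \<open>0\<close>. The multiplicative fields of
  the record are not part of the module structure.\<close>

definition quotient_space ::
    "('a \<Rightarrow> 'b::field_char_0) set \<Rightarrow> ('a \<Rightarrow> 'b) set \<Rightarrow> (rat, ('a \<Rightarrow> 'b) set) module" where
  "quotient_space V W =
     \<lparr>carrier = (\<lambda>v. v +o W) ` V, monoid.mult = undefined, one = undefined,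
      ring.zero = W, add = (\<lambda>A B. A + B), smult = (\<lambda>c A. qscale c ` A + W)\<rparr>"

definition linear_iso :: "(rat, 'a) module \<Rightarrow> (rat, 'b) module \<Rightarrow> ('a \<Rightarrow> 'b) \<Rightarrow> bool" where
  "linear_iso M N \<phi> \<longleftrightarrow>
     \<phi> \<in> iso (add_monoid M) (add_monoid N) \<and>
     (\<forall>c. \<forall>x \<in> carrier M. \<phi> (c \<odot>\<^bsub>M\<^esub> x) = c \<odot>\<^bsub>N\<^esub> \<phi> x)"

text \<open>Bases are families, so the members of a basis are pairwise distinct.\<close>

definition finite_basis :: "(rat, 'a) module \<Rightarrow> 'i set \<Rightarrow> ('i \<Rightarrow> 'a) \<Rightarrow> bool" where
  "finite_basis M S b \<longleftrightarrow>
     finite S \<and> b \<in> S \<rightarrow> carrier M \<and>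
     (\<forall>x \<in> carrier M. \<exists>c. x = (\<Oplus>\<^bsub>M\<^esub>s\<in>S. c s \<odot>\<^bsub>M\<^esub> b s)) \<and>
     (\<forall>c. (\<Oplus>\<^bsub>M\<^esub>s\<in>S. c s \<odot>\<^bsub>M\<^esub> b s) = \<zero>\<^bsub>M\<^esub> \<longrightarrow> (\<forall>s\<in>S. c s = 0))"


section \<open>Rational functions over the rationals and their partial derivatives\<close>

text \<open>Polynomials in the variables \<open>t i\<close>, indexed by all natural numbers; a monomial is its
  exponent function.\<close>

type_synonym qpoly = "(nat \<Rightarrow>\<^sub>0 nat) \<Rightarrow>\<^sub>0 rat"
type_synonym ratfun = "qpoly fract"

lemma of_nat_fract: "(of_nat n :: 'a::idom fract) = Fract (of_nat n) 1"
  by (induction n) (auto simp: Zero_fract_def One_fract_def)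

instance fract :: ("{idom, ring_char_0}") field_char_0
proof
  show "inj (of_nat :: nat \<Rightarrow> 'a fract)"
    by (rule injI) (simp add: of_nat_fract eq_fract)
qed

definition var :: "nat \<Rightarrow> qpoly" where
  "var i = Poly_Mapping.single (Poly_Mapping.single i 1) 1"

text \<open>The coefficient of \<open>\<partial>p/\<partial>t\<^sub>i\<close> at the monomial \<open>m\<close> is \<open>m\<^sub>i + 1\<close> times the one of \<open>p\<close> at \<open>t\<^sub>i m\<close>.\<close>

lift_definition poly_partial :: "nat \<Rightarrow> qpoly \<Rightarrow> qpoly" is
  "\<lambda>i p m. of_nat (Poly_Mapping.lookup m i + 1) * p (m + Poly_Mapping.single i 1)"
proof -
  fix i :: nat and p :: "(nat \<Rightarrow>\<^sub>0 nat) \<Rightarrow> rat"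
  assume "finite {m. p m \<noteq> 0}"
  then have "finite ((\<lambda>m. m + Poly_Mapping.single i 1) -` {m. p m \<noteq> 0})"
    by (rule finite_vimageI) (auto intro: injI)
  then show "finite {m. of_nat (Poly_Mapping.lookup m i + 1) * p (m + Poly_Mapping.single i 1) \<noteq> 0}"
    by (rule finite_subset [rotated]) auto
qed

lemma poly_partial_add: "poly_partial i (p + q) = poly_partial i p + poly_partial i q"
  by transfer (auto simp: fun_eq_iff algebra_simps)

lemma poly_partial_zero [simp]: "poly_partial i 0 = 0"
  by transfer auto

lemma poly_partial_sum: "poly_partial i (\<Sum>x\<in>A. f x) = (\<Sum>x\<in>A. poly_partial i (f x))"
  by (induction A rule: infinite_finite_induct) (auto simp: poly_partial_add)

lemma poly_partial_single:
  "poly_partial i (Poly_Mapping.single m a) =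
     Poly_Mapping.single (m - Poly_Mapping.single i 1) (of_nat (Poly_Mapping.lookup m i) * a)"
proof (rule poly_mapping_eqI)
  fix k
  have eq: "m = k + Poly_Mapping.single i 1 \<longleftrightarrow>
      m - Poly_Mapping.single i 1 = k \<and> Poly_Mapping.lookup m i \<noteq> 0"
  proof
    assume "m - Poly_Mapping.single i 1 = k \<and> Poly_Mapping.lookup m i \<noteq> 0"
    then show "m = k + Poly_Mapping.single i 1"
      by (intro poly_mapping_eqI) (auto simp: lookup_add lookup_minus lookup_single when_def)
  qed (auto simp: lookup_add)
  show "Poly_Mapping.lookup (poly_partial i (Poly_Mapping.single m a)) k =
      Poly_Mapping.lookup (Poly_Mapping.single (m - Poly_Mapping.single i 1)
        (of_nat (Poly_Mapping.lookup m i) * a)) k"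
  proof (cases "m = k + Poly_Mapping.single i 1")
    case True
    then show ?thesis
      by (simp add: poly_partial.rep_eq lookup_add)
  next
    case False
    then have "m - Poly_Mapping.single i 1 \<noteq> k \<or> Poly_Mapping.lookup m i = 0"
      using eq by blast
    with False show ?thesis
      by (auto simp: poly_partial.rep_eq lookup_single when_def)
  qed
qed

lemma qpoly_monomials:
  "p = (\<Sum>m\<in>Poly_Mapping.keys p. Poly_Mapping.single m (Poly_Mapping.lookup p m))"
  for p :: qpoly
  by (rule poly_mapping_eqI) (auto simp: lookup_sum lookup_single when_def in_keys_iff)

lemma poly_partial_mult_single:
  "poly_partial i (Poly_Mapping.single m a * Poly_Mapping.single k b) =
     poly_partial i (Poly_Mapping.single m a) * Poly_Mapping.single k b +
     Poly_Mapping.single m a * poly_partial i (Poly_Mapping.single k b)"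
proof -
  have sub: "Poly_Mapping.lookup x i \<noteq> 0 \<Longrightarrow>
      x + y - Poly_Mapping.single i 1 = (x - Poly_Mapping.single i 1) + y" for x y :: "nat \<Rightarrow>\<^sub>0 nat"
    by (rule poly_mapping_eqI) (auto simp: lookup_add lookup_minus lookup_single when_def)
  show ?thesis
    using sub [of m k] sub [of k m]
    by (cases "Poly_Mapping.lookup m i = 0"; cases "Poly_Mapping.lookup k i = 0")
      (simp_all add: poly_partial_single mult_single lookup_add algebra_simps flip: single_add)
qed

lemma poly_partial_mult:
  "poly_partial i (p * q) = poly_partial i p * q + p * poly_partial i q"
proof -
  let ?s = "\<lambda>p m. Poly_Mapping.single m (Poly_Mapping.lookup p m) :: qpoly"
  have "poly_partial i ((\<Sum>m\<in>A. ?s p m) * (\<Sum>k\<in>B. ?s q k)) =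
      poly_partial i (\<Sum>m\<in>A. ?s p m) * (\<Sum>k\<in>B. ?s q k) +
      (\<Sum>m\<in>A. ?s p m) * poly_partial i (\<Sum>k\<in>B. ?s q k)" for A B
    by (simp add: sum_product poly_partial_sum poly_partial_mult_single sum.distrib)
  from this [of "Poly_Mapping.keys p" "Poly_Mapping.keys q"] show ?thesis
    by (simp flip: qpoly_monomials)
qed

lift_definition partial :: "nat \<Rightarrow> ratfun \<Rightarrow> ratfun" is
  "\<lambda>i q. (poly_partial i (fst q) * snd q - fst q * poly_partial i (snd q), snd q ^ 2)"
proof -
  fix i :: nat and x y :: "qpoly \<times> qpoly"
  assume "fractrel x y"
  then obtain a b c d where xy: "x = (a, b)" "y = (c, d)" and nz: "b \<noteq> 0" "d \<noteq> 0"
    and eq: "a * d = c * b"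
    by (cases x; cases y) auto
  define a' b' c' d' where defs: "a' = poly_partial i a" "b' = poly_partial i b"
    "c' = poly_partial i c" "d' = poly_partial i d"
  have "a' * d + a * d' = c' * b + c * b'"
    using arg_cong [OF eq, of "poly_partial i"] by (simp add: poly_partial_mult defs)
  then have a'd: "a' * d = c' * b + c * b' - a * d'"
    by (simp add: algebra_simps)
  have "(a' * b - a * b') * d\<^sup>2 = b * d * (a' * d) - (a * d) * b' * d"
    by (simp add: algebra_simps power2_eq_square)
  also have "\<dots> = b\<^sup>2 * d * c' + b * d * c * b' - b * d' * (a * d) - (a * d) * b' * d"
    unfolding a'd by (simp add: algebra_simps power2_eq_square)
  also have "\<dots> = (c' * d - c * d') * b\<^sup>2"
    unfolding eq by (simp add: algebra_simps power2_eq_square)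
  finally have "(a' * b - a * b') * d\<^sup>2 = (c' * d - c * d') * b\<^sup>2" .
  with nz show "fractrel
      (poly_partial i (fst x) * snd x - fst x * poly_partial i (snd x), snd x ^ 2)
      (poly_partial i (fst y) * snd y - fst y * poly_partial i (snd y), snd y ^ 2)"
    by (simp add: xy defs)
qed

lemma partial_Fract:
  "b \<noteq> 0 \<Longrightarrow> partial i (Fract a b) = Fract (poly_partial i a * b - a * poly_partial i b) (b ^ 2)"
  by transfer auto


section \<open>The algebraic de Rham complex of the moduli space\<close>

text \<open>With \<open>l = n - 3\<close> simplicial coordinates, the moduli space is the complement in affine
  \<open>l\<close>-space of the zero locus of \<open>discriminant l\<close>; its coordinate ring is the localisation of the
  polynomial ring at that polynomial.\<close>

definition discriminant :: "nat \<Rightarrow> qpoly" where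
  "discriminant l =
     (\<Prod>i\<in>{1..l}. var i) * (\<Prod>i\<in>{1..l}. 1 - var i) *
     (\<Prod>(i, j)\<in>{(i, j). 1 \<le> i \<and> i < j \<and> j \<le> l}. var i - var j)"

definition polynomials :: "nat \<Rightarrow> qpoly set" where
  "polynomials l = {p. \<forall>m \<in> Poly_Mapping.keys p. Poly_Mapping.keys m \<subseteq> {1..l}}"

definition coordinate_ring :: "nat \<Rightarrow> ratfun set" where
  "coordinate_ring l = {Fract p (discriminant l ^ k) |p k. p \<in> polynomials l}"

text \<open>The form \<open>\<Sum>\<^sub>I f\<^sub>I dt\<^sub>I\<close> is represented by its coefficients \<open>I \<mapsto> f\<^sub>I\<close>, where \<open>dt\<^sub>I\<close> is the wedge
  product of the \<open>dt\<^sub>i\<close>, \<open>i \<in> I\<close>, in increasing order.\<close>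

type_synonym form = "nat set \<Rightarrow> ratfun"

definition forms :: "nat \<Rightarrow> nat \<Rightarrow> form set" where
  "forms l k =
     {\<omega>. \<forall>I. \<omega> I \<in> coordinate_ring l \<and> (\<omega> I \<noteq> 0 \<longrightarrow> I \<subseteq> {1..l} \<and> card I = k)}"

text \<open>\<open>dt\<^sub>i \<and> dt\<^sub>I = (-1)\<^sup>s dt\<^sub>J\<close> for \<open>J = I \<union> {i}\<close> and \<open>s\<close> the number of elements of \<open>I\<close> below \<open>i\<close>.\<close>

definition ext_deriv :: "form \<Rightarrow> form" where
  "ext_deriv \<omega> = (\<lambda>J. \<Sum>i\<in>J. (-1) ^ card {j\<in>J. j < i} * partial i (\<omega> (J - {i})))"

definition closed_forms :: "nat \<Rightarrow> nat \<Rightarrow> form set" where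
  "closed_forms l k = {\<omega> \<in> forms l k. ext_deriv \<omega> = 0}"

definition exact_forms :: "nat \<Rightarrow> nat \<Rightarrow> form set" where
  "exact_forms l k = (if k = 0 then {0} else ext_deriv ` forms l (k - 1))"

text \<open>\<open>de_Rham n k\<close> is the \<open>k\<close>-th cohomology of the moduli space of genus 0 curves with \<open>n\<close>
  ordered marked points.\<close>

definition de_Rham :: "nat \<Rightarrow> nat \<Rightarrow> (rat, form set) module" where
  "de_Rham n k = quotient_space (closed_forms (n - 3) k) (exact_forms (n - 3) k)"

definition form_class :: "nat \<Rightarrow> nat \<Rightarrow> form \<Rightarrow> form set" where
  "form_class n k \<omega> = \<omega> +o exact_forms (n - 3) k"


section \<open>Polygons and cell forms\<close>

datatype label = Zero | One | Infty | T nat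

definition labels :: "nat \<Rightarrow> label set" where
  "labels l = {Zero, One, Infty} \<union> T ` {1..l}"

definition orderings :: "nat \<Rightarrow> label list set" where
  "orderings l = {s. distinct s \<and> set s = labels l}"

text \<open>The cyclic ordering \<open>[s\<^sub>1, \<dots>, s\<^sub>n]\<close>, as the set of all lists representing it.\<close>

definition cyclic :: "label list \<Rightarrow> label list set" where
  "cyclic s = {rotate k s |k. True}"

definition polygon :: "label list \<Rightarrow> label list set \<Rightarrow> rat" where
  "polygon s = (\<lambda>C. if C = cyclic s then 1 else 0)"

definition polygon_space :: "nat \<Rightarrow> (label list set \<Rightarrow> rat) set" where
  "polygon_space l = Q.span (polygon ` orderings l)"

text \<open>For lists without common elements, \<open>shuffles\<close> lists every shuffle exactly once.\<close>

definition shuffle_space :: "nat \<Rightarrow> (label list set \<Rightarrow> rat) set" where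
  "shuffle_space l = Q.span
     {\<Sum>W\<in>shuffles A B. polygon (W @ [Infty]) |A B.
        A \<noteq> [] \<and> B \<noteq> [] \<and> distinct (A @ B) \<and> set (A @ B) = labels l - {Infty}}"

text \<open>Irrelevant at \<open>Infty\<close>.\<close>

fun label_value :: "label \<Rightarrow> ratfun" where
  "label_value Zero = 0"
| "label_value One = 1"
| "label_value (T i) = Fract (var i) 1"
| "label_value Infty = undefined"

definition cell_form :: "nat \<Rightarrow> label list \<Rightarrow> form" where
  "cell_form l s = (\<lambda>I. if I = {1..l} then
     1 / (\<Prod>i\<in>{i. i < length s \<and> s ! i \<noteq> Infty \<and> s ! ((i + length s - 1) mod length s) \<noteq> Infty}.
            label_value (s ! i) - label_value (s ! ((i + length s - 1) mod length s)))
   else 0)"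

end

theory Submission
  imports Defs "HOL-Computational_Algebra.Formal_Laurent_Series"
begin

text \<open>
  The map that sends a polygon to the class of its cell form is shown to be well defined modulo
  shuffles, injective and surjective, and the two families of words that occur on the way give the
  basis. Write \<open>R\<^sub>l\<close> for the coordinate ring and \<open>E\<^sub>l = \<Sum>\<^sub>i \<partial>\<^sub>i R\<^sub>l\<close>. In top degree every form is closed, so
  the cohomology is \<open>R\<^sub>l / E\<^sub>l\<close> (\<open>closed_forms_top\<close>, \<open>exact_forms_top\<close>).

  The ring is understood by forgetting the last marked point \<open>t = t\<^bsub>l+1\<^esub>\<close>, whose fibre is a line with
  the punctures \<open>a \<in> {0, 1, t\<^sub>1, \<dots>, t\<^sub>l}\<close>. By partial fractions over \<open>R\<^sub>l\<close>, every element of \<open>R\<^bsub>l+1\<^esub>\<close> is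
  \<open>\<partial>G/\<partial>t + \<Sum>\<^sub>a g\<^sub>a / (t - a)\<close> with \<open>g\<^sub>a \<in> R\<^sub>l\<close> (\<open>partial_fractions\<close>): every power of \<open>t - a\<close> except the
  simple pole has a primitive. The residues at the punctures show that the
  \<open>g\<^sub>a\<close> are determined by the element (\<open>simple_poles_not_exact\<close>). The derivatives in the other coordinates act on
  the \<open>g\<^sub>a\<close> only, up to a \<open>t\<close>-derivative, because \<open>1 / (t - a)\<close> depends on \<open>t - a\<close> alone. Hence the top
  cohomology is \<open>\<Oplus>\<^sub>a R\<^sub>l / E\<^sub>l\<close>, and questions about it can be settled by induction on \<open>l\<close>.

  A polygon, cut open at \<open>\<infinity>\<close>, is a word \<open>W\<close> in the letters \<open>0, 1, t\<^sub>1, \<dots>, t\<^sub>l\<close>, and its cell form has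
  the coefficient \<open>chain W = \<Prod>\<^sub>i 1 / (w\<^bsub>i+1\<^esub> - w\<^sub>i)\<close>. The identity behind all relations is that the
  product of two chains with the same first letter is the sum of the chains of the shuffles of their
  tails (\<open>chain_shuffles\<close>). It gives the vanishing of the shuffle sums
  (\<open>chain_shuffles_eq_0\<close>). It also gives surjectivity: multiplying \<open>chain U\<close> by \<open>1 / (t - a)\<close> yields
  the sum of the chains in which \<open>t\<close> is inserted anywhere to the right of \<open>a\<close>, so the chains span
  \<open>R\<^sub>l\<close> modulo \<open>E\<^sub>l\<close> (\<open>coordinate_ring_spanned\<close>). Finally, it turns \<open>chain (u 0 v)\<close> into a signed sum
  of chains that start with \<open>0\<close>, and a triangularity in the position of the letter \<open>1\<close> shows that the words
  in which \<open>0\<close> is followed by \<open>1\<close> suffice (\<open>coordinate_ring_spanned_by_words01\<close>).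

  Independence has a uniform proof (\<open>chains_independent\<close>). The residue of \<open>chain (x t y)\<close> at \<open>a\<close> is
  \<open>chain (x y)\<close> if \<open>a\<close> stands immediately before \<open>t\<close>, and \<open>- chain (x y)\<close> if it stands immediately after \<open>t\<close>. Thus in a relation, by
  induction, the coefficient does not change when \<open>t\<close> moves across one letter; as soon as one
  position of \<open>t\<close> is excluded from the family, all coefficients vanish. Words that start with \<open>0\<close>
  exclude \<open>t\<close> before \<open>0\<close>, and words that contain \<open>01\<close> exclude \<open>t\<close> between \<open>0\<close> and \<open>1\<close>.

  Since polygons are generated modulo shuffles by the words that start with \<open>0\<close>
  (\<open>polygon_space_spanned_by_initial\<close>), the first family gives injectivity of the map to the cohomology, and
  the second family is the claimed basis.
\<close>


section \<open>Polynomials, rational functions and their derivatives\<close>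

lemma const_in_polynomials: "Poly_Mapping.single 0 c \<in> polynomials l"
  by (auto simp: polynomials_def)

lemma zero_in_polynomials: "0 \<in> polynomials l"
  by (auto simp: polynomials_def)

lemma one_in_polynomials: "1 \<in> polynomials l"
  by (auto simp: polynomials_def)

lemma var_in_polynomials: "i \<in> {1..l} \<Longrightarrow> var i \<in> polynomials l"
  by (auto simp: polynomials_def var_def)

lemma polynomials_add: "p \<in> polynomials l \<Longrightarrow> q \<in> polynomials l \<Longrightarrow> p + q \<in> polynomials l"
  using keys_add [of p q] by (auto simp: polynomials_def)

lemma polynomials_mult:
  assumes "p \<in> polynomials l" "q \<in> polynomials l"
  shows "p * q \<in> polynomials l"
proof -
  have "Poly_Mapping.keys m \<subseteq> {1..l}" if m: "m \<in> Poly_Mapping.keys (p * q)" for m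
  proof -
    from m keys_mult [of p q] obtain a b
      where "m = a + b" "a \<in> Poly_Mapping.keys p" "b \<in> Poly_Mapping.keys q"
      by blast
    with assms keys_add [of a b] show ?thesis
      by (fastforce simp: polynomials_def)
  qed
  then show ?thesis
    by (auto simp: polynomials_def)
qed

lemma polynomials_uminus: "p \<in> polynomials l \<Longrightarrow> - p \<in> polynomials l"
  using polynomials_mult [OF const_in_polynomials [of "- 1"], of p l]
  by (simp add: single_uminus single_one)

lemma polynomials_diff: "p \<in> polynomials l \<Longrightarrow> q \<in> polynomials l \<Longrightarrow> p - q \<in> polynomials l"
  using polynomials_add [of p l "- q"] by (simp add: polynomials_uminus)

lemma polynomials_power: "p \<in> polynomials l \<Longrightarrow> p ^ k \<in> polynomials l"
  by (induction k) (auto simp: one_in_polynomials polynomials_mult)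

lemma polynomials_prod: "(\<And>x. x \<in> S \<Longrightarrow> f x \<in> polynomials l) \<Longrightarrow> prod f S \<in> polynomials l"
  by (induction S rule: infinite_finite_induct) (auto simp: one_in_polynomials polynomials_mult)

lemma polynomials_mono: "l \<le> l' \<Longrightarrow> polynomials l \<subseteq> polynomials l'"
  by (fastforce simp: polynomials_def)

text \<open>A monomial is a constant times a product of variables, by induction on the total degree.
  This rule is the means to compare two derivations, or two ring homomorphisms, on polynomials.\<close>

lemma polynomials_induct [consumes 1, case_names const var add mult]:
  assumes p: "p \<in> polynomials l"
    and const: "\<And>c. P (Poly_Mapping.single 0 c)"
    and var: "\<And>i. i \<in> {1..l} \<Longrightarrow> P (var i)"
    and add: "\<And>p q. P p \<Longrightarrow> P q \<Longrightarrow> P (p + q)"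
    and mult: "\<And>p q. P p \<Longrightarrow> P q \<Longrightarrow> P (p * q)"
  shows "P p"
proof -
  have single: "P (Poly_Mapping.single m c)"
    if "Poly_Mapping.keys m \<subseteq> {1..l}" "sum (Poly_Mapping.lookup m) {1..l} = d" for m c d
    using that
  proof (induction d arbitrary: m)
    case 0
    have "Poly_Mapping.lookup m i = 0" for i
      using 0 by (cases "i \<in> {1..l}") (use in_keys_iff [of i m] in auto)
    then have "m = 0"
      by (intro poly_mapping_eqI) simp
    then show ?case
      using const by simp
  next
    case (Suc d)
    have "\<exists>i \<in> {1..l}. Poly_Mapping.lookup m i > 0"
    proof (rule ccontr)
      assume "\<not> ?thesis"
      then have "sum (Poly_Mapping.lookup m) {1..l} = 0"
        by auto
      with Suc.prems(2) show False
        by simp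
    qed
    then obtain i where i: "i \<in> {1..l}" "Poly_Mapping.lookup m i > 0"
      by blast
    define m' where "m' = m - Poly_Mapping.single i 1"
    have m: "m = m' + Poly_Mapping.single i 1"
      using i by (intro poly_mapping_eqI)
        (auto simp: m'_def lookup_add lookup_minus lookup_single when_def)
    have "Poly_Mapping.keys m' \<subseteq> Poly_Mapping.keys m"
      by (auto simp: m'_def in_keys_iff lookup_minus)
    moreover have "sum (Poly_Mapping.lookup m) {1..l} = sum (Poly_Mapping.lookup m') {1..l} + 1"
      using i by (subst m) (simp add: lookup_add sum.distrib lookup_single when_def)
    ultimately have "P (Poly_Mapping.single m' c)"
      using Suc by auto
    then have "P (Poly_Mapping.single m' c * var i)"
      using i by (intro mult var)
    then show ?case
      unfolding var_def mult_single m [symmetric] by simp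
  qed
  have "P (\<Sum>m\<in>S. Poly_Mapping.single m (Poly_Mapping.lookup p m))"
    if "S \<subseteq> Poly_Mapping.keys p" for S
    using finite_subset [OF that finite_keys] that
  proof (induction S rule: finite_induct)
    case empty
    then show ?case
      using const [of 0] by simp
  next
    case (insert m S)
    then show ?case
      using p unfolding sum.insert [OF insert.hyps] polynomials_def by (blast intro: add single)
  qed
  then show ?thesis
    by (subst qpoly_monomials) simp
qed

lemma poly_partial_const [simp]: "poly_partial i (Poly_Mapping.single 0 c) = 0"
  by (simp add: poly_partial_single)

lemma poly_partial_one [simp]: "poly_partial i 1 = 0"
  using poly_partial_const [of i 1] by (simp del: poly_partial_const)

lemma poly_partial_var: "poly_partial i (var j) = (if i = j then 1 else 0)"
  by (auto simp: var_def poly_partial_single lookup_single when_def)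

lemma poly_partial_in_polynomials: "p \<in> polynomials l \<Longrightarrow> poly_partial i p \<in> polynomials l"
proof -
  assume "p \<in> polynomials l"
  then have "p \<in> polynomials l \<and> poly_partial i p \<in> polynomials l"
    by (induction p rule: polynomials_induct)
      (auto simp: poly_partial_add poly_partial_mult poly_partial_var const_in_polynomials
        zero_in_polynomials one_in_polynomials var_in_polynomials polynomials_add polynomials_mult)
  then show ?thesis ..
qed

lemma poly_partial_eq_0: "p \<in> polynomials l \<Longrightarrow> i \<notin> {1..l} \<Longrightarrow> poly_partial i p = 0"
  by (induction p rule: polynomials_induct)
    (auto simp: poly_partial_add poly_partial_mult poly_partial_var)

lemma poly_partial_commute:
  "poly_partial i (poly_partial j p) = poly_partial j (poly_partial i p)"
proof -
  have "poly_partial i (poly_partial j (Poly_Mapping.single m c)) =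
      poly_partial j (poly_partial i (Poly_Mapping.single m c))" for m c
    by (cases "i = j")
      (auto simp: poly_partial_single lookup_minus lookup_single when_def diff_diff_eq add.commute
         intro!: arg_cong2 [where f = Poly_Mapping.single] poly_mapping_eqI)
  then have "poly_partial i (poly_partial j (\<Sum>m\<in>S. Poly_Mapping.single m (Poly_Mapping.lookup p m))) =
    poly_partial j (poly_partial i (\<Sum>m\<in>S. Poly_Mapping.single m (Poly_Mapping.lookup p m)))" for S
    by (simp add: poly_partial_sum)
  from this [of "Poly_Mapping.keys p"] show ?thesis
    by (simp flip: qpoly_monomials)
qed

lemma partial_add: "partial i (x + y) = partial i x + partial i y"
proof (cases x, cases y)
  fix a b c d
  assume "x = Fract a b" "b \<noteq> 0" "y = Fract c d" "d \<noteq> 0"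
  then show ?thesis
    by (simp add: partial_Fract eq_fract poly_partial_add poly_partial_mult algebra_simps power2_eq_square)
qed

lemma partial_mult: "partial i (x * y) = partial i x * y + x * partial i y"
proof (cases x, cases y)
  fix a b c d
  assume "x = Fract a b" "b \<noteq> 0" "y = Fract c d" "d \<noteq> 0"
  then show ?thesis
    by (simp add: partial_Fract eq_fract poly_partial_add poly_partial_mult algebra_simps power2_eq_square)
qed

lemma partial_poly: "partial i (Fract p 1) = Fract (poly_partial i p) 1"
  by (simp add: partial_Fract)

text \<open>Both sides are compatible with sums and products and agree on integers; a rational number is
  a quotient of integers.\<close>

lemma of_rat_ratfun: "(of_rat c :: ratfun) = Fract (Poly_Mapping.single 0 c) 1"
proof -
  have nat: "of_nat n = Poly_Mapping.single (0::nat \<Rightarrow>\<^sub>0 nat) (of_nat n :: rat)" for n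
    by (induction n) (auto simp: single_add single_one)
  have int: "(of_int z :: ratfun) = Fract (Poly_Mapping.single 0 (of_int z)) 1" for z
  proof (cases z rule: int_cases2)
    case (nonneg n)
    then show ?thesis
      by (simp only: of_int_of_nat_eq of_nat_fract nat)
  next
    case (nonpos n)
    have "(of_int z :: ratfun) = - Fract (Poly_Mapping.single 0 (of_nat n)) 1"
      unfolding nonpos of_int_minus of_int_of_nat_eq of_nat_fract nat ..
    then show ?thesis
      unfolding nonpos of_int_minus of_int_of_nat_eq by (simp only: single_uminus minus_fract)
  qed
  obtain a b where c: "c = of_int a / of_int b" "b \<noteq> 0"
    by (metis Fract_of_int_quotient Rat_cases of_int_0_eq_iff less_irrefl)
  have "Fract (Poly_Mapping.single 0 c) 1 * (of_int b :: ratfun) = of_int a"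
    unfolding int mult_fract mult_single using c by simp
  moreover have "of_rat c * (of_int b :: ratfun) = of_int a"
    using c by (simp add: of_rat_divide)
  ultimately show ?thesis
    using c(2) by (metis mult_right_cancel of_int_0_eq_iff)
qed

lemma partial_of_rat [simp]: "partial i (of_rat c) = 0"
  by (simp add: of_rat_ratfun partial_poly Zero_fract_def)

lemma partial_0 [simp]: "partial i 0 = 0"
  using partial_of_rat [of i 0] by (simp del: partial_of_rat)

lemma partial_1 [simp]: "partial i 1 = 0"
  using partial_of_rat [of i 1] by (simp del: partial_of_rat)

lemma partial_uminus: "partial i (- x) = - partial i x"
  using partial_add [of i x "- x"] by (simp add: eq_neg_iff_add_eq_0 add.commute)

lemma partial_diff: "partial i (x - y) = partial i x - partial i y"
  using partial_add [of i x "- y"] by (simp add: partial_uminus)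

lemma partial_sum: "partial i (sum f S) = (\<Sum>x\<in>S. partial i (f x))"
  by (induction S rule: infinite_finite_induct) (auto simp: partial_add)

lemma partial_inverse: "partial i (inverse x) = - partial i x / x\<^sup>2"
proof (cases "x = 0")
  case False
  have "partial i (x * inverse x) = 0"
    using False by simp
  then have "x * partial i (inverse x) = - (partial i x * inverse x)"
    by (simp add: partial_mult eq_neg_iff_add_eq_0 add.commute)
  then have "x * x * partial i (inverse x) = - partial i x"
    using False by (simp add: mult.assoc)
  then show ?thesis
    using False by (simp add: field_simps power2_eq_square)
qed simp

lemma partial_power: "partial i (x ^ k) = of_nat k * x ^ (k - 1) * partial i x"
proof (induction k)
  case (Suc k)
  then show ?case
    by (cases k) (auto simp: partial_mult algebra_simps)
qed simp

text \<open>The commutator of two derivations is a derivation. It kills numerator and denominator, hence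
  the quotient.\<close>

lemma partial_commute: "partial i (partial j x) = partial j (partial i x)"
proof (cases x)
  case (Fract a b)
  define A B where AB: "A = Fract a 1" "B = Fract b 1"
  have B: "B \<noteq> 0"
    using Fract by (simp add: AB Zero_fract_def eq_fract)
  have x: "x * B = A"
    using Fract by (simp add: AB eq_fract)
  have comm: "partial i (partial j A) = partial j (partial i A)"
    "partial i (partial j B) = partial j (partial i B)"
    by (simp_all add: AB partial_poly poly_partial_commute)
  have "partial i (partial j (x * B)) = partial j (partial i (x * B))"
    using comm x by simp
  then have "(partial i (partial j x) - partial j (partial i x)) * B = 0"
    using comm by (simp add: partial_add partial_mult algebra_simps)
  with B show ?thesis
    by simp
qed

section \<open>The coordinate ring\<close>

definition letters :: "nat \<Rightarrow> label set" where
  "letters l = {Zero, One} \<union> T ` {1..l}"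

text \<open>The value of a finite label as a polynomial; \<open>Infty\<close> gets a default value.\<close>

fun label_poly :: "label \<Rightarrow> qpoly" where
  "label_poly Zero = 0"
| "label_poly One = 1"
| "label_poly (T i) = var i"
| "label_poly Infty = 0"

lemma label_value_eq: "a \<noteq> Infty \<Longrightarrow> label_value a = Fract (label_poly a) 1"
  by (cases a) (auto simp: Zero_fract_def One_fract_def)

lemma label_poly_inj: "a \<noteq> Infty \<Longrightarrow> b \<noteq> Infty \<Longrightarrow> label_poly a = label_poly b \<longleftrightarrow> a = b"
proof -
  have keys: "Poly_Mapping.keys (var i) = {Poly_Mapping.single i 1}" for i
    by (simp add: var_def)
  have ii: "Poly_Mapping.single i (1::nat) = Poly_Mapping.single j 1 \<longleftrightarrow> i = j" for i j :: nat
    by (metis keys_single one_neq_zero singleton_inject)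
  have i0: "Poly_Mapping.single i (1::nat) \<noteq> 0" for i :: nat
    by (metis keys_single one_neq_zero keys_zero insert_not_empty)
  have [simp]: "var i = var j \<longleftrightarrow> i = j" for i j
    using keys [of i] keys [of j] ii [of i j] by (metis singleton_inject)
  have [simp]: "var i \<noteq> 0" for i
    using keys [of i] by auto
  have [simp]: "var i \<noteq> 1" "1 \<noteq> var i" for i
    using keys [of i] i0 [of i] keys_one by (metis singleton_inject)+
  show "a \<noteq> Infty \<Longrightarrow> b \<noteq> Infty \<Longrightarrow> ?thesis"
    by (cases a; cases b) auto
qed

lemma label_value_inj: "a \<noteq> Infty \<Longrightarrow> b \<noteq> Infty \<Longrightarrow> label_value a = label_value b \<longleftrightarrow> a = b"
  by (simp add: label_value_eq eq_fract label_poly_inj)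

lemma Infty_notin_letters [simp]: "Infty \<notin> letters l"
  by (auto simp: letters_def)

lemma label_poly_in_polynomials: "a \<in> letters l \<Longrightarrow> label_poly a \<in> polynomials l"
  by (auto simp: letters_def zero_in_polynomials one_in_polynomials var_in_polynomials)

lemma finite_ordered_pairs:
  "finite {(i, j). 1 \<le> i \<and> i < j \<and> j \<le> (l::nat)}"
  "finite {(i, j). Suc 0 \<le> i \<and> i < j \<and> j \<le> (l::nat)}"
  by (rule finite_subset [of _ "{1..l} \<times> {1..l}"]; auto)+

lemma discriminant_nz [simp]: "discriminant l \<noteq> 0"
  using label_poly_inj [of "T _" Zero] label_poly_inj [of "T _" One] label_poly_inj [of "T _" "T _"]
  by (auto simp: discriminant_def finite_ordered_pairs)

lemma discriminant_in_polynomials: "discriminant l \<in> polynomials l"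
  unfolding discriminant_def
  by (intro polynomials_mult polynomials_prod)
    (auto intro!: polynomials_diff var_in_polynomials one_in_polynomials)

lemma coordinate_ring_FractI: "p \<in> polynomials l \<Longrightarrow> Fract p (discriminant l ^ k) \<in> coordinate_ring l"
  by (auto simp: coordinate_ring_def)

lemma coordinate_ringE:
  assumes "f \<in> coordinate_ring l"
  obtains p k where "p \<in> polynomials l" "f = Fract p (discriminant l ^ k)"
  using assms by (auto simp: coordinate_ring_def)

lemma coordinate_ring_poly: "p \<in> polynomials l \<Longrightarrow> Fract p 1 \<in> coordinate_ring l"
  using coordinate_ring_FractI [of p l 0] by simp

lemma coordinate_ring_add:
  assumes "f \<in> coordinate_ring l" "g \<in> coordinate_ring l"
  shows "f + g \<in> coordinate_ring l"
proof -
  from assms obtain p k q m where "p \<in> polynomials l" "f = Fract p (discriminant l ^ k)"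
    "q \<in> polynomials l" "g = Fract q (discriminant l ^ m)"
    by (elim coordinate_ringE)
  then show ?thesis
    using coordinate_ring_FractI [of "p * discriminant l ^ m + q * discriminant l ^ k" l "k + m"]
    by (simp add: power_add polynomials_add polynomials_mult polynomials_power discriminant_in_polynomials)
qed

lemma coordinate_ring_mult:
  assumes "f \<in> coordinate_ring l" "g \<in> coordinate_ring l"
  shows "f * g \<in> coordinate_ring l"
proof -
  from assms obtain p k q m where "p \<in> polynomials l" "f = Fract p (discriminant l ^ k)"
    "q \<in> polynomials l" "g = Fract q (discriminant l ^ m)"
    by (elim coordinate_ringE)
  then show ?thesis
    using coordinate_ring_FractI [of "p * q" l "k + m"]
    by (simp add: power_add polynomials_mult)
qed

lemma coordinate_ring_of_rat: "of_rat c \<in> coordinate_ring l"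
  by (simp add: of_rat_ratfun coordinate_ring_poly const_in_polynomials)

lemma coordinate_ring_0 [simp]: "0 \<in> coordinate_ring l"
  using coordinate_ring_of_rat [of 0] by simp

lemma coordinate_ring_1 [simp]: "1 \<in> coordinate_ring l"
  using coordinate_ring_of_rat [of 1] by simp

lemma coordinate_ring_uminus: "f \<in> coordinate_ring l \<Longrightarrow> - f \<in> coordinate_ring l"
  using coordinate_ring_mult [OF coordinate_ring_of_rat [of "- 1"], of f l] by (simp add: of_rat_minus)

lemma coordinate_ring_diff:
  "f \<in> coordinate_ring l \<Longrightarrow> g \<in> coordinate_ring l \<Longrightarrow> f - g \<in> coordinate_ring l"
  using coordinate_ring_add [of f l "- g"] by (simp add: coordinate_ring_uminus)

lemma coordinate_ring_sum:
  "(\<And>x. x \<in> S \<Longrightarrow> f x \<in> coordinate_ring l) \<Longrightarrow> sum f S \<in> coordinate_ring l"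
  by (induction S rule: infinite_finite_induct) (auto simp: coordinate_ring_add)

lemma coordinate_ring_power: "f \<in> coordinate_ring l \<Longrightarrow> f ^ k \<in> coordinate_ring l"
  by (induction k) (auto simp: coordinate_ring_mult)

lemma coordinate_ring_partial:
  assumes "f \<in> coordinate_ring l"
  shows "partial i f \<in> coordinate_ring l"
proof -
  from assms obtain p k where pk: "p \<in> polynomials l" "f = Fract p (discriminant l ^ k)"
    by (elim coordinate_ringE)
  let ?D = "discriminant l ^ k"
  have "Fract (poly_partial i p * ?D - p * poly_partial i ?D) (discriminant l ^ (k * 2)) \<in> coordinate_ring l"
    using pk(1) by (intro coordinate_ring_FractI polynomials_diff polynomials_mult
      polynomials_power discriminant_in_polynomials poly_partial_in_polynomials)
  with pk(2) show ?thesis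
    by (simp add: partial_Fract power_mult)
qed

lemma partial_eq_0:
  assumes "f \<in> coordinate_ring l" "i \<notin> {1..l}"
  shows "partial i f = 0"
proof -
  from assms obtain p k where pk: "p \<in> polynomials l" "f = Fract p (discriminant l ^ k)"
    by (elim coordinate_ringE)
  then show ?thesis
    using assms(2) poly_partial_eq_0 [OF pk(1)]
      poly_partial_eq_0 [OF polynomials_power [OF discriminant_in_polynomials]]
    by (simp add: partial_Fract Zero_fract_def eq_fract)
qed

lemma coordinate_ring_inverse:
  assumes "p * q = discriminant l" "q \<in> polynomials l"
  shows "inverse (Fract p 1) \<in> coordinate_ring l"
proof -
  have "q \<noteq> 0" "p \<noteq> 0"
    using assms(1) discriminant_nz [of l] by auto
  have "inverse (Fract p 1) = Fract q (discriminant l ^ 1)"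
    using \<open>q \<noteq> 0\<close> \<open>p \<noteq> 0\<close> by (simp add: eq_fract flip: assms(1))
  then show ?thesis
    using coordinate_ring_FractI [OF assms(2)] by metis
qed

lemma label_value_in_coordinate_ring: "a \<in> letters l \<Longrightarrow> label_value a \<in> coordinate_ring l"
  using label_value_eq [of a] coordinate_ring_poly label_poly_in_polynomials by (cases "a = Infty") auto

lemma prod_cofactor:
  assumes "finite S" "x \<in> S" "\<And>y. y \<in> S \<Longrightarrow> f y \<in> polynomials l"
  shows "\<exists>q \<in> polynomials l. f x * q = prod f S"
  using assms by (intro bexI [of _ "prod f (S - {x})"] polynomials_prod) (auto simp flip: prod.remove)

lemma cofactor_trans:
  assumes "\<exists>q \<in> polynomials l. x * q = A" "A * B = D" "B \<in> polynomials l"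
  shows "\<exists>q \<in> polynomials l. x * q = D"
proof -
  from assms(1) obtain q where "q \<in> polynomials l" "x * q = A"
    by blast
  with assms(2,3) show ?thesis
    by (intro bexI [of _ "q * B"] polynomials_mult) (auto simp: mult.assoc)
qed

text \<open>Up to sign, the difference is one of the factors of the discriminant, or it is \<open>1\<close>.\<close>

lemma discriminant_cofactor:
  assumes "a \<in> letters l" "b \<in> letters l" "a \<noteq> b"
  shows "\<exists>q \<in> polynomials l. (label_poly a - label_poly b) * q = discriminant l"
proof -
  define A B C :: qpoly where ABC: "A = (\<Prod>i\<in>{1..l}. var i)" "B = (\<Prod>i\<in>{1..l}. 1 - var i)"
    "C = (\<Prod>(i, j)\<in>{(i, j). 1 \<le> i \<and> i < j \<and> j \<le> l}. var i - var j)"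
  have D: "discriminant l = A * B * C"
    by (simp add: discriminant_def ABC)
  have mem: "A \<in> polynomials l" "B \<in> polynomials l" "C \<in> polynomials l"
    unfolding ABC
    by (auto intro!: polynomials_prod polynomials_diff var_in_polynomials one_in_polynomials)
  have A: "\<exists>q \<in> polynomials l. var i * q = discriminant l" if "i \<in> {1..l}" for i
  proof -
    from that have "\<exists>q \<in> polynomials l. var i * q = A"
      unfolding ABC by (intro prod_cofactor) (auto intro: var_in_polynomials)
    then show ?thesis
      by (rule cofactor_trans [where B = "B * C"]) (simp_all add: D mult_ac polynomials_mult mem)
  qed
  have B: "\<exists>q \<in> polynomials l. (1 - var i) * q = discriminant l" if "i \<in> {1..l}" for i
  proof -
    from that have "\<exists>q \<in> polynomials l. (1 - var i) * q = B"
      unfolding ABC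
      by (intro prod_cofactor) (auto intro!: var_in_polynomials polynomials_diff one_in_polynomials)
    then show ?thesis
      by (rule cofactor_trans [where B = "A * C"]) (simp_all add: D mult_ac polynomials_mult mem)
  qed
  have C: "\<exists>q \<in> polynomials l. (var i - var j) * q = discriminant l"
    if "i \<in> {1..l}" "j \<in> {1..l}" "i < j" for i j
  proof -
    from that have "\<exists>q \<in> polynomials l. (case (i, j) of (i, j) \<Rightarrow> var i - var j) * q = C"
      unfolding ABC
      by (intro prod_cofactor finite_ordered_pairs) (auto intro!: var_in_polynomials polynomials_diff)
    then show ?thesis
      unfolding case_prod_conv
      by (rule cofactor_trans [where B = "A * B"]) (simp_all add: D mult_ac polynomials_mult mem)
  qed
  have neg: "\<exists>q \<in> polynomials l. (y - x) * q = discriminant l"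
    if "\<exists>q \<in> polynomials l. (x - y) * q = discriminant l" for x y :: qpoly
  proof -
    from that obtain q where "q \<in> polynomials l" "(x - y) * q = discriminant l"
      by blast
    then show ?thesis
      by (intro bexI [of _ "- q"] polynomials_uminus) (auto simp: algebra_simps)
  qed
  have C': "\<exists>q \<in> polynomials l. (var i - var j) * q = discriminant l"
    if "i \<in> {1..l}" "j \<in> {1..l}" "i \<noteq> j" for i j
    using C [of i j] neg [OF C [of j i]] that by (metis nat_neq_iff)
  have U: "\<exists>q \<in> polynomials l. 1 * q = discriminant l"
    using discriminant_in_polynomials by auto
  have A': "\<exists>q \<in> polynomials l. - var i * q = discriminant l" if "i \<in> {1..l}" for i
    using neg [of "var i" 0] A [OF that] by simp
  have U': "\<exists>q \<in> polynomials l. - 1 * q = discriminant l"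
    using neg [of 1 0] U by simp
  show ?thesis
  proof (cases a; cases b)
    fix i j
    assume "a = T i" "b = T j"
    with assms C' show ?thesis
      by (auto simp: letters_def)
  qed (use assms A A' B neg [OF B] U U' in \<open>auto simp: letters_def\<close>)
qed

lemma inverse_difference_in_coordinate_ring:
  assumes "a \<in> letters l" "b \<in> letters l" "a \<noteq> b"
  shows "1 / (label_value a - label_value b) \<in> coordinate_ring l"
proof -
  obtain q where q: "q \<in> polynomials l" "(label_poly a - label_poly b) * q = discriminant l"
    using discriminant_cofactor [OF assms] by blast
  have "a \<noteq> Infty" "b \<noteq> Infty"
    using assms by auto
  then show ?thesis
    using coordinate_ring_inverse [OF q(2,1)] by (simp add: label_value_eq field_class.field_divide_inverse del: inverse_fract)
qed

text \<open>The factors that involve the last coordinate are those of the punctures of the fibre over the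
  remaining coordinates.\<close>

lemma discriminant_Suc:
  "discriminant (Suc l) = discriminant l *
     (var (Suc l) * (1 - var (Suc l)) * (\<Prod>i\<in>{1..l}. var i - var (Suc l)))"
proof -
  have "{(i, j). 1 \<le> i \<and> i < j \<and> j \<le> Suc l} =
      {(i, j). 1 \<le> i \<and> i < j \<and> j \<le> l} \<union> (\<lambda>i. (i, Suc l)) ` {1..l}"
    by auto
  then have "(\<Prod>(i, j)\<in>{(i, j). 1 \<le> i \<and> i < j \<and> j \<le> Suc l}. var i - var j) =
      (\<Prod>(i, j)\<in>{(i, j). 1 \<le> i \<and> i < j \<and> j \<le> l}. var i - var j) *
      (\<Prod>(i, j)\<in>(\<lambda>i. (i, Suc l)) ` {1..l}. var i - var j)"
    by (simp only:) (rule prod.union_disjoint, auto simp: finite_ordered_pairs)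
  also have "(\<Prod>(i, j)\<in>(\<lambda>i. (i, Suc l)) ` {1..l}. var i - var j) = (\<Prod>i\<in>{1..l}. var i - var (Suc l))"
    by (subst prod.reindex) (auto simp: inj_on_def)
  finally show ?thesis
    by (simp add: discriminant_def mult_ac)
qed

lemma coordinate_ring_Suc: "coordinate_ring l \<subseteq> coordinate_ring (Suc l)"
proof
  fix f
  assume "f \<in> coordinate_ring l"
  then obtain p k where pk: "p \<in> polynomials l" "f = Fract p (discriminant l ^ k)"
    by (elim coordinate_ringE)
  define e where "e = var (Suc l) * (1 - var (Suc l)) * (\<Prod>i\<in>{1..l}. var i - var (Suc l))"
  have D: "discriminant (Suc l) = discriminant l * e"
    unfolding e_def by (rule discriminant_Suc)
  then have "e \<noteq> 0"
    using discriminant_nz [of "Suc l"] by auto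
  have "e \<in> polynomials (Suc l)"
    unfolding e_def by (intro polynomials_mult polynomials_prod polynomials_diff)
      (auto intro!: var_in_polynomials one_in_polynomials)
  then have "Fract (p * e ^ k) (discriminant (Suc l) ^ k) \<in> coordinate_ring (Suc l)"
    using pk polynomials_mono [of l "Suc l"]
    by (intro coordinate_ring_FractI polynomials_mult polynomials_power) auto
  moreover have "Fract (p * e ^ k) (discriminant (Suc l) ^ k) = f"
    using \<open>e \<noteq> 0\<close> by (simp add: D pk eq_fract power_mult_distrib)
  ultimately show "f \<in> coordinate_ring (Suc l)"
    by simp
qed

section \<open>Partial fractions in the last coordinate\<close>

declare label_value.simps(3) [simp del]

abbreviation coord :: "nat \<Rightarrow> ratfun" where
  "coord i \<equiv> label_value (T i)"

definition simple_pole :: "nat \<Rightarrow> label \<Rightarrow> ratfun" where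
  "simple_pole l a = inverse (coord (Suc l) - label_value a)"

lemma finite_letters [simp]: "finite (letters l)"
  by (simp add: letters_def)

lemma letters_Suc: "letters (Suc l) = insert (T (Suc l)) (letters l)"
proof -
  have "{1..Suc l} = insert (Suc l) {1..l}"
    by auto
  then show ?thesis
    unfolding letters_def by auto
qed

lemma T_Suc_notin_letters [simp]: "T (Suc l) \<notin> letters l"
  by (auto simp: letters_def)

lemma not_Infty_letters: "a \<in> letters l \<Longrightarrow> a \<noteq> Infty"
  by auto

lemma coord_diff_nz: "a \<in> letters l \<Longrightarrow> coord (Suc l) - label_value a \<noteq> 0"
  using label_value_inj [of "T (Suc l)" a] by (auto simp: letters_def)

lemma coord_times_simple_pole:
  "a \<in> letters l \<Longrightarrow> coord (Suc l) * simple_pole l a = 1 + label_value a * simple_pole l a"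
  using coord_diff_nz [of a l] by (simp add: simple_pole_def field_simps)

text \<open>The coefficient on the right lies in the coordinate ring of the base, because the difference of two
  punctures is a unit there. This makes partial fractions possible without passing to a field.\<close>

lemma simple_pole_times_simple_pole:
  assumes "a \<in> letters l" "b \<in> letters l" "a \<noteq> b"
  shows "simple_pole l b * simple_pole l a =
    1 / (label_value b - label_value a) * (simple_pole l b - simple_pole l a)"
proof -
  have "label_value b - label_value a \<noteq> 0"
    using assms label_value_inj [of b a] not_Infty_letters by auto
  then show ?thesis
    using coord_diff_nz [of a l] coord_diff_nz [of b l] assms
    by (simp add: simple_pole_def divide_simps)
qed

lemma simple_pole_in_coordinate_ring:
  assumes "a \<in> letters l"
  shows "simple_pole l a \<in> coordinate_ring (Suc l)"
proof -
  have "T (Suc l) \<noteq> a"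
    using assms T_Suc_notin_letters by metis
  then show ?thesis
    using inverse_difference_in_coordinate_ring [of "T (Suc l)" "Suc l" a] assms
    by (simp add: simple_pole_def letters_Suc inverse_eq_divide)
qed

lemma partial_coord: "partial i (coord j) = (if i = j then 1 else 0)"
  by (simp add: label_value.simps(3) partial_poly poly_partial_var Zero_fract_def One_fract_def)

lemma partial_label_value: "a \<in> letters l \<Longrightarrow> partial (Suc l) (label_value a) = 0"
  by (rule partial_eq_0 [OF label_value_in_coordinate_ring]) auto

lemma partial_simple_pole: "a \<in> letters l \<Longrightarrow> partial (Suc l) (simple_pole l a) = - (simple_pole l a)\<^sup>2"
  by (simp add: simple_pole_def partial_inverse partial_diff partial_coord partial_label_value
      divide_inverse power_inverse)

text \<open>The span over the base ring of all powers of \<open>t = coord (Suc l)\<close> and of all pole parts at the punctures.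
  It will turn out to be the whole coordinate ring.\<close>

inductive_set simple_fractions :: "nat \<Rightarrow> ratfun set" for l where
  zero: "0 \<in> simple_fractions l"
| add: "f \<in> simple_fractions l \<Longrightarrow> g \<in> simple_fractions l \<Longrightarrow> f + g \<in> simple_fractions l"
| monomial: "g \<in> coordinate_ring l \<Longrightarrow> g * coord (Suc l) ^ k \<in> simple_fractions l"
| pole: "g \<in> coordinate_ring l \<Longrightarrow> a \<in> letters l \<Longrightarrow>
    g * simple_pole l a ^ Suc k \<in> simple_fractions l"

lemma simple_fractions_mult_base:
  assumes "f \<in> simple_fractions l" "c \<in> coordinate_ring l"
  shows "c * f \<in> simple_fractions l"
  using assms(1)
proof induction
  case (add f g)
  then show ?case
    by (simp add: distrib_left simple_fractions.add)
next
  case (monomial g k)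
  then show ?case
    using simple_fractions.monomial [OF coordinate_ring_mult [OF assms(2)], of g k] by (simp add: mult.assoc)
next
  case (pole g a k)
  then show ?case
    using simple_fractions.pole [OF coordinate_ring_mult [OF assms(2)], of g a k] by (simp only: mult.assoc)
qed (simp add: simple_fractions.zero)

lemma simple_fractions_pole_power:
  "a \<in> letters l \<Longrightarrow> simple_pole l a ^ k \<in> simple_fractions l"
  using simple_fractions.pole [of 1 l a "k - 1"] simple_fractions.monomial [of 1 l 0]
  by (cases k) auto

lemma simple_fractions_mult_coord:
  assumes "f \<in> simple_fractions l"
  shows "coord (Suc l) * f \<in> simple_fractions l"
  using assms
proof induction
  case (add f g)
  then show ?case
    by (simp add: distrib_left simple_fractions.add)
next
  case (monomial g k)
  then show ?case
    using simple_fractions.monomial [of g l "Suc k"] by (simp add: mult_ac)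
next
  case (pole g a k)
  have "coord (Suc l) * (g * simple_pole l a ^ Suc k) =
      g * simple_pole l a ^ k * (coord (Suc l) * simple_pole l a)"
    by (simp add: mult_ac)
  also have "\<dots> = g * simple_pole l a ^ k + label_value a * (g * simple_pole l a ^ Suc k)"
    using pole by (simp only: coord_times_simple_pole) (simp add: algebra_simps)
  also have "\<dots> \<in> simple_fractions l"
    using pole by (intro simple_fractions.add simple_fractions_mult_base simple_fractions.pole
      label_value_in_coordinate_ring simple_fractions_pole_power)
  finally show ?case .
qed (simp add: simple_fractions.zero)

text \<open>Induction on the exponent: one factor of the polar part, or of the power of \<open>t\<close>, is combined with
  the new pole, which lowers the exponent in the mixed term.\<close>

lemma simple_fractions_mult_pole:
  assumes f: "f \<in> simple_fractions l" and a: "a \<in> letters l"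
  shows "simple_pole l a * f \<in> simple_fractions l"
  using f
proof induction
  case (add f g)
  then show ?case
    by (simp add: distrib_left simple_fractions.add)
next
  case (monomial g k)
  have "simple_pole l a * coord (Suc l) ^ k \<in> simple_fractions l"
  proof (induction k)
    case 0
    then show ?case
      using simple_fractions_pole_power [OF a, of 1] by simp
  next
    case (Suc k)
    have "simple_pole l a * coord (Suc l) ^ Suc k =
        coord (Suc l) ^ k * (coord (Suc l) * simple_pole l a)"
      by (simp add: mult_ac)
    also have "\<dots> = 1 * coord (Suc l) ^ k + label_value a * (simple_pole l a * coord (Suc l) ^ k)"
      using a by (simp only: coord_times_simple_pole) (simp add: algebra_simps)
    also have "\<dots> \<in> simple_fractions l"
      by (rule simple_fractions.add [OF simple_fractions.monomial [OF coordinate_ring_1]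
        simple_fractions_mult_base [OF Suc label_value_in_coordinate_ring [OF a]]])
    finally show ?case .
  qed
  then show ?case
    using simple_fractions_mult_base [of "simple_pole l a * coord (Suc l) ^ k" l g] monomial
    by (simp add: mult_ac)
next
  case (pole g b k)
  have "simple_pole l a * simple_pole l b ^ k \<in> simple_fractions l" for k
  proof (cases "a = b")
    case True
    then show ?thesis
      using simple_fractions_pole_power [OF a, of "Suc k"] by simp
  next
    case False
    define c where "c = 1 / (label_value b - label_value a)"
    have c: "c \<in> coordinate_ring l"
      unfolding c_def using False a pole by (intro inverse_difference_in_coordinate_ring) auto
    show ?thesis
    proof (induction k)
      case 0
      then show ?case
        using simple_fractions_pole_power [OF a, of 1] by simp
    next
      case (Suc k)
      have "simple_pole l a * simple_pole l b ^ Suc k =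
          simple_pole l b ^ k * (simple_pole l b * simple_pole l a)"
        by (simp add: mult_ac)
      also have "\<dots> = c * simple_pole l b ^ Suc k + (- c) * (simple_pole l a * simple_pole l b ^ k)"
        using simple_pole_times_simple_pole [OF a _ False] pole
        by (simp add: c_def [symmetric]) (simp add: algebra_simps)
      also have "\<dots> \<in> simple_fractions l"
        by (rule simple_fractions.add [OF simple_fractions.pole [OF c pole(2)]
          simple_fractions_mult_base [OF Suc coordinate_ring_uminus [OF c]]])
      finally show ?case .
    qed
  qed
  from simple_fractions_mult_base [OF this [of "Suc k"] pole(1)] show ?case
    by (simp only: mult_ac)
qed (simp add: simple_fractions.zero)

lemma simple_fractions_mult_poly:
  assumes "p \<in> polynomials (Suc l)" "f \<in> simple_fractions l"
  shows "Fract p 1 * f \<in> simple_fractions l"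
  using assms
proof (induction p arbitrary: f rule: polynomials_induct)
  case (const c)
  then show ?case
    using simple_fractions_mult_base [OF _ coordinate_ring_of_rat, of f l c]
    by (simp add: of_rat_ratfun)
next
  case (var i)
  then show ?case
    using simple_fractions_mult_base [OF _ label_value_in_coordinate_ring [of "T i"], of f l]
      simple_fractions_mult_coord [of f l]
    by (cases "i = Suc l") (auto simp: letters_def le_Suc_eq label_value.simps(3))
next
  case (add p q)
  have "Fract (p + q) 1 * f = Fract p 1 * f + Fract q 1 * f"
    by (simp flip: distrib_right)
  with add show ?case
    by (simp add: simple_fractions.add)
next
  case (mult p q)
  have "Fract (p * q) 1 * f = Fract p 1 * (Fract q 1 * f)"
    by (simp flip: mult.assoc)
  then show ?case
    using mult by (simp only:)
qed

lemma simple_fractions_mult_inverse_factor: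
  assumes "f \<in> simple_fractions l" "a \<in> letters l"
  shows "inverse (label_value a - coord (Suc l)) * f \<in> simple_fractions l"
proof -
  have "inverse (label_value a - coord (Suc l)) * f = (- 1) * (simple_pole l a * f)"
    unfolding simple_pole_def by (metis inverse_minus_eq minus_diff_eq minus_mult_left mult_1)
  also have "\<dots> \<in> simple_fractions l"
    using assms coordinate_ring_uminus [OF coordinate_ring_1]
    by (intro simple_fractions_mult_base simple_fractions_mult_pole)
  finally show ?thesis .
qed

text \<open>The inverse of the discriminant is a product of a unit of the base and of simple poles, up to
  sign.\<close>

lemma simple_fractions_mult_inverse_discriminant:
  assumes "f \<in> simple_fractions l"
  shows "inverse (Fract (discriminant (Suc l)) 1) * f \<in> simple_fractions l"
proof -
  have prod: "inverse (\<Prod>i\<in>S. label_value (T i) - coord (Suc l)) * f \<in> simple_fractions l"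
    if "S \<subseteq> {1..l}" "f \<in> simple_fractions l" for S f
    using finite_subset [OF that(1)] that
  proof (induction S arbitrary: f rule: infinite_finite_induct)
    case (insert i S)
    then have "inverse (\<Prod>i\<in>S. label_value (T i) - coord (Suc l)) *
        (inverse (label_value (T i) - coord (Suc l)) * f) \<in> simple_fractions l"
      by (intro insert.IH simple_fractions_mult_inverse_factor) (auto simp: letters_def)
    with insert(1,2) show ?case
      by (simp add: inverse_mult_distrib mult_ac)
  qed auto
  have Fprod: "Fract (\<Prod>i\<in>S. var i - var (Suc l)) 1 = (\<Prod>i\<in>S. label_value (T i) - coord (Suc l))" for S
  proof (induction S rule: infinite_finite_induct)
    case (insert i S)
    have "Fract (\<Prod>i\<in>insert i S. var i - var (Suc l)) 1 =
        Fract (var i - var (Suc l)) 1 * Fract (\<Prod>i\<in>S. var i - var (Suc l)) 1"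
      using insert(1,2) by simp
    with insert show ?case
      by (simp add: label_value.simps(3))
  qed (auto simp: One_fract_def)
  have split: "Fract (discriminant (Suc l)) 1 = Fract (discriminant l) 1 *
     (coord (Suc l) * ((label_value One - coord (Suc l)) * (\<Prod>i\<in>{1..l}. label_value (T i) - coord (Suc l))))"
    unfolding Fprod [symmetric] discriminant_Suc by (simp add: label_value.simps(3) One_fract_def mult.assoc)
  have D: "inverse (Fract (discriminant l) 1) \<in> coordinate_ring l"
    by (rule coordinate_ring_inverse [of _ 1]) (auto simp: one_in_polynomials)
  have "inverse (Fract (discriminant (Suc l)) 1) * f =
     inverse (Fract (discriminant l) 1) * (simple_pole l Zero *
       (inverse (label_value One - coord (Suc l)) *
         (inverse (\<Prod>i\<in>{1..l}. label_value (T i) - coord (Suc l)) * f)))"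
    unfolding split by (simp only: inverse_mult_distrib simple_pole_def label_value.simps(1) diff_zero mult_ac)
  also have "\<dots> \<in> simple_fractions l"
    using assms D by (intro simple_fractions_mult_base simple_fractions_mult_pole
      simple_fractions_mult_inverse_factor prod) (auto simp: letters_def)
  finally show ?thesis .
qed

lemma coordinate_ring_subset_simple_fractions:
  assumes "f \<in> coordinate_ring (Suc l)"
  shows "f \<in> simple_fractions l"
proof -
  obtain p k where pk: "p \<in> polynomials (Suc l)" "f = Fract p (discriminant (Suc l) ^ k)"
    using assms by (elim coordinate_ringE)
  have "inverse (Fract (discriminant (Suc l)) 1) ^ k \<in> simple_fractions l"
    using simple_fractions_mult_inverse_discriminant [of _ l] simple_fractions_pole_power [of Zero l 0]
    by (induction k) (auto simp: letters_def)
  then have "Fract p 1 * inverse (Fract (discriminant (Suc l)) 1) ^ k \<in> simple_fractions l"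
    using pk by (intro simple_fractions_mult_poly)
  moreover have "inverse (Fract (discriminant (Suc l)) 1) ^ k = Fract 1 (discriminant (Suc l) ^ k)"
    by (induction k) (auto simp: One_fract_def)
  ultimately show ?thesis
    using pk by simp
qed

text \<open>All powers of \<open>t - a\<close> except the power \<open>-1\<close> have a primitive, and elements of the base are constants for
  \<open>\<partial>/\<partial>t\<close>.\<close>

lemma simple_fractions_reduce:
  assumes "f \<in> simple_fractions l"
  shows "\<exists>G g. G \<in> coordinate_ring (Suc l) \<and> (\<forall>a\<in>letters l. g a \<in> coordinate_ring l) \<and>
    f = partial (Suc l) G + (\<Sum>a\<in>letters l. g a * simple_pole l a)"
  using assms
proof induction
  case zero
  then show ?case
    by (intro exI [of _ 0] exI [of _ "\<lambda>_. 0"]) auto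
next
  case (add f f')
  from add.IH(1) obtain G g where G: "G \<in> coordinate_ring (Suc l)"
    "\<forall>a\<in>letters l. g a \<in> coordinate_ring l"
    "f = partial (Suc l) G + (\<Sum>a\<in>letters l. g a * simple_pole l a)"
    by blast
  from add.IH(2) obtain G' g' where G': "G' \<in> coordinate_ring (Suc l)"
    "\<forall>a\<in>letters l. g' a \<in> coordinate_ring l"
    "f' = partial (Suc l) G' + (\<Sum>a\<in>letters l. g' a * simple_pole l a)"
    by blast
  show ?case
    using G(1,2) G'(1,2) unfolding G(3) G'(3)
    by (intro exI [of _ "G + G'"] exI [of _ "\<lambda>a. g a + g' a"])
      (simp add: partial_add sum.distrib distrib_right coordinate_ring_add)
next
  case (monomial g k)
  define c where "c = (of_rat (1 / of_nat (Suc k)) :: ratfun)"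
  have c: "c * of_nat (Suc k) = 1" "partial (Suc l) c = 0"
    by (simp add: c_def of_rat_divide del: of_nat_Suc) (simp only: c_def partial_of_rat)
  have "partial (Suc l) (c * g * coord (Suc l) ^ Suc k) = c * of_nat (Suc k) * (g * coord (Suc l) ^ k)"
    unfolding partial_mult partial_power partial_coord partial_eq_0 [OF monomial(1), of "Suc l", simplified] c(2)
    by simp
  then have "g * coord (Suc l) ^ k = partial (Suc l) (c * g * coord (Suc l) ^ Suc k)"
    unfolding c(1) by simp
  moreover have "c * g * coord (Suc l) ^ Suc k \<in> coordinate_ring (Suc l)"
    using monomial coordinate_ring_Suc [of l]
    by (intro coordinate_ring_mult coordinate_ring_power label_value_in_coordinate_ring)
      (auto simp: c_def letters_def coordinate_ring_of_rat)
  ultimately show ?case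
    by (intro exI [of _ "c * g * coord (Suc l) ^ Suc k"] exI [of _ "\<lambda>_. 0"]) auto
next
  case (pole g a k)
  show ?case
  proof (cases k)
    case 0
    have "(\<Sum>b\<in>letters l. (if b = a then g else 0) * simple_pole l b) =
        (\<Sum>b\<in>letters l. if b = a then g * simple_pole l a else 0)"
      by (rule sum.cong) auto
    also have "\<dots> = g * simple_pole l a"
      using pole by (simp add: sum.delta')
    finally show ?thesis
      using 0 pole by (intro exI [of _ 0] exI [of _ "\<lambda>b. if b = a then g else 0"]) auto
  next
    case (Suc m)
    define c where "c = (of_rat (- 1 / of_nat (Suc m)) :: ratfun)"
    have c: "c * of_nat (Suc m) = - 1" "partial (Suc l) c = 0"
      by (simp add: c_def of_rat_divide of_rat_minus del: of_nat_Suc) (simp only: c_def partial_of_rat)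
    have "partial (Suc l) (c * g * simple_pole l a ^ Suc m) =
        c * of_nat (Suc m) * - (g * simple_pole l a ^ Suc k)"
      unfolding partial_mult partial_power partial_simple_pole [OF pole(2)]
        partial_eq_0 [OF pole(1), of "Suc l", simplified] c(2)
      by (simp add: Suc power2_eq_square)
    then have "g * simple_pole l a ^ Suc k = partial (Suc l) (c * g * simple_pole l a ^ Suc m)"
      unfolding c(1) by simp
    moreover have "c * g * simple_pole l a ^ Suc m \<in> coordinate_ring (Suc l)"
      using pole coordinate_ring_Suc [of l]
      by (intro coordinate_ring_mult coordinate_ring_power simple_pole_in_coordinate_ring)
        (auto simp: c_def coordinate_ring_of_rat)
    ultimately show ?thesis
      by (intro exI [of _ "c * g * simple_pole l a ^ Suc m"] exI [of _ "\<lambda>_. 0"]) auto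
  qed
qed

lemmas partial_fractions = simple_fractions_reduce [OF coordinate_ring_subset_simple_fractions]

section \<open>Laurent expansion and residues at the punctures\<close>

definition monomial_value :: "(nat \<Rightarrow> 'a::field_char_0) \<Rightarrow> (nat \<Rightarrow>\<^sub>0 nat) \<Rightarrow> 'a" where
  "monomial_value x m = (\<Prod>i\<in>Poly_Mapping.keys m. x i ^ Poly_Mapping.lookup m i)"

text \<open>The evaluation homomorphism at the point \<open>x\<close>.\<close>

definition insertion :: "(nat \<Rightarrow> 'a::field_char_0) \<Rightarrow> qpoly \<Rightarrow> 'a" where
  "insertion x p = (\<Sum>m\<in>Poly_Mapping.keys p. of_rat (Poly_Mapping.lookup p m) * monomial_value x m)"

lemma monomial_value_superset:
  assumes "finite S" "Poly_Mapping.keys m \<subseteq> S"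
  shows "monomial_value x m = (\<Prod>i\<in>S. x i ^ Poly_Mapping.lookup m i)"
  unfolding monomial_value_def using assms
  by (intro prod.mono_neutral_left) (auto simp: in_keys_iff)

lemma monomial_value_add: "monomial_value x (m + k) = monomial_value x m * monomial_value x k"
proof -
  let ?S = "Poly_Mapping.keys m \<union> Poly_Mapping.keys k"
  have "monomial_value x (m + k) = (\<Prod>i\<in>?S. x i ^ Poly_Mapping.lookup (m + k) i)"
    by (rule monomial_value_superset) (auto dest: subsetD [OF keys_add])
  moreover have "monomial_value x m = (\<Prod>i\<in>?S. x i ^ Poly_Mapping.lookup m i)"
    by (rule monomial_value_superset) auto
  moreover have "monomial_value x k = (\<Prod>i\<in>?S. x i ^ Poly_Mapping.lookup k i)"
    by (rule monomial_value_superset) auto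
  ultimately show ?thesis
    by (simp add: lookup_add power_add prod.distrib)
qed

lemma insertion_single: "insertion x (Poly_Mapping.single m c) = of_rat c * monomial_value x m"
  by (simp add: insertion_def)

lemma insertion_const: "insertion x (Poly_Mapping.single 0 c) = of_rat c"
  by (simp add: insertion_single monomial_value_def)

lemma insertion_0 [simp]: "insertion x 0 = 0"
  by (simp add: insertion_def)

lemma insertion_1 [simp]: "insertion x 1 = 1"
  using insertion_const [of x 1] by simp

lemma insertion_var: "insertion x (var i) = x i"
  by (simp add: var_def insertion_single monomial_value_def)

lemma insertion_add: "insertion x (p + q) = insertion x p + insertion x q"
  unfolding insertion_def
  by (rule setsum_keys_plus_distrib) (auto simp: of_rat_add distrib_right)

lemma insertion_sum: "insertion x (sum f S) = (\<Sum>y\<in>S. insertion x (f y))"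
  by (induction S rule: infinite_finite_induct) (auto simp: insertion_add)

lemma insertion_uminus: "insertion x (- p) = - insertion x p"
  using insertion_add [of x p "- p"] by (simp add: eq_neg_iff_add_eq_0 add.commute)

lemma insertion_diff: "insertion x (p - q) = insertion x p - insertion x q"
  using insertion_add [of x p "- q"] by (simp add: insertion_uminus)

lemma insertion_mult: "insertion x (p * q) = insertion x p * insertion x q"
proof -
  let ?s = "\<lambda>p m. Poly_Mapping.single m (Poly_Mapping.lookup p m) :: qpoly"
  have "insertion x ((\<Sum>m\<in>A. ?s p m) * (\<Sum>k\<in>B. ?s q k)) =
      insertion x (\<Sum>m\<in>A. ?s p m) * insertion x (\<Sum>k\<in>B. ?s q k)" for A B
    by (simp add: sum_product insertion_sum insertion_single mult_single monomial_value_add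
        of_rat_mult mult_ac)
  from this [of "Poly_Mapping.keys p" "Poly_Mapping.keys q"] show ?thesis
    by (simp flip: qpoly_monomials)
qed

lemma insertion_power: "insertion x (p ^ k) = insertion x p ^ k"
  by (induction k) (auto simp: insertion_mult)

lemma insertion_prod: "insertion x (prod f S) = (\<Prod>y\<in>S. insertion x (f y))"
  by (induction S rule: infinite_finite_induct) (auto simp: insertion_mult)

text \<open>The Taylor expansion at the puncture \<open>t = a\<close>: the last coordinate becomes \<open>a + X\<close>, and the other
  coordinates are treated as constants.\<close>

definition poly_expansion :: "nat \<Rightarrow> label \<Rightarrow> qpoly \<Rightarrow> ratfun fls" where
  "poly_expansion l a =
     insertion (\<lambda>i. if i = Suc l then fls_const (label_value a) + fls_X else fls_const (coord i))"

lemma poly_expansion_hom: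
  "poly_expansion l a (p + q) = poly_expansion l a p + poly_expansion l a q"
  "poly_expansion l a (p - q) = poly_expansion l a p - poly_expansion l a q"
  "poly_expansion l a (p * q) = poly_expansion l a p * poly_expansion l a q"
  "poly_expansion l a (p ^ k) = poly_expansion l a p ^ k"
  "poly_expansion l a (prod f S) = (\<Prod>y\<in>S. poly_expansion l a (f y))"
  by (simp_all add: poly_expansion_def insertion_add insertion_diff insertion_mult insertion_power
      insertion_prod)

lemma fls_const_of_rat: "fls_const (of_rat c :: ratfun) = of_rat c"
proof -
  have nat: "fls_const (of_nat n :: ratfun) = of_nat n" for n
    by (simp add: fls_of_nat)
  have int: "fls_const (of_int z :: ratfun) = of_int z" for z
    by (simp add: fls_of_int)
  obtain a b where c: "c = of_int a / of_int b" "b \<noteq> 0"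
    by (metis Fract_of_int_quotient Rat_cases of_int_0_eq_iff less_irrefl)
  have "fls_const (of_rat c :: ratfun) * of_int b = of_int a"
    unfolding int [symmetric] fls_const_mult_const using c by (simp add: of_rat_divide)
  moreover have "of_rat c * (of_int b :: ratfun fls) = of_int a"
    using c by (simp add: of_rat_divide)
  ultimately show ?thesis
    using c(2) by (metis mult_right_cancel of_int_0_eq_iff)
qed

lemma poly_expansion_const [simp]:
  "poly_expansion l a (Poly_Mapping.single 0 c) = fls_const (of_rat c)"
  by (simp add: poly_expansion_def insertion_const fls_const_of_rat)

lemma poly_expansion_0 [simp]: "poly_expansion l a 0 = 0"
  by (simp add: poly_expansion_def)

lemma poly_expansion_1 [simp]: "poly_expansion l a 1 = 1"
  by (simp add: poly_expansion_def)

lemma poly_expansion_var: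
  "poly_expansion l a (var i) =
    (if i = Suc l then fls_const (label_value a) + fls_X else fls_const (coord i))"
  by (simp add: poly_expansion_def insertion_var)

lemma poly_expansion_base:
  "p \<in> polynomials l \<Longrightarrow> poly_expansion l a p = fls_const (Fract p 1)"
proof (induction p rule: polynomials_induct)
  case (const c)
  then show ?case
    by (simp add: of_rat_ratfun)
next
  case (var i)
  then show ?case
    by (simp add: poly_expansion_var label_value.simps(3))
next
  case (add p q)
  then show ?case
    by (simp add: poly_expansion_hom fls_plus_const)
next
  case (mult p q)
  then show ?case
    by (simp add: poly_expansion_hom fls_const_mult_const)
qed

text \<open>Both sides are derivations along the ring homomorphism \<open>poly_expansion l a\<close>, so it suffices to compare
  them on the generators.\<close>

lemma poly_expansion_deriv:
  "p \<in> polynomials (Suc l) \<Longrightarrow>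
    poly_expansion l a (poly_partial (Suc l) p) = fls_deriv (poly_expansion l a p)"
proof (induction p rule: polynomials_induct)
  case (mult p q)
  then show ?case
    by (simp add: poly_expansion_hom poly_partial_mult algebra_simps)
qed (auto simp: poly_expansion_hom poly_partial_add poly_partial_var poly_expansion_var)

lemma fls_const_plus_X_nz: "fls_const (c::ratfun) + fls_X \<noteq> 0" "fls_const c - fls_X \<noteq> 0"
proof -
  have "fls_nth (fls_const c + fls_X) 1 = 1" "fls_nth (fls_const c - fls_X) 1 = - 1"
    by simp_all
  then show "fls_const c + fls_X \<noteq> 0" "fls_const c - fls_X \<noteq> 0"
    by (metis fls_zero_nth zero_neq_one neg_equal_0_iff_equal)+
qed

lemma poly_expansion_discriminant_nz: "poly_expansion l a (discriminant (Suc l)) \<noteq> 0"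
proof -
  have 1: "poly_expansion l a (discriminant l) \<noteq> 0"
    by (simp add: poly_expansion_base discriminant_in_polynomials Zero_fract_def eq_fract fls_const_nonzero)
  have 2: "1 - (fls_const c + fls_X) \<noteq> 0" "fls_const b - (fls_const c + fls_X) \<noteq> 0" for b c :: ratfun
    using fls_const_plus_X_nz(2) [of "1 - c"] fls_const_plus_X_nz(2) [of "b - c"]
    by (simp_all add: algebra_simps flip: fls_minus_const fls_const_1)
  show ?thesis
    unfolding discriminant_Suc using 1 2
    by (auto simp: poly_expansion_hom poly_expansion_var fls_const_plus_X_nz)
qed

text \<open>A fraction is expanded through a denominator with nonzero expansion. Elements of the coordinate ring
  have one, namely a power of the discriminant, and the result does not depend on its choice.\<close>

definition expansion :: "nat \<Rightarrow> label \<Rightarrow> ratfun \<Rightarrow> ratfun fls" where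
  "expansion l a f = (SOME z. \<exists>p q. poly_expansion l a q \<noteq> 0 \<and> f = Fract p q \<and>
     z = poly_expansion l a p / poly_expansion l a q)"

lemma expansion_Fract:
  assumes "poly_expansion l a q \<noteq> 0"
  shows "expansion l a (Fract p q) = poly_expansion l a p / poly_expansion l a q"
  unfolding expansion_def
proof (rule some_equality)
  show "\<exists>p' q'. poly_expansion l a q' \<noteq> 0 \<and> Fract p q = Fract p' q' \<and>
     poly_expansion l a p / poly_expansion l a q = poly_expansion l a p' / poly_expansion l a q'"
    using assms by blast
next
  fix z
  assume "\<exists>p' q'. poly_expansion l a q' \<noteq> 0 \<and> Fract p q = Fract p' q' \<and>
     z = poly_expansion l a p' / poly_expansion l a q'"
  then obtain p' q' where *: "poly_expansion l a q' \<noteq> 0" "Fract p q = Fract p' q'"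
    "z = poly_expansion l a p' / poly_expansion l a q'"
    by blast
  have "q \<noteq> 0" "q' \<noteq> 0"
    using assms *(1) by auto
  then have "p * q' = p' * q"
    using *(2) by (simp add: eq_fract)
  then have "poly_expansion l a p * poly_expansion l a q' = poly_expansion l a p' * poly_expansion l a q"
    by (metis poly_expansion_hom(3))
  then show "z = poly_expansion l a p / poly_expansion l a q"
    using assms * by (simp add: frac_eq_eq)
qed

lemma coordinate_ring_expansionE:
  assumes "f \<in> coordinate_ring (Suc l)"
  obtains p q where "p \<in> polynomials (Suc l)" "q \<in> polynomials (Suc l)" "f = Fract p q"
    "poly_expansion l a q \<noteq> 0" "q \<noteq> 0"
proof -
  from assms obtain p k where "p \<in> polynomials (Suc l)" "f = Fract p (discriminant (Suc l) ^ k)"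
    by (elim coordinate_ringE)
  then show ?thesis
    using that [of p "discriminant (Suc l) ^ k"] poly_expansion_discriminant_nz [of l a]
    by (simp add: poly_expansion_hom polynomials_power discriminant_in_polynomials)
qed

lemma expansion_add:
  assumes "f \<in> coordinate_ring (Suc l)" "g \<in> coordinate_ring (Suc l)"
  shows "expansion l a (f + g) = expansion l a f + expansion l a g"
proof -
  obtain p q where 1: "f = Fract p q" "poly_expansion l a q \<noteq> 0" "q \<noteq> 0"
    using assms(1) by (rule coordinate_ring_expansionE)
  obtain r s where 2: "g = Fract r s" "poly_expansion l a s \<noteq> 0" "s \<noteq> 0"
    using assms(2) by (rule coordinate_ring_expansionE)
  show ?thesis
    using 1(2) 2(2) by (simp add: 1(1,3) 2(1,3) expansion_Fract poly_expansion_hom add_frac_eq)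
qed

lemma expansion_mult:
  assumes "f \<in> coordinate_ring (Suc l)" "g \<in> coordinate_ring (Suc l)"
  shows "expansion l a (f * g) = expansion l a f * expansion l a g"
proof -
  obtain p q where 1: "f = Fract p q" "poly_expansion l a q \<noteq> 0" "q \<noteq> 0"
    using assms(1) by (rule coordinate_ring_expansionE)
  obtain r s where 2: "g = Fract r s" "poly_expansion l a s \<noteq> 0" "s \<noteq> 0"
    using assms(2) by (rule coordinate_ring_expansionE)
  show ?thesis
    using 1(2) 2(2) by (simp add: 1(1,3) 2(1,3) expansion_Fract poly_expansion_hom)
qed

text \<open>The quotient rule, with the denominator cleared.\<close>

lemma expansion_partial:
  assumes "f \<in> coordinate_ring (Suc l)"
  shows "expansion l a (partial (Suc l) f) = fls_deriv (expansion l a f)"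
proof -
  obtain p q where 1: "p \<in> polynomials (Suc l)" "q \<in> polynomials (Suc l)" "f = Fract p q"
    "poly_expansion l a q \<noteq> 0" "q \<noteq> 0"
    using assms by (rule coordinate_ring_expansionE)
  have "fls_deriv (expansion l a f) * poly_expansion l a q + expansion l a f * fls_deriv (poly_expansion l a q) =
      fls_deriv (expansion l a f * poly_expansion l a q)"
    by (simp add: algebra_simps)
  also have "expansion l a f * poly_expansion l a q = poly_expansion l a p"
    using 1(4) by (simp add: 1(3) expansion_Fract)
  finally have "fls_deriv (expansion l a f) * poly_expansion l a q =
      fls_deriv (poly_expansion l a p) - expansion l a f * fls_deriv (poly_expansion l a q)"
    by (simp add: algebra_simps)
  moreover have "expansion l a (partial (Suc l) f) * poly_expansion l a q =
      fls_deriv (poly_expansion l a p) - expansion l a f * fls_deriv (poly_expansion l a q)"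
    using 1 by (simp add: partial_Fract expansion_Fract poly_expansion_hom poly_expansion_deriv
        diff_divide_distrib power2_eq_square left_diff_distrib)
  ultimately show ?thesis
    using 1(4) by (metis mult_right_cancel)
qed

lemma expansion_base:
  assumes "g \<in> coordinate_ring l"
  shows "expansion l a g = fls_const g"
proof -
  from assms obtain p k where p: "p \<in> polynomials l" "g = Fract p (discriminant l ^ k)"
    by (elim coordinate_ringE)
  let ?D = "discriminant l ^ k"
  have D: "poly_expansion l a ?D = fls_const (Fract ?D 1)"
    by (simp add: poly_expansion_base discriminant_in_polynomials polynomials_power)
  have nz: "Fract ?D 1 \<noteq> 0"
    by (simp add: Zero_fract_def eq_fract)
  then have "poly_expansion l a ?D \<noteq> 0"
    by (simp add: D fls_const_nonzero)
  then have "expansion l a g = fls_const (Fract p 1) / fls_const (Fract ?D 1)"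
    using p by (simp add: expansion_Fract poly_expansion_base D)
  moreover have "fls_const g * fls_const (Fract ?D 1) = fls_const (Fract p 1)"
  proof -
    have "g * Fract ?D 1 = Fract p 1"
      by (simp add: p eq_fract)
    then show ?thesis
      by (simp only: fls_const_mult_const)
  qed
  ultimately show ?thesis
    using nz by (metis nonzero_mult_div_cancel_right fls_const_nonzero)
qed

lemma expansion_simple_pole:
  assumes "b \<in> letters l"
  shows "expansion l a (simple_pole l b) = inverse (fls_const (label_value a - label_value b) + fls_X)"
proof -
  have b: "label_value b = Fract (label_poly b) 1" "label_poly b \<in> polynomials l"
    using assms label_value_eq not_Infty_letters label_poly_in_polynomials by blast+
  let ?q = "var (Suc l) - label_poly b"
  have q: "poly_expansion l a ?q = fls_const (label_value a - label_value b) + fls_X"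
    using b by (simp add: poly_expansion_hom poly_expansion_var poly_expansion_base
        algebra_simps flip: fls_minus_const)
  have "coord (Suc l) - label_value b = Fract ?q 1"
    by (simp add: b label_value.simps(3))
  moreover from this have "?q \<noteq> 0"
    using coord_diff_nz [OF assms] by (auto simp: Zero_fract_def)
  ultimately have "simple_pole l b = Fract 1 ?q"
    by (simp add: simple_pole_def)
  then show ?thesis
    using fls_const_plus_X_nz(1) by (simp add: expansion_Fract q inverse_eq_divide)
qed

definition residue :: "nat \<Rightarrow> label \<Rightarrow> ratfun \<Rightarrow> ratfun" where
  "residue l a f = fls_residue (expansion l a f)"

lemma residue_add:
  "f \<in> coordinate_ring (Suc l) \<Longrightarrow> g \<in> coordinate_ring (Suc l) \<Longrightarrow>
    residue l a (f + g) = residue l a f + residue l a g"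
  by (simp add: residue_def expansion_add)

lemma residue_0: "residue l a 0 = 0"
  using expansion_base [of 0 l a] by (simp add: residue_def)

lemma residue_sum:
  "(\<And>x. x \<in> S \<Longrightarrow> f x \<in> coordinate_ring (Suc l)) \<Longrightarrow>
    residue l a (sum f S) = (\<Sum>x\<in>S. residue l a (f x))"
  by (induction S rule: infinite_finite_induct) (auto simp: residue_0 residue_add coordinate_ring_sum)

lemma residue_partial:
  "f \<in> coordinate_ring (Suc l) \<Longrightarrow> residue l a (partial (Suc l) f) = 0"
  using fls_residue_deriv by (simp add: residue_def expansion_partial)

lemma residue_simple_pole:
  assumes "g \<in> coordinate_ring l" "a \<in> letters l" "b \<in> letters l"
  shows "residue l a (g * simple_pole l b) = (if a = b then g else 0)"
proof -
  define c where "c = label_value a - label_value b"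
  have e: "expansion l a (g * simple_pole l b) = fls_const g * inverse (fls_const c + fls_X)"
    using assms coordinate_ring_Suc [of l] simple_pole_in_coordinate_ring
    by (subst expansion_mult) (auto simp: expansion_base expansion_simple_pole c_def)
  show ?thesis
  proof (cases "a = b")
    case True
    then show ?thesis
      unfolding residue_def e by (simp add: c_def fls_inverse_X)
  next
    case False
    then have "c \<noteq> 0"
      using assms label_value_inj [of a b] not_Infty_letters by (auto simp: c_def)
    then have "fls_subdegree (fls_const c + fls_X) = 0"
      by (intro fls_subdegree_eqI) (auto simp: fls_const_nth)
    then have "fls_subdegree (inverse (fls_const c + fls_X)) = 0"
      by (simp add: fls_inverse_subdegree)
    then show ?thesis
      using False by (simp add: residue_def e)
  qed
qed

text \<open>A derivative of a Laurent series has no residue, while the residue of the sum at \<open>b\<close> is \<open>g b\<close>.\<close>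

lemma simple_poles_not_exact:
  assumes "G \<in> coordinate_ring (Suc l)" "\<And>a. a \<in> letters l \<Longrightarrow> g a \<in> coordinate_ring l"
    and eq: "(\<Sum>a\<in>letters l. g a * simple_pole l a) = partial (Suc l) G"
    and b: "b \<in> letters l"
  shows "g b = 0"
proof -
  have "residue l b (\<Sum>a\<in>letters l. g a * simple_pole l a) =
      (\<Sum>a\<in>letters l. residue l b (g a * simple_pole l a))"
    using assms coordinate_ring_Suc [of l]
    by (intro residue_sum coordinate_ring_mult simple_pole_in_coordinate_ring) auto
  also have "\<dots> = (\<Sum>a\<in>letters l. if a = b then g a else 0)"
    using assms by (intro sum.cong) (auto simp: residue_simple_pole)
  also have "\<dots> = g b"
    using b by simp
  finally show ?thesis
    using residue_partial [OF assms(1), of b] eq by simp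
qed

section \<open>Exact functions in top degree\<close>

definition exact_functions :: "nat \<Rightarrow> ratfun set" where
  "exact_functions l = {\<Sum>i\<in>{1..l}. partial i (F i) |F. \<forall>i\<in>{1..l}. F i \<in> coordinate_ring l}"

lemma exact_functions_add:
  assumes "f \<in> exact_functions l" "g \<in> exact_functions l"
  shows "f + g \<in> exact_functions l"
proof -
  obtain F G where "f = (\<Sum>i\<in>{1..l}. partial i (F i))" "g = (\<Sum>i\<in>{1..l}. partial i (G i))"
    "\<forall>i\<in>{1..l}. F i \<in> coordinate_ring l" "\<forall>i\<in>{1..l}. G i \<in> coordinate_ring l"
    using assms unfolding exact_functions_def by blast
  then show ?thesis
    unfolding exact_functions_def
    by (intro CollectI exI [of _ "\<lambda>i. F i + G i"]) (simp add: partial_add sum.distrib coordinate_ring_add)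
qed

lemma exact_functions_scale:
  assumes "f \<in> exact_functions l"
  shows "of_rat c * f \<in> exact_functions l"
proof -
  obtain F where "f = (\<Sum>i\<in>{1..l}. partial i (F i))" "\<forall>i\<in>{1..l}. F i \<in> coordinate_ring l"
    using assms unfolding exact_functions_def by blast
  then show ?thesis
    unfolding exact_functions_def
    by (intro CollectI exI [of _ "\<lambda>i. of_rat c * F i"])
      (simp add: partial_mult sum_distrib_left coordinate_ring_mult coordinate_ring_of_rat)
qed

lemma exact_functions_0 [simp]: "0 \<in> exact_functions l"
  unfolding exact_functions_def by (intro CollectI exI [of _ "\<lambda>i. 0"]) simp

lemma exact_functions_sum:
  "(\<And>x. x \<in> S \<Longrightarrow> f x \<in> exact_functions l) \<Longrightarrow> sum f S \<in> exact_functions l"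
  by (induction S rule: infinite_finite_induct) (auto simp: exact_functions_add)

lemma partial_in_exact_functions:
  assumes "f \<in> coordinate_ring l" "i \<in> {1..l}"
  shows "partial i f \<in> exact_functions l"
proof -
  have "(\<Sum>j\<in>{1..l}. partial j (if j = i then f else 0)) = (\<Sum>j\<in>{1..l}. if j = i then partial i f else 0)"
    by (intro sum.cong) auto
  also have "\<dots> = partial i f"
    using assms by simp
  finally show ?thesis
    unfolding exact_functions_def using assms(1)
    by (intro CollectI exI [of _ "\<lambda>j. if j = i then f else 0"]) auto
qed

lemma exact_functions_0_eq [simp]: "exact_functions 0 = {0}"
  by (auto simp: exact_functions_def)

text \<open>By the chain rule: \<open>1 / (t - a)\<close> depends on \<open>t\<close> and \<open>a\<close> only through the difference, and
  \<open>\<partial>a/\<partial>t\<^sub>i\<close> does not depend on \<open>t\<close>.\<close>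

lemma partial_simple_pole_base:
  assumes "a \<in> letters l" "i \<in> {1..l}"
  shows "partial i (simple_pole l a) = - partial (Suc l) (partial i (label_value a) * simple_pole l a)"
proof -
  have "partial (Suc l) (partial i (label_value a)) = 0"
    using assms by (intro partial_eq_0 [of _ l] coordinate_ring_partial label_value_in_coordinate_ring) auto
  then show ?thesis
    using assms by (simp add: partial_mult partial_simple_pole)
      (simp add: simple_pole_def partial_inverse partial_diff partial_coord divide_inverse power_inverse)
qed

text \<open>Leibniz rule. The term in which the pole is differentiated is itself a derivative with respect to the
  last coordinate.\<close>

lemma exact_times_simple_pole:
  assumes e: "e \<in> exact_functions l" and a: "a \<in> letters l"
  shows "e * simple_pole l a \<in> exact_functions (Suc l)"
proof -
  obtain F where F: "e = (\<Sum>i\<in>{1..l}. partial i (F i))" "\<forall>i\<in>{1..l}. F i \<in> coordinate_ring l"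
    using e unfolding exact_functions_def by blast
  have "partial i (F i) * simple_pole l a \<in> exact_functions (Suc l)" if i: "i \<in> {1..l}" for i
  proof -
    have Fi: "F i \<in> coordinate_ring l" "F i \<in> coordinate_ring (Suc l)"
      using F i coordinate_ring_Suc [of l] by auto
    let ?h = "F i * partial i (label_value a)"
    have h: "?h \<in> coordinate_ring l"
      using Fi a by (intro coordinate_ring_mult coordinate_ring_partial label_value_in_coordinate_ring)
    have "partial (Suc l) (F i) = 0"
      using Fi by (intro partial_eq_0 [of _ l]) auto
    then have "partial i (F i) * simple_pole l a =
        partial i (F i * simple_pole l a) + partial (Suc l) (?h * simple_pole l a)"
      using i a by (simp add: partial_mult partial_simple_pole_base mult.assoc algebra_simps)
    also have "\<dots> \<in> exact_functions (Suc l)"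
      using i a Fi(2) subsetD [OF coordinate_ring_Suc h]
      by (intro exact_functions_add partial_in_exact_functions
          coordinate_ring_mult [OF _ simple_pole_in_coordinate_ring]) auto
    finally show ?thesis .
  qed
  then show ?thesis
    unfolding F(1) sum_distrib_right by (rule exact_functions_sum)
qed

text \<open>The converse of the previous lemma: the polar parts of an exact function are exact on the base. A
  derivative \<open>\<partial>\<^sub>i F\<close> with \<open>i \<le> l\<close> is computed on the partial fractions of \<open>F\<close>.\<close>

lemma exact_functions_SucE:
  assumes "e \<in> exact_functions (Suc l)"
  shows "\<exists>G h. G \<in> coordinate_ring (Suc l) \<and> (\<forall>a\<in>letters l. h a \<in> exact_functions l) \<and>
    e = partial (Suc l) G + (\<Sum>a\<in>letters l. h a * simple_pole l a)"
proof -
  define Q where "Q e \<longleftrightarrow> (\<exists>G h. G \<in> coordinate_ring (Suc l) \<and> (\<forall>a\<in>letters l. h a \<in> exact_functions l) \<and>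
    e = partial (Suc l) G + (\<Sum>a\<in>letters l. h a * simple_pole l a))" for e
  have Q_last: "Q (partial (Suc l) F)" if "F \<in> coordinate_ring (Suc l)" for F
    unfolding Q_def using that by (intro exI [of _ F] exI [of _ "\<lambda>_. 0"]) auto
  have Q_add: "Q (e + e')" if "Q e" "Q e'" for e e'
  proof -
    from \<open>Q e\<close> obtain G h where G: "G \<in> coordinate_ring (Suc l)" "\<forall>a\<in>letters l. h a \<in> exact_functions l"
      "e = partial (Suc l) G + (\<Sum>a\<in>letters l. h a * simple_pole l a)"
      unfolding Q_def by blast
    from \<open>Q e'\<close> obtain G' h' where G': "G' \<in> coordinate_ring (Suc l)" "\<forall>a\<in>letters l. h' a \<in> exact_functions l"
      "e' = partial (Suc l) G' + (\<Sum>a\<in>letters l. h' a * simple_pole l a)"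
      unfolding Q_def by blast
    show ?thesis
      unfolding Q_def G(3) G'(3) using G(1,2) G'(1,2)
      by (intro exI [of _ "G + G'"] exI [of _ "\<lambda>a. h a + h' a"])
        (simp add: partial_add sum.distrib distrib_right coordinate_ring_add exact_functions_add)
  qed
  have Q_base: "Q (partial i F)" if i: "i \<in> {1..l}" and F: "F \<in> coordinate_ring (Suc l)" for i F
  proof -
    obtain G g where G: "G \<in> coordinate_ring (Suc l)" "\<forall>a\<in>letters l. g a \<in> coordinate_ring l"
      "F = partial (Suc l) G + (\<Sum>a\<in>letters l. g a * simple_pole l a)"
      using partial_fractions [OF F] by blast
    \<comment> \<open>A primitive of the terms that arise from differentiating the poles.\<close>
    define H where "H = (\<Sum>a\<in>letters l. g a * (partial i (label_value a) * simple_pole l a))"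
    have H: "H \<in> coordinate_ring (Suc l)"
      unfolding H_def using G(2) coordinate_ring_Suc [of l]
      by (intro coordinate_ring_sum coordinate_ring_mult simple_pole_in_coordinate_ring
          subsetD [OF coordinate_ring_Suc coordinate_ring_partial [OF label_value_in_coordinate_ring]]) auto
    have dH: "partial (Suc l) H = - (\<Sum>a\<in>letters l. g a * partial i (simple_pole l a))"
      unfolding H_def partial_sum sum_negf [symmetric]
    proof (rule sum.cong)
      fix a assume a: "a \<in> letters l"
      then have "partial (Suc l) (g a) = 0"
        using G(2) by (intro partial_eq_0 [of _ l]) auto
      then show "partial (Suc l) (g a * (partial i (label_value a) * simple_pole l a)) =
          - (g a * partial i (simple_pole l a))"
        using partial_simple_pole_base [OF a i] by (subst partial_mult) simp
    qed simp
    have "partial i F = partial (Suc l) (partial i G - H) + (\<Sum>a\<in>letters l. partial i (g a) * simple_pole l a)"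
      unfolding G(3) partial_add partial_diff partial_sum partial_mult sum.distrib dH
        partial_commute [of i "Suc l"] by simp
    then show ?thesis
      unfolding Q_def using G i H
      by (intro exI [of _ "partial i G - H"] exI [of _ "\<lambda>a. partial i (g a)"])
        (auto intro!: partial_in_exact_functions coordinate_ring_diff coordinate_ring_partial)
  qed
  obtain F where F: "e = (\<Sum>i\<in>{1..Suc l}. partial i (F i))" "\<forall>i\<in>{1..Suc l}. F i \<in> coordinate_ring (Suc l)"
    using assms unfolding exact_functions_def by blast
  have "Q (\<Sum>i\<in>S. partial i (F i))" if "S \<subseteq> {1..l}" for S
    using finite_subset [OF that] that
  proof (induction S rule: infinite_finite_induct)
    case empty
    then show ?case
      using Q_last [of 0] by simp
  next
    case (insert i S)
    then show ?case
      using F(2) by (simp add: Q_add Q_base)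
  qed auto
  then have "Q ((\<Sum>i\<in>{1..l}. partial i (F i)) + partial (Suc l) (F (Suc l)))"
    using F(2) by (intro Q_add Q_last) auto
  then have "Q e"
    unfolding F(1) by (simp add: add.commute)
  then show ?thesis
    unfolding Q_def .
qed

section \<open>Chains and shuffles\<close>

text \<open>The coefficient of the cell form \<open>[W, \<infinity>]\<close>. For words of length at most one the product is empty.\<close>

fun chain :: "label list \<Rightarrow> ratfun" where
  "chain (x # y # w) = chain (y # w) / (label_value y - label_value x)"
| "chain w = 1"

definition words :: "nat \<Rightarrow> label list set" where
  "words l = {W. distinct W \<and> set W = letters l}"

lemma finite_words: "finite (words l)"
proof (rule finite_subset)
  show "words l \<subseteq> {W. set W \<subseteq> letters l \<and> length W \<le> card (letters l)}"
    by (auto simp: words_def distinct_card [symmetric])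
qed (simp add: finite_lists_length_le)

lemma chain_append: "chain (u @ x # v) = chain (u @ [x]) * chain (x # v)"
proof (induction u rule: chain.induct)
  case ("2_2" y)
  then show ?case
    by (cases v) auto
qed auto

lemma chain_rev: "chain (rev w) = (- 1) ^ (length w - 1) * chain w"
proof (induction w rule: chain.induct)
  case (1 x y w)
  have "label_value x - label_value y = - (label_value y - label_value x)"
    by simp
  then have "chain [y, x] = - chain [x, y]"
    by (simp only: chain.simps divide_minus_right)
  then have "chain (rev (x # y # w)) = chain (rev (y # w)) * - chain [x, y]"
    using chain_append [of "rev w" y "[x]"] by simp
  also have "\<dots> = (- 1) ^ (length (x # y # w) - 1) * (chain (y # w) * chain [x, y])"
    unfolding 1 by simp
  finally show ?case
    by simp
qed auto

text \<open>Induction on both words. Splitting the shuffles by their first letter \<open>a\<close> or \<open>b\<close>, the induction step is the identity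
  \<open>1 / ((b - a)(a - x)) + 1 / ((a - b)(b - x)) = 1 / ((a - x)(b - x))\<close>.\<close>

lemma chain_shuffles:
  assumes "distinct (x # A @ B)" "Infty \<notin> set (x # A @ B)"
  shows "(\<Sum>W\<in>shuffles A B. chain (x # W)) = chain (x # A) * chain (x # B)"
  using assms
proof (induction A B arbitrary: x rule: shuffles.induct)
  case (3 a A b B)
  define u v w where uvw: "u = label_value a" "v = label_value b" "w = label_value x"
  have nz: "u - v \<noteq> 0" "v - u \<noteq> 0" "u - w \<noteq> 0" "v - w \<noteq> 0"
    using 3(3,4) label_value_inj by (auto simp: uvw)
  have disj: "(#) a ` shuffles A (b # B) \<inter> (#) b ` shuffles (a # A) B = {}"
    using 3(3) by auto
  have "(\<Sum>W\<in>shuffles (a # A) (b # B). chain (x # W)) =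
      (\<Sum>W\<in>shuffles A (b # B). chain (x # a # W)) + (\<Sum>W\<in>shuffles (a # A) B. chain (x # b # W))"
    using disj by (simp add: sum.union_disjoint sum.reindex)
  also have "\<dots> = (\<Sum>W\<in>shuffles A (b # B). chain (a # W)) / (u - w) +
      (\<Sum>W\<in>shuffles (a # A) B. chain (b # W)) / (v - w)"
    by (simp add: sum_divide_distrib uvw)
  also have "(\<Sum>W\<in>shuffles A (b # B). chain (a # W)) = chain (a # A) * (chain (b # B) / (v - u))"
    using 3(3,4) by (subst 3(1)) (auto simp: uvw)
  also have "(\<Sum>W\<in>shuffles (a # A) B. chain (b # W)) = chain (a # A) / (u - v) * chain (b # B)"
    using 3(3,4) by (subst 3(2)) (auto simp: uvw)
  also have "chain (a # A) * (chain (b # B) / (v - u)) / (u - w) + chain (a # A) / (u - v) * chain (b # B) / (v - w) =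
      chain (a # A) * chain (b # B) * (1 / ((v - u) * (u - w)) + 1 / ((u - v) * (v - w)))"
    by (simp add: distrib_left mult_ac)
  also have "1 / ((v - u) * (u - w)) + 1 / ((u - v) * (v - w)) = 1 / ((u - w) * (v - w))"
    using nz by (simp add: divide_simps) (simp add: algebra_simps)
  finally show ?case
    by (simp add: uvw field_class.field_divide_inverse mult_ac)
qed auto

text \<open>Split by the first letter. By the product formula the two parts are \<open>chain A * chain B\<close> times \<open>1 / (b - a)\<close> and
  times \<open>1 / (a - b)\<close>.\<close>

lemma chain_shuffles_eq_0:
  assumes "distinct (A @ B)" "Infty \<notin> set (A @ B)" "A \<noteq> []" "B \<noteq> []"
  shows "(\<Sum>W\<in>shuffles A B. chain W) = 0"
proof -
  obtain a A' b B' where AB: "A = a # A'" "B = b # B'"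
    using assms(3,4) by (meson neq_Nil_conv)
  define u v where uv: "u = label_value a" "v = label_value b"
  have nz: "u - v \<noteq> 0" "v - u \<noteq> 0"
    using assms label_value_inj by (auto simp: uv AB)
  have disj: "(#) a ` shuffles A' (b # B') \<inter> (#) b ` shuffles (a # A') B' = {}"
    using assms(1) by (auto simp: AB)
  have "(\<Sum>W\<in>shuffles A B. chain W) =
      (\<Sum>W\<in>shuffles A' (b # B'). chain (a # W)) + (\<Sum>W\<in>shuffles (a # A') B'. chain (b # W))"
    using disj by (simp add: sum.union_disjoint sum.reindex AB)
  also have "\<dots> = chain (a # A') * chain (a # b # B') + chain (b # a # A') * chain (b # B')"
    using assms(1,2) by (subst (1 2) chain_shuffles) (auto simp: AB)
  also have "\<dots> = chain (a # A') * chain (b # B') * (1 / (v - u) + 1 / (u - v))"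
    by (simp add: uv field_class.field_divide_inverse algebra_simps)
  also have "1 / (v - u) + 1 / (u - v) = 0"
    using nz by (simp add: divide_simps)
  finally show ?thesis
    by simp
qed

text \<open>A chain is the product of its parts to the left and to the right of \<open>x\<close>. Reversing the left part costs a
  sign, and then both parts start with \<open>x\<close>.\<close>

lemma chain_via_initial:
  assumes "distinct (u @ x # v)" "Infty \<notin> set (u @ x # v)"
  shows "chain (u @ x # v) = (- 1) ^ length u * (\<Sum>W\<in>shuffles (rev u) v. chain (x # W))"
proof -
  have "chain (u @ [x]) = (- 1) ^ length u * chain (x # rev u)"
    using chain_rev [of "x # rev u"] by simp
  moreover have "(\<Sum>W\<in>shuffles (rev u) v. chain (x # W)) = chain (x # rev u) * chain (x # v)"
    using assms by (intro chain_shuffles) auto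
  ultimately show ?thesis
    using chain_append [of u x v] by simp
qed

lemma append_in_shuffles: "u @ v \<in> shuffles u v"
proof (induction u)
  case (Cons a u)
  then show ?case
    by (cases v) auto
qed simp

text \<open>The letter \<open>z\<close> can only move to the left of its position in \<open>u z v\<close>. This drives the two
  triangularity arguments below.\<close>

lemma shuffles_position:
  assumes "W \<in> shuffles u (z # v)" "z \<notin> set u"
  shows "W = u @ z # v \<or> (\<exists>u' v'. W = u' @ z # v' \<and> length u' < length u)"
  using assms
proof (induction u arbitrary: W)
  case (Cons a u)
  then consider W' where "W = a # W'" "W' \<in> shuffles u (z # v)" | W' where "W = z # W'"
    by auto
  then show ?case
  proof cases
    case (1 W')
    with Cons have "W' = u @ z # v \<or> (\<exists>u' v'. W' = u' @ z # v' \<and> length u' < length u)"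
      by simp
    with 1 show ?thesis
      by (metis append_Cons length_Cons Suc_less_eq)
  next
    case (2 W')
    then show ?thesis
      by (intro disjI2 exI [of _ "[]"] exI [of _ W']) simp
  qed
qed auto

section \<open>Generation of the coordinate ring by chains\<close>

definition spanned :: "nat \<Rightarrow> label list set \<Rightarrow> ratfun set" where
  "spanned l S = {f. \<exists>c. f - (\<Sum>W\<in>S. of_rat (c W) * chain W) \<in> exact_functions l}"

lemma spanned_add:
  assumes "f \<in> spanned l S" "g \<in> spanned l S"
  shows "f + g \<in> spanned l S"
proof -
  obtain c d where "f - (\<Sum>W\<in>S. of_rat (c W) * chain W) \<in> exact_functions l"
    "g - (\<Sum>W\<in>S. of_rat (d W) * chain W) \<in> exact_functions l"
    using assms unfolding spanned_def by blast
  from exact_functions_add [OF this] show ?thesis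
    unfolding spanned_def
    by (intro CollectI exI [of _ "\<lambda>W. c W + d W"])
      (simp add: of_rat_add distrib_right sum.distrib algebra_simps)
qed

lemma spanned_scale:
  assumes "f \<in> spanned l S"
  shows "of_rat r * f \<in> spanned l S"
proof -
  obtain c where "f - (\<Sum>W\<in>S. of_rat (c W) * chain W) \<in> exact_functions l"
    using assms unfolding spanned_def by blast
  from exact_functions_scale [OF this, of r] show ?thesis
    unfolding spanned_def
    by (intro CollectI exI [of _ "\<lambda>W. r * c W"])
      (simp add: of_rat_mult right_diff_distrib sum_distrib_left mult.assoc)
qed

lemma spanned_exact: "f \<in> exact_functions l \<Longrightarrow> f \<in> spanned l S"
  unfolding spanned_def by (intro CollectI exI [of _ "\<lambda>_. 0"]) simp

lemma spanned_sum: "(\<And>x. x \<in> A \<Longrightarrow> f x \<in> spanned l S) \<Longrightarrow> sum f A \<in> spanned l S"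
  by (induction A rule: infinite_finite_induct) (auto simp: spanned_add spanned_exact)

lemma spanned_minus_one_power: "f \<in> spanned l S \<Longrightarrow> (- 1) ^ k * f \<in> spanned l S"
  using spanned_scale [of f l S "(- 1) ^ k"] by (simp add: of_rat_power of_rat_minus)

lemma spanned_uminus: "f \<in> spanned l S \<Longrightarrow> - f \<in> spanned l S"
  using spanned_minus_one_power [of f l S 1] by simp

lemma chain_spanned:
  assumes "finite S" "W \<in> S"
  shows "chain W \<in> spanned l S"
proof -
  have "(\<Sum>V\<in>S. of_rat (if V = W then 1 else 0) * chain V) = (\<Sum>V\<in>S. if V = W then chain V else 0)"
    by (intro sum.cong) auto
  then show ?thesis
    unfolding spanned_def using assms
    by (intro CollectI exI [of _ "\<lambda>V. if V = W then 1 else 0"]) simp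
qed

lemma spanned_trans:
  assumes "f \<in> spanned l S" "\<And>W. W \<in> S \<Longrightarrow> chain W \<in> spanned l S'"
  shows "f \<in> spanned l S'"
proof -
  obtain c where c: "f - (\<Sum>W\<in>S. of_rat (c W) * chain W) \<in> exact_functions l"
    using assms(1) unfolding spanned_def by blast
  have "(\<Sum>W\<in>S. of_rat (c W) * chain W) + (f - (\<Sum>W\<in>S. of_rat (c W) * chain W)) \<in> spanned l S'"
    using assms(2) by (intro spanned_add spanned_exact [OF c] spanned_sum spanned_scale)
  then show ?thesis
    by simp
qed

lemma words_cases_at:
  assumes "W \<in> words l" "a \<in> letters l"
  obtains x y where "W = x @ a # y"
  using assms by (metis (mono_tags, lifting) mem_Collect_eq split_list words_def)

text \<open>With \<open>U = x a y\<close>, the factor \<open>1 / (t - a)\<close> is the chain \<open>a t\<close>, and the product formula for shuffles inserts \<open>t\<close>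
  into \<open>y\<close> in all possible ways.\<close>

lemma chain_times_simple_pole:
  assumes U: "U \<in> words l" and a: "a \<in> letters l"
  shows "chain U * simple_pole l a \<in> spanned (Suc l) (words (Suc l))"
proof -
  obtain x y where U_eq: "U = x @ a # y"
    using words_cases_at [OF assms] .
  have dist: "distinct (x @ a # y)" "set (x @ a # y) = letters l"
    using U by (auto simp: words_def U_eq)
  then have notin: "T (Suc l) \<notin> set (x @ a # y)" "Infty \<notin> set (x @ a # y)"
    unfolding dist(2) by simp_all
  have "chain U * simple_pole l a = chain (x @ [a]) * (chain [a, T (Suc l)] * chain (a # y))"
    using chain_append [of x a y] by (simp add: U_eq simple_pole_def field_class.field_divide_inverse)
  also have "chain [a, T (Suc l)] * chain (a # y) = (\<Sum>W\<in>shuffles [T (Suc l)] y. chain (a # W))"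
    using dist notin a by (intro chain_shuffles [symmetric]) auto
  also have "chain (x @ [a]) * \<dots> = (\<Sum>W\<in>shuffles [T (Suc l)] y. chain (x @ a # W))"
    unfolding sum_distrib_left by (intro sum.cong refl) (rule chain_append [symmetric])
  also have "\<dots> \<in> spanned (Suc l) (words (Suc l))"
  proof (intro spanned_sum chain_spanned finite_words)
    fix W assume W: "W \<in> shuffles [T (Suc l)] y"
    have y: "T (Suc l) \<notin> set y" "T (Suc l) \<notin> set x" "T (Suc l) \<noteq> a"
      using notin(1) by auto
    have "set W = insert (T (Suc l)) (set y)"
      using set_shuffles [OF W] by simp
    moreover have "distinct W"
      using distinct_disjoint_shuffles [OF _ _ _ W] y dist(1) by simp
    ultimately show "x @ a # W \<in> words (Suc l)"
      using dist(1) y by (auto simp: words_def letters_Suc simp flip: dist(2))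
  qed
  finally show ?thesis .
qed

lemma coordinate_ring_0_eq: "f \<in> coordinate_ring 0 \<Longrightarrow> \<exists>c. f = of_rat c"
proof -
  assume "f \<in> coordinate_ring 0"
  then obtain p k where p: "p \<in> polynomials 0" "f = Fract p (discriminant 0 ^ k)"
    by (elim coordinate_ringE)
  have no_pairs: "{(i, j). 1 \<le> i \<and> i < j \<and> j \<le> (0::nat)} = {}"
    by auto
  have D: "discriminant 0 = 1"
    unfolding discriminant_def no_pairs by simp
  have "\<exists>c. p = Poly_Mapping.single 0 c"
    using p(1)
  proof (induction p rule: polynomials_induct)
    case (add p q)
    then show ?case
      by (metis single_add)
  next
    case (mult p q)
    then show ?case
      by (metis mult_single add_0)
  qed auto
  then show ?thesis
    using p(2) by (auto simp: D of_rat_ratfun)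
qed

text \<open>Induction on \<open>l\<close>: expand into partial fractions, and apply the induction hypothesis to the residues. In the base
  case the ring consists of the constants, and \<open>chain [Zero, One] = 1\<close>.\<close>

lemma coordinate_ring_spanned: "f \<in> coordinate_ring l \<Longrightarrow> f \<in> spanned l (words l)"
proof (induction l arbitrary: f)
  case 0
  then obtain c where c: "f = of_rat c"
    using coordinate_ring_0_eq by blast
  have "[Zero, One] \<in> words 0"
    by (auto simp: words_def letters_def)
  then have "of_rat c * chain [Zero, One] \<in> spanned 0 (words 0)"
    by (intro spanned_scale chain_spanned finite_words)
  then show ?case
    by (simp add: c)
next
  case (Suc l)
  obtain G g where G: "G \<in> coordinate_ring (Suc l)" "\<forall>a\<in>letters l. g a \<in> coordinate_ring l"
    "f = partial (Suc l) G + (\<Sum>a\<in>letters l. g a * simple_pole l a)"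
    using partial_fractions [OF Suc.prems] by blast
  have "g a * simple_pole l a \<in> spanned (Suc l) (words (Suc l))" if a: "a \<in> letters l" for a
  proof -
    obtain c where c: "g a - (\<Sum>W\<in>words l. of_rat (c W) * chain W) \<in> exact_functions l"
      using Suc.IH [of "g a"] G(2) a unfolding spanned_def by blast
    have "g a * simple_pole l a = (\<Sum>W\<in>words l. of_rat (c W) * (chain W * simple_pole l a)) +
        (g a - (\<Sum>W\<in>words l. of_rat (c W) * chain W)) * simple_pole l a"
      by (simp add: sum_distrib_right left_diff_distrib mult.assoc)
    also have "\<dots> \<in> spanned (Suc l) (words (Suc l))"
      using a by (intro spanned_add spanned_sum spanned_scale chain_times_simple_pole
        spanned_exact exact_times_simple_pole [OF c])
    finally show ?thesis .
  qed
  then show ?case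
    unfolding G(3) using G(1)
    by (intro spanned_add [OF spanned_exact [OF partial_in_exact_functions] spanned_sum]) auto
qed

definition words01 :: "nat \<Rightarrow> label list set" where
  "words01 l = {W \<in> words l. \<exists>u v. W = u @ [Zero, One] @ v}"

lemma shuffle_in_words:
  assumes "x @ A @ B @ y \<in> words l" "W \<in> shuffles A B"
  shows "x @ W @ y \<in> words l"
  using assms set_shuffles [OF assms(2)] distinct_disjoint_shuffles [OF _ _ _ assms(2)]
  by (auto simp: words_def)

lemma words_not_Infty: "W \<in> words l \<Longrightarrow> Infty \<notin> set W"
  by (auto simp: words_def)

text \<open>Expanding the chain of the word \<open>(rev a) 0 1 b\<close> into words that start with \<open>0\<close>, one obtains \<open>0 a 1 b\<close> and words in
  which \<open>1\<close> stands further to the left, so induction on the length of \<open>a\<close> applies.\<close>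

lemma initial_word_spanned_by_words01:
  assumes "Zero # a @ One # b \<in> words l"
  shows "chain (Zero # a @ One # b) \<in> spanned l (words01 l)"
  using assms
proof (induction a arbitrary: b rule: length_induct)
  case (1 a)
  have W: "distinct (Zero # a @ One # b)" "Infty \<notin> set (Zero # a @ One # b)"
    using 1(2) words_not_Infty by (auto simp: words_def)
  let ?S = "shuffles a (One # b)"
  have in_S: "a @ One # b \<in> ?S"
    by (rule append_in_shuffles)
  have "chain (rev a @ Zero # One # b) = (- 1) ^ length a * (\<Sum>W\<in>?S. chain (Zero # W))"
    using W by (subst chain_via_initial) auto
  also have "(\<Sum>W\<in>?S. chain (Zero # W)) =
      chain (Zero # a @ One # b) + (\<Sum>W\<in>?S - {a @ One # b}. chain (Zero # W))"
    using in_S by (intro sum.remove) auto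
  finally have eq: "chain (Zero # a @ One # b) = (- 1) ^ length a * chain (rev a @ Zero # One # b) +
      - (\<Sum>W\<in>?S - {a @ One # b}. chain (Zero # W))"
    by (simp add: mult.assoc [symmetric] flip: power_mult_distrib)
  have "rev a @ Zero # One # b \<in> words01 l"
    using 1(2) by (auto simp: words01_def words_def)
  moreover have "finite (words01 l)"
    using finite_words by (simp add: words01_def)
  moreover have "chain (Zero # W) \<in> spanned l (words01 l)" if "W \<in> ?S - {a @ One # b}" for W
  proof -
    from that W shuffles_position [of W a One b] obtain a' b'
      where W': "W = a' @ One # b'" "length a' < length a"
      by auto
    have "Zero # W \<in> words l"
      using shuffle_in_words [of "[Zero]" a "One # b" "[]" l W] that 1(2) by simp
    with 1(1) W' show ?thesis
      by simp
  qed
  ultimately show ?case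
    unfolding eq
    by (intro spanned_add [OF spanned_minus_one_power [OF chain_spanned]
      spanned_uminus [OF spanned_sum]])
qed

lemma chain_spanned_by_words01:
  assumes "W \<in> words l"
  shows "chain W \<in> spanned l (words01 l)"
proof -
  have "Zero \<in> letters l"
    by (simp add: letters_def)
  then obtain u v where uv: "W = u @ Zero # v"
    using words_cases_at [OF assms] by blast
  have W: "distinct (u @ Zero # v)" "Infty \<notin> set (u @ Zero # v)"
    using assms words_not_Infty by (auto simp: words_def uv)
  have "chain (Zero # V) \<in> spanned l (words01 l)" if V: "V \<in> shuffles (rev u) v" for V
  proof -
    have "[Zero] @ rev u @ v @ [] \<in> words l"
      using assms by (auto simp: words_def uv)
    from shuffle_in_words [OF this V] have V': "Zero # V \<in> words l"
      by simp
    moreover have "One \<in> set V"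
      using V' by (auto simp: words_def letters_def)
    then obtain a b where "V = a @ One # b"
      by (meson split_list)
    ultimately show ?thesis
      using initial_word_spanned_by_words01 by blast
  qed
  then show ?thesis
    unfolding uv chain_via_initial [OF W] by (intro spanned_minus_one_power spanned_sum)
qed

lemma coordinate_ring_spanned_by_words01: "f \<in> coordinate_ring l \<Longrightarrow> f \<in> spanned l (words01 l)"
  using spanned_trans [OF coordinate_ring_spanned chain_spanned_by_words01] .

section \<open>Linear independence of chains modulo exact functions\<close>

lemma exact_functions_in_coordinate_ring: "f \<in> exact_functions l \<Longrightarrow> f \<in> coordinate_ring l"
  unfolding exact_functions_def by (auto intro!: coordinate_ring_sum coordinate_ring_partial)

lemma chain_in_coordinate_ring:
  assumes "distinct W" "set W \<subseteq> letters l"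
  shows "chain W \<in> coordinate_ring l"
  using assms
proof (induction W rule: chain.induct)
  case (1 x y w)
  then have "1 / (label_value y - label_value x) \<in> coordinate_ring l"
    by (intro inverse_difference_in_coordinate_ring) auto
  then have "chain (y # w) * (1 / (label_value y - label_value x)) \<in> coordinate_ring l"
    using 1 by (intro coordinate_ring_mult) auto
  then show ?case
    by simp
qed auto

definition insert_at :: "nat \<Rightarrow> 'a \<Rightarrow> 'a list \<Rightarrow> 'a list" where
  "insert_at k x W = take k W @ x # drop k W"

text \<open>In the middle of a word, this is the partial fraction expansion of \<open>1 / ((t - a)(b - t))\<close>. At an end of the
  word the term of the missing neighbour disappears.\<close>

lemma chain_insert:
  assumes "x @ y \<in> words l"
  shows "chain (x @ T (Suc l) # y) = chain (x @ y) *
    ((if x = [] then 0 else simple_pole l (last x)) - (if y = [] then 0 else simple_pole l (hd y)))"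
proof -
  let ?t = "T (Suc l)"
  have set: "set (x @ y) = letters l" and dist: "distinct (x @ y)"
    using assms by (auto simp: words_def)
  have "Zero \<in> set (x @ y)"
    unfolding set by (simp add: letters_def)
  then have nonempty: "x @ y \<noteq> []"
    by auto
  have pole_after: "chain [a, ?t] = simple_pole l a" if "a \<in> letters l" for a
    by (simp add: simple_pole_def inverse_eq_divide)
  have pole_before: "chain [?t, a] = - simple_pole l a" if "a \<in> letters l" for a
    by (simp add: simple_pole_def inverse_minus_eq [symmetric] inverse_eq_divide [symmetric] del: inverse_minus_eq)
  consider (first) "x = []" "y \<noteq> []" | (last) "x \<noteq> []" "y = []" | (mid) "x \<noteq> []" "y \<noteq> []"
    using nonempty by auto
  then show ?thesis
  proof cases
    case first
    then obtain b y' where y: "y = b # y'"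
      by (meson neq_Nil_conv)
    have "b \<in> letters l"
      using set by (auto simp: y)
    then show ?thesis
      using chain_append [of "[?t]" b y'] pole_before [of b] first by (simp add: y del: chain.simps(1))
  next
    case last
    then obtain a x' where x: "x = x' @ [a]"
      by (meson rev_exhaust)
    have "a \<in> letters l"
      using set by (auto simp: x)
    then show ?thesis
      using chain_append [of x' a "[?t]"] pole_after [of a] last by (simp add: x del: chain.simps(1))
  next
    case mid
    then obtain a x' b y' where xy: "x = x' @ [a]" "y = b # y'"
      by (meson rev_exhaust neq_Nil_conv)
    have ab: "a \<in> letters l" "b \<in> letters l" "b \<noteq> a"
      using set dist by (auto simp: xy)
    have nz: "label_value b - label_value a \<noteq> 0"
      using ab label_value_inj [of b a] not_Infty_letters by auto
    have "chain (x @ ?t # y) = chain (x' @ [a]) * (chain [a, ?t] * (chain [?t, b] * chain (b # y')))"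
      using chain_append [of x' a "?t # b # y'"] chain_append [of "[a]" ?t "b # y'"]
        chain_append [of "[?t]" b y']
      by (simp add: xy del: chain.simps(1))
    also have "chain [a, ?t] * (chain [?t, b] * chain (b # y')) =
        - (simple_pole l b * simple_pole l a) * chain (b # y')"
      using ab by (simp add: pole_after pole_before del: chain.simps(1))
    also have "simple_pole l b * simple_pole l a =
        1 / (label_value b - label_value a) * (simple_pole l b - simple_pole l a)"
      using simple_pole_times_simple_pole [of a l b] ab by simp
    also have "chain (x' @ [a]) * (- (1 / (label_value b - label_value a) * (simple_pole l b - simple_pole l a)) *
        chain (b # y')) =
        chain (x' @ [a]) * (chain (b # y') / (label_value b - label_value a)) *
          (simple_pole l a - simple_pole l b)"
      by (simp add: field_class.field_divide_inverse algebra_simps)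
    also have "chain (x' @ [a]) * (chain (b # y') / (label_value b - label_value a)) = chain (x @ y)"
      using chain_append [of x' a "b # y'"] by (simp add: xy)
    finally show ?thesis
      by (simp add: xy)
  qed
qed

lemma chain_insert_at:
  assumes U: "U \<in> words l" and k: "k \<le> length U"
  shows "chain (insert_at k (T (Suc l)) U) = chain U *
    ((if k = 0 then 0 else simple_pole l (U ! (k - 1))) -
     (if k = length U then 0 else simple_pole l (U ! k)))"
proof -
  have ne: "U \<noteq> []"
    using U by (auto simp: words_def letters_def)
  have "take k U = [] \<longleftrightarrow> k = 0" "drop k U = [] \<longleftrightarrow> k = length U"
    using k ne by auto
  moreover have "last (take k U) = U ! (k - 1)" if "k \<noteq> 0"
    using that k ne by (subst last_conv_nth) (auto simp: min_def)
  moreover have "hd (drop k U) = U ! k" if "k \<noteq> length U"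
    using that k by (simp add: hd_drop_conv_nth)
  ultimately show ?thesis
    using chain_insert [of "take k U" "drop k U" l] U
    by (auto simp: insert_at_def last_conv_nth [OF ne])
qed

text \<open>Summation by parts: the pole at a letter occurs for the two positions of \<open>t\<close> next to it, with opposite
  signs.\<close>

lemma sum_insertions:
  assumes U: "U \<in> words l"
  shows "(\<Sum>k\<le>length U. of_rat (c k) * chain (insert_at k (T (Suc l)) U)) =
    (\<Sum>k<length U. of_rat (c (Suc k) - c k) * chain U * simple_pole l (U ! k))"
proof -
  let ?N = "length U" and ?c = "\<lambda>k. of_rat (c k) :: ratfun"
  have "(\<Sum>k\<le>?N. ?c k * chain (insert_at k (T (Suc l)) U)) =
      (\<Sum>k\<le>?N. if k = 0 then 0 else ?c k * chain U * simple_pole l (U ! (k - 1))) -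
      (\<Sum>k\<le>?N. if k = ?N then 0 else ?c k * chain U * simple_pole l (U ! k))"
    unfolding sum_subtractf [symmetric]
    by (intro sum.cong) (auto simp: chain_insert_at [OF U] algebra_simps)
  also have "(\<Sum>k\<le>?N. if k = 0 then 0 else ?c k * chain U * simple_pole l (U ! (k - 1))) =
      (\<Sum>k<?N. ?c (Suc k) * chain U * simple_pole l (U ! k))"
    by (subst sum.atMost_shift) simp
  also have "(\<Sum>k\<le>?N. if k = ?N then 0 else ?c k * chain U * simple_pole l (U ! k)) =
      (\<Sum>k<?N. ?c k * chain U * simple_pole l (U ! k))"
    unfolding lessThan_Suc_atMost [symmetric] by simp
  also have "(\<Sum>k<?N. ?c (Suc k) * chain U * simple_pole l (U ! k)) -
      (\<Sum>k<?N. ?c k * chain U * simple_pole l (U ! k)) =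
      (\<Sum>k<?N. of_rat (c (Suc k) - c k) * chain U * simple_pole l (U ! k))"
    unfolding sum_subtractf [symmetric] by (simp add: of_rat_diff algebra_simps)
  finally show ?thesis .
qed

lemma insert_at_inj:
  assumes "t \<notin> set U" "t \<notin> set V" "k \<le> length U" "m \<le> length V"
    and eq: "insert_at k t U = insert_at m t V"
  shows "k = m \<and> U = V"
proof -
  have "t \<notin> set (take k U)" "t \<notin> set (take m V)"
    using assms(1,2) set_take_subset by (metis subsetD)+
  then have *: "takeWhile (\<lambda>x. x \<noteq> t) (insert_at k t U) = take k U"
    "takeWhile (\<lambda>x. x \<noteq> t) (insert_at m t V) = take m V"
    unfolding insert_at_def by (subst takeWhile_append2; auto)+
  then have "take k U = take m V"
    using eq by simp
  moreover from this have "drop k U = drop m V"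
    using eq by (simp add: insert_at_def)
  ultimately show ?thesis
    using assms(3,4) by (metis append_take_drop_id length_take min.absorb2)
qed

text \<open>Taking residues at the letter \<open>a\<close> in a relation gives, by induction on \<open>l\<close>, that the coefficients of the words
  with \<open>t\<close> just after and just before \<open>a\<close> agree. So the coefficient does not depend on the position of \<open>t\<close>; by the
  hypothesis on insertions it is zero for one position. The hypothesis \<open>base\<close> excludes that both
  \<open>[0, 1]\<close> and \<open>[1, 0]\<close> belong to the family; their chains are \<open>1\<close> and \<open>-1\<close>.\<close>

lemma chains_independent:
  assumes delete: "\<And>x y i. P (x @ T i # y) \<Longrightarrow> P (x @ y)"
    and insert: "\<And>U i. P U \<Longrightarrow> distinct U \<Longrightarrow> \<exists>k\<le>length U. \<not> P (insert_at k (T i) U)"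
    and base: "\<not> P [One, Zero]"
    and exact: "(\<Sum>W\<in>{W \<in> words l. P W}. of_rat (c W) * chain W) \<in> exact_functions l"
    and W: "W \<in> words l" "P W"
  shows "c W = 0"
  using exact W
proof (induction l arbitrary: c W)
  case 0
  have "words 0 \<subseteq> {[Zero, One], [One, Zero]}"
  proof
    fix V assume "V \<in> words 0"
    then have V: "distinct V" "set V = {Zero, One}"
      by (auto simp: words_def letters_def)
    then have "length V = 2"
      using distinct_card [of V] by simp
    then obtain x y where "V = [x, y]"
      by (auto simp: length_Suc_conv numeral_2_eq_2)
    with V(2) have "{x, y} = {Zero, One}"
      by simp
    with \<open>V = [x, y]\<close> show "V \<in> {[Zero, One], [One, Zero]}"
      unfolding doubleton_eq_iff by blast
  qed
  then have W: "W = [Zero, One]" and "{V \<in> words 0. P V} = {[Zero, One]}"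
    using 0(2,3) base by auto
  with 0(1) show ?case
    by simp
next
  case (Suc l)
  let ?t = "T (Suc l)"
  define S where "S = {U \<in> words l. P U}"
  define S' where "S' = {W \<in> words (Suc l). P W}"
  \<comment> \<open>Coefficients are extended by zero to all insertions of the last coordinate into words of the family.\<close>
  define d where "d V = (if V \<in> S' then c V else 0)" for V
  have fin: "finite S" "finite S'"
    unfolding S_def S'_def using finite_words by auto
  have U: "U \<in> words l" "P U" "distinct U" "set U = letters l" "?t \<notin> set U" if "U \<in> S" for U
    using that by (auto simp: S_def words_def)
  define I where "I = (SIGMA U:S. {..length U})"
  have inj: "inj_on (\<lambda>(U, k). insert_at k ?t U) I"
  proof (rule inj_onI)
    fix p q
    assume pq: "p \<in> I" "q \<in> I"
      "(\<lambda>(U, k). insert_at k ?t U) p = (\<lambda>(U, k). insert_at k ?t U) q"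
    have "snd p = snd q \<and> fst p = fst q"
      using pq by (intro insert_at_inj [of ?t]) (auto simp: I_def U(5) case_prod_unfold)
    then show "p = q"
      by (simp add: prod_eq_iff)
  qed
  have sub: "S' \<subseteq> (\<lambda>(U, k). insert_at k ?t U) ` I"
  proof
    fix V assume V: "V \<in> S'"
    then have "?t \<in> set V"
      by (auto simp: S'_def words_def letters_def)
    then obtain x y where xy: "V = x @ ?t # y"
      by (meson split_list)
    have "insert ?t (set (x @ y)) = insert ?t (letters l)" "?t \<notin> set (x @ y)" "distinct (x @ y)"
      using V by (auto simp: S'_def words_def xy letters_Suc)
    moreover from this have "set (x @ y) = letters l"
      using T_Suc_notin_letters by (metis insert_ident)
    ultimately have "x @ y \<in> S"
      using V delete [of x "Suc l" y] by (auto simp: S_def S'_def words_def xy)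
    then have "(x @ y, length x) \<in> I"
      by (simp add: I_def)
    moreover have "insert_at (length x) ?t (x @ y) = V"
      by (simp add: insert_at_def xy)
    ultimately show "V \<in> (\<lambda>(U, k). insert_at k ?t U) ` I"
      by force
  qed
  \<comment> \<open>The position of the letter \<open>a\<close> in \<open>U\<close>, and the difference of the coefficients for the two positions of
    the last coordinate next to \<open>a\<close>, which is the coefficient of \<open>chain U\<close> in the residue at \<open>a\<close>.\<close>
  define J where "J U a = inv_into {..<length U} ((!) U) a" for U and a :: label
  define D where "D U a = d (insert_at (Suc (J U a)) ?t U) - d (insert_at (J U a) ?t U)" for U a
  have "(\<Sum>V\<in>S'. of_rat (c V) * chain V) =
      (\<Sum>V\<in>(\<lambda>(U, k). insert_at k ?t U) ` I. of_rat (d V) * chain V)"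
    using sub fin by (intro sum.mono_neutral_cong_left) (auto simp: d_def I_def)
  also have "\<dots> = (\<Sum>(U, k)\<in>I. of_rat (d (insert_at k ?t U)) * chain (insert_at k ?t U))"
    by (subst sum.reindex [OF inj]) (simp add: case_prod_unfold)
  also have "\<dots> = (\<Sum>U\<in>S. \<Sum>k\<le>length U. of_rat (d (insert_at k ?t U)) * chain (insert_at k ?t U))"
    unfolding I_def using fin by (subst sum.Sigma) auto
  also have "\<dots> = (\<Sum>U\<in>S. \<Sum>a\<in>letters l. of_rat (D U a) * chain U * simple_pole l a)"
  proof (intro sum.cong refl)
    fix V assume V: "V \<in> S"
    have bij: "bij_betw ((!) V) {..<length V} (letters l)"
      using bij_betw_nth [OF U(3) [OF V], of "{..<length V}"] U(4) [OF V] by simp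
    have "(\<Sum>k\<le>length V. of_rat (d (insert_at k ?t V)) * chain (insert_at k ?t V)) =
        (\<Sum>k<length V. of_rat (D V (V ! k)) * chain V * simple_pole l (V ! k))"
      unfolding sum_insertions [OF U(1) [OF V], of "\<lambda>k. d (insert_at k ?t V)"]
      using bij by (intro sum.cong) (auto simp: D_def J_def bij_betw_def)
    also have "\<dots> = (\<Sum>a\<in>letters l. of_rat (D V a) * chain V * simple_pole l a)"
      by (rule sum.reindex_bij_betw [OF bij])
    finally show "(\<Sum>k\<le>length V. of_rat (d (insert_at k ?t V)) * chain (insert_at k ?t V)) =
      (\<Sum>a\<in>letters l. of_rat (D V a) * chain V * simple_pole l a)" .
  qed
  also have "\<dots> = (\<Sum>a\<in>letters l. (\<Sum>U\<in>S. of_rat (D U a) * chain U) * simple_pole l a)"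
    by (subst sum.swap) (simp add: sum_distrib_right)
  finally have "(\<Sum>a\<in>letters l. (\<Sum>U\<in>S. of_rat (D U a) * chain U) * simple_pole l a) \<in> exact_functions (Suc l)"
    using Suc.prems(1) by (simp add: S'_def)
  then obtain G h where G: "G \<in> coordinate_ring (Suc l)" "\<forall>a\<in>letters l. h a \<in> exact_functions l"
    "(\<Sum>a\<in>letters l. (\<Sum>U\<in>S. of_rat (D U a) * chain U) * simple_pole l a) =
      partial (Suc l) G + (\<Sum>a\<in>letters l. h a * simple_pole l a)"
    using exact_functions_SucE by blast
  have h: "h a \<in> coordinate_ring l" if "a \<in> letters l" for a
    using exact_functions_in_coordinate_ring G(2) that by blast
  have D_eq: "D U a = 0" if a: "a \<in> letters l" and "U \<in> S" for U a
  proof -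
    have "(\<Sum>U\<in>S. of_rat (D U a) * chain U) - h a = 0"
    proof (rule simple_poles_not_exact [OF G(1) _ _ a])
      show "(\<Sum>U\<in>S. of_rat (D U a) * chain U) - h a \<in> coordinate_ring l" if "a \<in> letters l" for a
        using that h U by (intro coordinate_ring_diff coordinate_ring_sum coordinate_ring_mult
          coordinate_ring_of_rat chain_in_coordinate_ring) auto
      show "(\<Sum>a\<in>letters l. ((\<Sum>U\<in>S. of_rat (D U a) * chain U) - h a) * simple_pole l a) =
          partial (Suc l) G"
        unfolding left_diff_distrib sum_subtractf G(3) by simp
    qed
    then have "(\<Sum>U\<in>S. of_rat (D U a) * chain U) \<in> exact_functions l"
      using G(2) a by simp
    then show ?thesis
      using Suc.IH [of "\<lambda>U. D U a" U] \<open>U \<in> S\<close> by (simp add: S_def)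
  qed
  have step: "d (insert_at (Suc k) ?t U) = d (insert_at k ?t U)" if "U \<in> S" "k < length U" for U k
  proof -
    have "inj_on ((!) U) {..<length U}"
      using that U(3) by (simp add: inj_on_nth)
    then have "J U (U ! k) = k"
      using that by (simp add: J_def)
    moreover have "U ! k \<in> letters l"
      using that U(4) nth_mem by blast
    ultimately show ?thesis
      using D_eq [of "U ! k" U] that(1) by (simp add: D_def)
  qed
  have const: "d (insert_at k ?t U) = d (insert_at 0 ?t U)" if "U \<in> S" "k \<le> length U" for U k
    using that(2) by (induction k) (auto simp: step [OF that(1)])
  obtain U k where Uk: "U \<in> S" "k \<le> length U" "W = insert_at k ?t U"
    using Suc.prems(2,3) sub by (force simp: S'_def I_def)
  obtain m where m: "m \<le> length U" "\<not> P (insert_at m ?t U)"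
    using insert [of U "Suc l"] U(2,3) Uk(1) by blast
  have "d (insert_at k ?t U) = d (insert_at m ?t U)"
    using const Uk m by metis
  also have "\<dots> = 0"
    using m by (simp add: d_def S'_def)
  finally show ?case
    using Uk(3) Suc.prems(2,3) by (simp add: d_def S'_def)
qed

section \<open>Quotient spaces\<close>

lemma qscale_add: "qscale c (v + w) = qscale c v + qscale c w"
  by (rule Q.scale_right_distrib)

lemma coset_eq_iff:
  fixes W :: "('a \<Rightarrow> 'b::field_char_0) set"
  assumes "Q.subspace W"
  shows "v +o W = w +o W \<longleftrightarrow> v - w \<in> W"
proof
  assume "v +o W = w +o W"
  moreover have "v \<in> v +o W"
    using Q.subspace_0 [OF assms] by (force simp: elt_set_plus_def)
  ultimately show "v - w \<in> W"
    by (auto simp: elt_set_plus_def)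
next
  assume vw: "v - w \<in> W"
  have "v +o W \<subseteq> w +o W" if "v - w \<in> W" for v w
  proof
    fix x assume "x \<in> v +o W"
    then obtain y where "y \<in> W" "x = v + y"
      by (auto simp: elt_set_plus_def)
    then have "x = w + ((v - w) + y)" "(v - w) + y \<in> W"
      using that Q.subspace_add [OF assms] by auto
    then show "x \<in> w +o W"
      unfolding elt_set_plus_def by blast
  qed
  moreover have "w - v \<in> W"
    using Q.subspace_neg [OF assms vw] by simp
  ultimately show "v +o W = w +o W"
    using vw by blast
qed

lemma subspace_plus_self:
  fixes W :: "('a \<Rightarrow> 'b::field_char_0) set"
  assumes "Q.subspace W"
  shows "W + W = W"
proof
  show "W + W \<subseteq> W"
    using Q.subspace_add [OF assms] by (auto simp: set_plus_def)
  show "W \<subseteq> W + W"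
    using Q.subspace_0 [OF assms] by (force simp: set_plus_def)
qed

lemma coset_plus:
  fixes W :: "('a \<Rightarrow> 'b::field_char_0) set"
  assumes "Q.subspace W"
  shows "(v +o W) + (w +o W) = (v + w) +o W"
  by (simp add: set_plus_rearrange subspace_plus_self [OF assms])

text \<open>Both the scalar multiplication of a quotient and the map induced by a linear map have this form.
  Adding \<open>W'\<close> turns the image of a coset, which may be smaller than a coset, into a coset.\<close>

lemma image_coset_plus:
  fixes W :: "('a \<Rightarrow> 'b::field_char_0) set" and W' :: "('c \<Rightarrow> 'd::field_char_0) set"
  assumes W: "Q.subspace W" and W': "Q.subspace W'"
    and add: "\<And>x y. f (x + y) = f x + f y" and f: "f ` W \<subseteq> W'"
  shows "f ` (v +o W) + W' = f v +o W'"
proof -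
  have "f ` (v +o W) = f v +o f ` W"
    unfolding elt_set_plus_def
  proof (intro subset_antisym subsetI)
    fix z assume "z \<in> {c. \<exists>b\<in>f ` W. c = f v + b}"
    then obtain b where "b \<in> W" "z = f (v + b)"
      unfolding add by blast
    then show "z \<in> f ` {c. \<exists>b\<in>W. c = v + b}"
      by blast
  qed (use add in blast)
  moreover have "f ` W + W' = W'"
  proof
    show "f ` W + W' \<subseteq> W'"
      using set_plus_mono2 [OF f order.refl, of W'] by (simp add: subspace_plus_self [OF W'])
    have "f 0 = 0"
      using add [of 0 0] by simp
    then have "0 \<in> f ` W"
      using Q.subspace_0 [OF W] by (metis imageI)
    then show "W' \<subseteq> f ` W + W'"
      using set_zero_plus2 [of "f ` W" W'] by simp
  qed
  ultimately show ?thesis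
    by (simp add: set_plus_rearrange3)
qed

lemma quotient_space_sel:
  "carrier (quotient_space V W) = (\<lambda>v. v +o W) ` V"
  "\<zero>\<^bsub>quotient_space V W\<^esub> = W"
  "A \<oplus>\<^bsub>quotient_space V W\<^esub> B = A + B"
  "c \<odot>\<^bsub>quotient_space V W\<^esub> A = qscale c ` A + W"
  by (simp_all add: quotient_space_def)

lemma quotient_space_scale:
  fixes W :: "('a \<Rightarrow> 'b::field_char_0) set"
  assumes "Q.subspace W"
  shows "c \<odot>\<^bsub>quotient_space V W\<^esub> (v +o W) = qscale c v +o W"
  unfolding quotient_space_sel
  by (rule image_coset_plus [OF assms assms qscale_add]) (use Q.subspace_scale [OF assms] in auto)

lemma quotient_space_add:
  fixes W :: "('a \<Rightarrow> 'b::field_char_0) set"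
  assumes "Q.subspace W"
  shows "(v +o W) \<oplus>\<^bsub>quotient_space V W\<^esub> (w +o W) = (v + w) +o W"
  unfolding quotient_space_sel by (rule coset_plus [OF assms])

lemma abelian_monoid_quotient_space:
  fixes V W :: "('a \<Rightarrow> 'b::field_char_0) set"
  assumes V: "Q.subspace V" and W: "Q.subspace W"
  shows "abelian_monoid (quotient_space V W)"
proof (rule abelian_monoidI)
  have zero: "W = 0 +o W"
    by (rule set_zero_plus [symmetric])
  show "\<zero>\<^bsub>quotient_space V W\<^esub> \<in> carrier (quotient_space V W)"
    unfolding quotient_space_sel using Q.subspace_0 [OF V] zero by blast
  fix x y z
  assume "x \<in> carrier (quotient_space V W)"
  then obtain a where x: "x = a +o W" "a \<in> V"
    by (auto simp: quotient_space_sel)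
  show "\<zero>\<^bsub>quotient_space V W\<^esub> \<oplus>\<^bsub>quotient_space V W\<^esub> x = x"
    unfolding quotient_space_sel x using coset_plus [OF W, of 0 a] zero by simp
  assume "y \<in> carrier (quotient_space V W)"
  then obtain b where y: "y = b +o W" "b \<in> V"
    by (auto simp: quotient_space_sel)
  show "x \<oplus>\<^bsub>quotient_space V W\<^esub> y \<in> carrier (quotient_space V W)"
    using x y Q.subspace_add [OF V] by (auto simp: quotient_space_sel coset_plus [OF W])
  show "x \<oplus>\<^bsub>quotient_space V W\<^esub> y = y \<oplus>\<^bsub>quotient_space V W\<^esub> x"
    by (simp add: quotient_space_sel add.commute)
  assume "z \<in> carrier (quotient_space V W)"
  show "x \<oplus>\<^bsub>quotient_space V W\<^esub> y \<oplus>\<^bsub>quotient_space V W\<^esub> z =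
      x \<oplus>\<^bsub>quotient_space V W\<^esub> (y \<oplus>\<^bsub>quotient_space V W\<^esub> z)"
    by (simp add: quotient_space_sel add.assoc)
qed

lemma finsum_quotient_space:
  fixes V W :: "('a \<Rightarrow> 'b::field_char_0) set"
  assumes V: "Q.subspace V" and W: "Q.subspace W" and "finite S" and b: "\<And>s. s \<in> S \<Longrightarrow> b s \<in> V"
  shows "(\<Oplus>\<^bsub>quotient_space V W\<^esub>s\<in>S. c s \<odot>\<^bsub>quotient_space V W\<^esub> (b s +o W)) =
    (\<Sum>s\<in>S. qscale (c s) (b s)) +o W"
proof -
  interpret abelian_monoid "quotient_space V W"
    by (rule abelian_monoid_quotient_space [OF V W])
  have carrier: "qscale (c s) (b s) +o W \<in> carrier (quotient_space V W)" if "s \<in> S" for s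
    using b [OF that] Q.subspace_scale [OF V] by (auto simp: quotient_space_sel)
  show ?thesis
    using \<open>finite S\<close> carrier unfolding quotient_space_scale [OF W]
  proof (induction S rule: finite_induct)
    case empty
    show ?case
      by (simp only: finsum_empty sum.empty quotient_space_sel set_zero_plus)
  next
    case (insert s S)
    then show ?case
      by (subst finsum_insert) (auto simp: quotient_space_add [OF W])
  qed
qed

lemma linear_iso_quotient_spaces:
  fixes V W :: "('a \<Rightarrow> 'b::field_char_0) set" and V' W' :: "('c \<Rightarrow> 'd::field_char_0) set"
  assumes V: "Q.subspace V" and W: "Q.subspace W" and W': "Q.subspace W'"
    and add: "\<And>x y. f (x + y) = f x + f y" and scale: "\<And>c x. f (qscale c x) = qscale c (f x)"
    and WV: "W \<subseteq> V" and fV: "f ` V \<subseteq> V'" and fW: "f ` W \<subseteq> W'"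
    and inj: "\<And>v. v \<in> V \<Longrightarrow> f v \<in> W' \<Longrightarrow> v \<in> W"
    and surj: "\<And>v'. v' \<in> V' \<Longrightarrow> \<exists>v\<in>V. v' - f v \<in> W'"
  shows "linear_iso (quotient_space V W) (quotient_space V' W') (\<lambda>C. f ` C + W')"
proof -
  let ?\<phi> = "\<lambda>C. f ` C + W'"
  have \<phi>: "?\<phi> (v +o W) = f v +o W'" for v
    by (rule image_coset_plus [OF W W' add fW])
  have diff: "f (x - y) = f x - f y" for x y
    using add [of "x - y" y] by simp
  have "?\<phi> \<in> hom (add_monoid (quotient_space V W)) (add_monoid (quotient_space V' W'))"
  proof (rule homI)
    fix x assume "x \<in> carrier (add_monoid (quotient_space V W))"
    then obtain a where x: "x = a +o W" "a \<in> V"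
      by (auto simp: quotient_space_sel)
    then show "?\<phi> x \<in> carrier (add_monoid (quotient_space V' W'))"
      using fV by (auto simp: \<phi> quotient_space_sel)
    fix y assume "y \<in> carrier (add_monoid (quotient_space V W))"
    then obtain b where y: "y = b +o W" "b \<in> V"
      by (auto simp: quotient_space_sel)
    show "?\<phi> (x \<otimes>\<^bsub>add_monoid (quotient_space V W)\<^esub> y) =
        ?\<phi> x \<otimes>\<^bsub>add_monoid (quotient_space V' W')\<^esub> ?\<phi> y"
      by (simp add: quotient_space_sel coset_plus [OF W] coset_plus [OF W'] x y \<phi> add)
  qed
  moreover have "bij_betw ?\<phi> (carrier (quotient_space V W)) (carrier (quotient_space V' W'))"
    unfolding bij_betw_def
  proof
    show "inj_on ?\<phi> (carrier (quotient_space V W))"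
    proof (rule inj_onI)
      fix x y
      assume xy: "x \<in> carrier (quotient_space V W)" "y \<in> carrier (quotient_space V W)" "?\<phi> x = ?\<phi> y"
      then obtain a b where ab: "x = a +o W" "a \<in> V" "y = b +o W" "b \<in> V"
        by (auto simp: quotient_space_sel)
      have "f (a - b) \<in> W'"
        using xy(3) unfolding ab \<phi> diff coset_eq_iff [OF W'] .
      then have "a - b \<in> W"
        using ab Q.subspace_diff [OF V] by (intro inj) auto
      then show "x = y"
        unfolding ab coset_eq_iff [OF W] .
    qed
    show "?\<phi> ` carrier (quotient_space V W) = carrier (quotient_space V' W')"
    proof
      show "?\<phi> ` carrier (quotient_space V W) \<subseteq> carrier (quotient_space V' W')"
        using fV by (auto simp: quotient_space_sel \<phi>)
      show "carrier (quotient_space V' W') \<subseteq> ?\<phi> ` carrier (quotient_space V W)"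
      proof
        fix y assume "y \<in> carrier (quotient_space V' W')"
        then obtain v' where v': "y = v' +o W'" "v' \<in> V'"
          by (auto simp: quotient_space_sel)
        obtain v where v: "v \<in> V" "v' - f v \<in> W'"
          using surj [OF v'(2)] by blast
        have "y = ?\<phi> (v +o W)"
          unfolding v' \<phi> coset_eq_iff [OF W'] by (rule v(2))
        with v(1) show "y \<in> ?\<phi> ` carrier (quotient_space V W)"
          unfolding quotient_space_sel by blast
      qed
    qed
  qed
  moreover have "?\<phi> (c \<odot>\<^bsub>quotient_space V W\<^esub> x) = c \<odot>\<^bsub>quotient_space V' W'\<^esub> ?\<phi> x"
    if "x \<in> carrier (quotient_space V W)" for c x
    using that by (auto simp: quotient_space_sel(1) quotient_space_scale [OF W] quotient_space_scale [OF W'] \<phi> scale)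
  ultimately show ?thesis
    unfolding linear_iso_def iso_def by simp
qed

lemma finite_basis_quotient_space:
  fixes V W :: "('a \<Rightarrow> 'b::field_char_0) set"
  assumes V: "Q.subspace V" and W: "Q.subspace W" and S: "finite S" and b: "\<And>s. s \<in> S \<Longrightarrow> b s \<in> V"
    and spans: "\<And>v. v \<in> V \<Longrightarrow> \<exists>c. v - (\<Sum>s\<in>S. qscale (c s) (b s)) \<in> W"
    and independent: "\<And>c s. (\<Sum>s\<in>S. qscale (c s) (b s)) \<in> W \<Longrightarrow> s \<in> S \<Longrightarrow> c s = 0"
  shows "finite_basis (quotient_space V W) S (\<lambda>s. b s +o W)"
proof -
  have finsum: "(\<Oplus>\<^bsub>quotient_space V W\<^esub>s\<in>S. c s \<odot>\<^bsub>quotient_space V W\<^esub> (b s +o W)) =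
    (\<Sum>s\<in>S. qscale (c s) (b s)) +o W" for c
    by (rule finsum_quotient_space [OF V W S b])
  show ?thesis
  unfolding finite_basis_def finsum
proof (intro conjI allI impI ballI)
  show "(\<lambda>s. b s +o W) \<in> S \<rightarrow> carrier (quotient_space V W)"
    using b by (auto simp: quotient_space_sel)
  show "\<exists>c. x = (\<Sum>s\<in>S. qscale (c s) (b s)) +o W" if x: "x \<in> carrier (quotient_space V W)" for x
  proof -
    from x obtain v where v: "x = v +o W" "v \<in> V"
      by (auto simp: quotient_space_sel)
    then show ?thesis
      using spans coset_eq_iff [OF W] by metis
  qed
  show "c s = 0" if "(\<Sum>s\<in>S. qscale (c s) (b s)) +o W = \<zero>\<^bsub>quotient_space V W\<^esub>" "s \<in> S" for c s
  proof -
    have "(\<Sum>s\<in>S. qscale (c s) (b s)) +o W = 0 +o W"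
      using that(1) by (simp add: quotient_space_sel elt_set_plus_def)
    then have "(\<Sum>s\<in>S. qscale (c s) (b s)) \<in> W"
      unfolding coset_eq_iff [OF W] by simp
    then show ?thesis
      using that(2) independent by blast
  qed
qed (use S in auto)
qed

section \<open>Forms of top degree\<close>

definition top_form :: "nat \<Rightarrow> ratfun \<Rightarrow> form" where
  "top_form l f = (\<lambda>I. if I = {1..l} then f else 0)"

lemma top_form_add: "top_form l (f + g) = top_form l f + top_form l g"
  by (auto simp: top_form_def)

lemma top_form_diff: "top_form l (f - g) = top_form l f - top_form l g"
  by (auto simp: top_form_def)

lemma top_form_scale: "top_form l (of_rat c * f) = qscale c (top_form l f)"
  by (auto simp: top_form_def qscale_def)

lemma top_form_0: "top_form l 0 = 0"
  by (auto simp: top_form_def)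

lemma top_form_sum: "top_form l (sum f S) = (\<Sum>x\<in>S. top_form l (f x))"
  by (induction S rule: infinite_finite_induct) (auto simp: top_form_0 top_form_add)

lemma top_form_inj: "top_form l f = top_form l g \<longleftrightarrow> f = g"
  by (auto simp: top_form_def fun_eq_iff)

lemma subset_card_eq: "J \<subseteq> {1..l} \<Longrightarrow> card J = l \<Longrightarrow> J = {1..l}"
  using card_subset_eq [of "{1..l}" J] by simp

lemma forms_top: "forms l l = top_form l ` coordinate_ring l"
proof
  show "forms l l \<subseteq> top_form l ` coordinate_ring l"
  proof
    fix \<omega> assume \<omega>: "\<omega> \<in> forms l l"
    have "\<omega> I = top_form l (\<omega> {1..l}) I" for I
    proof (cases "I = {1..l}")
      case False
      then have "\<omega> I = 0"
        using \<omega> subset_card_eq unfolding forms_def by blast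
      with False show ?thesis
        unfolding top_form_def by simp
    qed (simp add: top_form_def)
    then have "\<omega> = top_form l (\<omega> {1..l})"
      by (rule ext)
    moreover have "\<omega> {1..l} \<in> coordinate_ring l"
      using \<omega> by (auto simp: forms_def)
    ultimately show "\<omega> \<in> top_form l ` coordinate_ring l"
      by blast
  qed
qed (auto simp: forms_def top_form_def split: if_splits)

lemma ext_deriv_top_form:
  assumes "f \<in> coordinate_ring l"
  shows "ext_deriv (top_form l f) = 0"
proof
  fix J
  have "partial i (top_form l f (J - {i})) = 0" if "i \<in> J" for i
  proof (cases "J - {i} = {1..l}")
    case True
    then have "i \<notin> {1..l}"
      by blast
    then show ?thesis
      unfolding top_form_def True using partial_eq_0 [OF assms] by simp
  next
    case False
    then show ?thesis
      unfolding top_form_def by simp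
  qed
  then show "ext_deriv (top_form l f) J = 0 J"
    by (simp add: ext_deriv_def)
qed

lemma closed_forms_top: "closed_forms l l = top_form l ` coordinate_ring l"
  unfolding closed_forms_def forms_top by (auto simp: ext_deriv_top_form)

lemma partial_sign: "partial i ((- 1) ^ k * f) = (- 1) ^ k * partial i f"
proof -
  have "(- 1 :: ratfun) ^ k = of_rat ((- 1) ^ k)"
    by (simp add: of_rat_power of_rat_minus)
  then show ?thesis
    by (simp add: partial_mult)
qed

text \<open>A form of degree \<open>l - 1\<close> has one coefficient for each omitted coordinate. The signs of the exterior
  derivative are constants and are absorbed into the coefficients.\<close>

lemma exact_forms_top:
  assumes "l > 0"
  shows "exact_forms l l = top_form l ` exact_functions l"
proof
  let ?s = "\<lambda>i. (- 1 :: ratfun) ^ card {j \<in> {1..l}. j < i}"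
  have sign: "?s i * f \<in> coordinate_ring l" if "f \<in> coordinate_ring l" for i f
    using that coordinate_ring_uminus [OF coordinate_ring_1]
    by (intro coordinate_ring_mult coordinate_ring_power)
  show "exact_forms l l \<subseteq> top_form l ` exact_functions l"
  proof
    fix \<eta> assume "\<eta> \<in> exact_forms l l"
    then obtain \<omega> where \<omega>: "\<omega> \<in> forms l (l - 1)" and \<eta>: "\<eta> = ext_deriv \<omega>"
      using assms by (auto simp: exact_forms_def)
    have R: "\<omega> I \<in> coordinate_ring l" for I
      using \<omega> by (auto simp: forms_def)
    have "ext_deriv \<omega> J = 0" if J: "J \<noteq> {1..l}" for J
    proof -
      have "partial i (\<omega> (J - {i})) = 0" if i: "i \<in> J" for i
      proof (cases "\<omega> (J - {i}) = 0 \<or> i \<notin> {1..l}")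
        case True
        then show ?thesis
          using partial_eq_0 [OF R] by auto
      next
        case False
        then have JI: "J - {i} \<subseteq> {1..l}" "card (J - {i}) = l - 1" "i \<in> {1..l}"
          using \<omega> by (auto simp: forms_def)
        then have "J \<subseteq> {1..l}"
          by blast
        moreover from this have "card J = l"
          using JI(2) i assms finite_subset [of J "{1..l}"] card_Suc_Diff1 [of J i] by simp
        ultimately show ?thesis
          using J subset_card_eq by blast
      qed
      then show ?thesis
        by (simp add: ext_deriv_def)
    qed
    then have "\<eta> = top_form l (ext_deriv \<omega> {1..l})"
      unfolding \<eta> top_form_def by auto
    moreover have "ext_deriv \<omega> {1..l} = (\<Sum>i\<in>{1..l}. partial i (?s i * \<omega> ({1..l} - {i})))"
      by (simp add: ext_deriv_def partial_sign)
    then have "ext_deriv \<omega> {1..l} \<in> exact_functions l"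
      unfolding exact_functions_def using sign [OF R]
      by (intro CollectI exI [of _ "\<lambda>i. ?s i * \<omega> ({1..l} - {i})"]) auto
    ultimately show "\<eta> \<in> top_form l ` exact_functions l"
      by blast
  qed
  show "top_form l ` exact_functions l \<subseteq> exact_forms l l"
  proof
    fix \<eta> assume "\<eta> \<in> top_form l ` exact_functions l"
    then obtain F where \<eta>: "\<eta> = top_form l (\<Sum>i\<in>{1..l}. partial i (F i))"
      and F: "\<forall>i\<in>{1..l}. F i \<in> coordinate_ring l"
      by (auto simp: exact_functions_def)
    define \<omega> :: form where
      "\<omega> I = (\<Sum>i\<in>{1..l}. if I = {1..l} - {i} then ?s i * F i else 0)" for I
    have \<omega>_forms: "\<omega> \<in> forms l (l - 1)"
    proof -
      have "\<omega> I \<in> coordinate_ring l" for I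
        unfolding \<omega>_def using F sign by (intro coordinate_ring_sum) auto
      moreover have "I \<subseteq> {1..l} \<and> card I = l - 1" if nz: "\<omega> I \<noteq> 0" for I
      proof -
        obtain i where "i \<in> {1..l}" "I = {1..l} - {i}"
          using sum.not_neutral_contains_not_neutral [OF nz [unfolded \<omega>_def]] by (metis (full_types))
        then show ?thesis
          by auto
      qed
      ultimately show ?thesis
        by (auto simp: forms_def)
    qed
    have \<omega>_at: "\<omega> ({1..l} - {i}) = ?s i * F i" if i: "i \<in> {1..l}" for i
    proof -
      have "{1..l} - {i} = {1..l} - {j} \<longleftrightarrow> j = i" if "j \<in> {1..l}" for j
        using i that by blast
      then have "\<omega> ({1..l} - {i}) = (\<Sum>j\<in>{1..l}. if j = i then ?s i * F i else 0)"
        unfolding \<omega>_def by (intro sum.cong) auto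
      then show ?thesis
        using i by simp
    qed
    have "ext_deriv \<omega> \<in> top_form l ` exact_functions l"
      using \<open>exact_forms l l \<subseteq> top_form l ` exact_functions l\<close> \<omega>_forms assms
      by (auto simp: exact_forms_def)
    then have "ext_deriv \<omega> = top_form l (ext_deriv \<omega> {1..l})"
      by (auto simp: top_form_def)
    also have "ext_deriv \<omega> {1..l} = (\<Sum>i\<in>{1..l}. ?s i * partial i (?s i * F i))"
      unfolding ext_deriv_def by (intro sum.cong) (simp_all only: \<omega>_at)
    also have "\<dots> = (\<Sum>i\<in>{1..l}. partial i (F i))"
      by (simp add: partial_sign mult.assoc [symmetric] flip: power_mult_distrib)
    finally have "\<eta> = ext_deriv \<omega>"
      unfolding \<eta> by simp
    then show "\<eta> \<in> exact_forms l l"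
      using \<omega>_forms assms by (auto simp: exact_forms_def)
  qed
qed

lemma subspace_top_form:
  assumes "0 \<in> S" "\<And>f g. f \<in> S \<Longrightarrow> g \<in> S \<Longrightarrow> f + g \<in> S" "\<And>c f. f \<in> S \<Longrightarrow> of_rat c * f \<in> S"
  shows "Q.subspace (top_form l ` S)"
  unfolding Q.subspace_def
  using assms by (auto simp: top_form_add [symmetric] top_form_scale [symmetric] intro!: image_eqI [of 0 _ 0])
    (simp add: top_form_0)

lemma subspace_closed_forms_top: "Q.subspace (closed_forms l l)"
  unfolding closed_forms_top
  by (intro subspace_top_form) (auto intro: coordinate_ring_add coordinate_ring_mult coordinate_ring_of_rat)

lemma subspace_exact_forms_top: "l > 0 \<Longrightarrow> Q.subspace (exact_forms l l)"
  unfolding exact_forms_top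
  by (intro subspace_top_form) (auto intro: exact_functions_add exact_functions_scale)

lemma top_form_in_image_iff: "top_form l f \<in> top_form l ` S \<longleftrightarrow> f \<in> S"
  by (auto simp: top_form_inj)

section \<open>Cell forms as chains\<close>

text \<open>Cutting a polygon open at \<open>Infty\<close> leaves the word of the other labels, read from there.\<close>

definition open_at_Infty :: "label list \<Rightarrow> label list" where
  "open_at_Infty s = tl (dropWhile (\<lambda>x. x \<noteq> Infty) s) @ takeWhile (\<lambda>x. x \<noteq> Infty) s"

lemma open_at_Infty_append: "Infty \<notin> set u \<Longrightarrow> open_at_Infty (u @ Infty # v) = v @ u"
proof -
  assume "Infty \<notin> set u"
  then have "\<And>x. x \<in> set u \<Longrightarrow> x \<noteq> Infty"
    by auto
  then show ?thesis
    by (simp add: open_at_Infty_def dropWhile_append2 takeWhile_append2)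
qed

lemma labels_eq: "labels l = insert Infty (letters l)"
  by (auto simp: labels_def letters_def)

lemma orderingE:
  assumes "s \<in> orderings l"
  obtains u v where "s = u @ Infty # v" "Infty \<notin> set u" "v @ u \<in> words l"
proof -
  have s: "distinct s" "set s = insert Infty (letters l)"
    using assms by (auto simp: orderings_def labels_eq)
  then obtain u v where uv: "s = u @ Infty # v" "Infty \<notin> set u"
    by (metis insertI1 split_list_first)
  have "Infty \<notin> set (v @ u)" "insert Infty (set (v @ u)) = insert Infty (letters l)" "distinct (v @ u)"
    using s by (auto simp: uv)
  then have "v @ u \<in> words l"
    unfolding words_def using Infty_notin_letters by (metis (mono_tags) insert_ident mem_Collect_eq)
  with uv that show ?thesis
    by blast
qed

lemma open_at_Infty_in_words: "s \<in> orderings l \<Longrightarrow> open_at_Infty s \<in> words l"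
  by (elim orderingE) (simp add: open_at_Infty_append)

lemma word_ordering: "W \<in> words l \<Longrightarrow> W @ [Infty] \<in> orderings l"
  by (auto simp: words_def orderings_def labels_eq)

lemma chain_eq_prod:
  "chain W = 1 / (\<Prod>i<length W - 1. label_value (W ! Suc i) - label_value (W ! i))"
proof (induction W rule: chain.induct)
  case (1 x y w)
  have "(\<Prod>i<length (x # y # w) - 1. label_value ((x # y # w) ! Suc i) - label_value ((x # y # w) ! i)) =
      (label_value y - label_value x) *
      (\<Prod>i<length (y # w) - 1. label_value ((y # w) ! Suc i) - label_value ((y # w) ! i))"
    by (simp add: prod.lessThan_Suc_shift del: prod.lessThan_Suc)
  then show ?case
    using 1 by simp
qed auto

text \<open>The index \<open>0\<close> has the predecessor \<open>Infty\<close>, and the last index is \<open>Infty\<close> itself; the remaining factors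
  belong to consecutive letters of \<open>W\<close>.\<close>

lemma cell_form_word:
  assumes "W \<in> words l"
  shows "cell_form l (W @ [Infty]) = top_form l (chain W)"
proof -
  let ?s = "W @ [Infty]" and ?N = "length W"
  have W: "Infty \<notin> set W"
    using assms words_not_Infty by blast
  have "{i. i < length ?s \<and> ?s ! i \<noteq> Infty \<and> ?s ! ((i + length ?s - 1) mod length ?s) \<noteq> Infty} =
      Suc ` {..<?N - 1}" (is "?L = ?R")
  proof
    show "?L \<subseteq> ?R"
    proof
      fix i assume "i \<in> ?L"
      then have i: "i < Suc ?N" "?s ! i \<noteq> Infty" "?s ! ((i + ?N) mod Suc ?N) \<noteq> Infty"
        by auto
      have "i \<noteq> ?N"
        using i(2) by auto
      moreover have "i \<noteq> 0"
      proof
        assume "i = 0"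
        with i(3) show False
          by simp
      qed
      ultimately show "i \<in> ?R"
        using i(1) by (intro image_eqI [of _ _ "i - 1"]) auto
    qed
    show "?R \<subseteq> ?L"
    proof
      fix i assume "i \<in> ?R"
      then obtain j where j: "i = Suc j" "Suc j < ?N"
        by auto
      have "(Suc j + length ?s - 1) mod length ?s = j"
        using j by (simp add: mod_if)
      moreover have "?s ! i \<in> set W" "?s ! j \<in> set W"
        using j by (simp_all add: nth_append)
      then have "?s ! i \<noteq> Infty" "?s ! j \<noteq> Infty"
        using W by metis+
      ultimately show "i \<in> ?L"
        using j by simp
    qed
  qed
  moreover have "(\<Prod>i\<in>Suc ` {..<?N - 1}.
      label_value (?s ! i) - label_value (?s ! ((i + length ?s - 1) mod length ?s))) =
      (\<Prod>i<?N - 1. label_value (W ! Suc i) - label_value (W ! i))"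
    by (subst prod.reindex) (auto intro!: prod.cong simp: nth_append mod_if)
  ultimately show ?thesis
    unfolding cell_form_def top_form_def chain_eq_prod by (simp only:)
qed

text \<open>Replacing the omitted factors by \<open>1\<close> gives a product over all cyclically consecutive pairs, which can be
  reindexed.\<close>

lemma cell_form_rotate1: "cell_form l (rotate1 s) = cell_form l s"
proof (cases "s = []")
  case False
  let ?n = "length s"
  define H where "H a b = (if b \<noteq> Infty \<and> a \<noteq> Infty then label_value b - label_value a else 1)" for a b
  have eq: "(\<Prod>i\<in>{i. i < length s \<and> s ! i \<noteq> Infty \<and> s ! ((i + length s - 1) mod length s) \<noteq> Infty}.
      label_value (s ! i) - label_value (s ! ((i + length s - 1) mod length s))) =
      (\<Prod>i<length s. H (s ! ((i + length s - 1) mod length s)) (s ! i))" for s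
    unfolding H_def by (subst prod.inter_filter [symmetric]) (auto intro!: prod.cong)
  have n: "?n > 0"
    using False by simp
  have nth: "rotate1 s ! i = s ! ((i + 1) mod ?n)" if "i < ?n" for i
    using nth_rotate1 [OF that] by simp
  have succ_pred: "((i + ?n - 1) mod ?n + 1) mod ?n = i" if "i < ?n" for i
    using n that by (simp add: mod_Suc_eq)
  have "(\<Prod>i<?n. H (rotate1 s ! ((i + ?n - 1) mod ?n)) (rotate1 s ! i)) =
      (\<Prod>i<?n. H (s ! i) (s ! ((i + 1) mod ?n)))"
    using n by (intro prod.cong refl) (simp add: nth mod_Suc_eq)
  also have "\<dots> = (\<Prod>i<?n. H (s ! ((i + ?n - 1) mod ?n)) (s ! i))"
  proof (rule prod.reindex_bij_witness [where i = "\<lambda>j. (j + ?n - 1) mod ?n" and j = "\<lambda>i. (i + 1) mod ?n"])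
    fix i assume "i \<in> {..<?n}"
    then have i: "i < ?n"
      by simp
    have pred_succ: "((i + 1) mod ?n + ?n - 1) mod ?n = i"
      using i n by (cases "i + 1 = ?n") auto
    then show "((i + 1) mod ?n + ?n - 1) mod ?n = i" .
    show "((i + ?n - 1) mod ?n + 1) mod ?n = i"
      by (rule succ_pred [OF i])
    show "(i + 1) mod ?n \<in> {..<?n}" "(i + ?n - 1) mod ?n \<in> {..<?n}"
      using n by simp_all
    show "H (s ! (((i + 1) mod ?n + ?n - 1) mod ?n)) (s ! ((i + 1) mod ?n)) = H (s ! i) (s ! ((i + 1) mod ?n))"
      by (simp only: pred_succ)
  qed
  finally have rotated: "(\<Prod>i<?n. H (rotate1 s ! ((i + ?n - 1) mod ?n)) (rotate1 s ! i)) =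
      (\<Prod>i<?n. H (s ! ((i + ?n - 1) mod ?n)) (s ! i))" .
  show ?thesis
    unfolding cell_form_def eq unfolding length_rotate1 rotated ..
qed simp

lemma cell_form_rotate: "cell_form l (rotate k s) = cell_form l s"
  by (induction k) (auto simp: cell_form_rotate1)

lemma cyclic_rotate: "cyclic (rotate k s) = cyclic s"
proof
  show "cyclic (rotate k s) \<subseteq> cyclic s"
    by (auto simp: cyclic_def rotate_rotate)
  show "cyclic s \<subseteq> cyclic (rotate k s)"
  proof
    fix r assume "r \<in> cyclic s"
    then obtain m where r: "r = rotate m s"
      by (auto simp: cyclic_def)
    show "r \<in> cyclic (rotate k s)"
    proof (cases "s = []")
      case False
      have "k \<le> k * length s"
        using False by (cases s) auto
      then have "m + (k * length s - k) + k = m + k * length s"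
        by (metis add.assoc le_add_diff_inverse2)
      then have "rotate (m + (k * length s - k)) (rotate k s) = rotate (m + k * length s) s"
        by (simp only: rotate_rotate)
      also have "\<dots> = r"
        unfolding r by (subst (1 2) rotate_conv_mod) simp
      finally show ?thesis
        by (force simp: cyclic_def)
    qed (auto simp: cyclic_def r)
  qed
qed

lemma rotate_to_open:
  assumes "s \<in> orderings l"
  obtains k where "open_at_Infty s @ [Infty] = rotate k s"
proof -
  from assms obtain u v where uv: "s = u @ Infty # v" "Infty \<notin> set u"
    by (rule orderingE)
  have "s = (u @ [Infty]) @ v"
    by (simp add: uv)
  then have "open_at_Infty s @ [Infty] = rotate (length (u @ [Infty])) s"
    using rotate_append [of "u @ [Infty]" v] open_at_Infty_append [OF uv(2), of v] uv(1)
    by (simp only: append_assoc)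
  then show ?thesis
    by (rule that)
qed

lemma cell_form_eq:
  assumes "s \<in> orderings l"
  shows "cell_form l s = top_form l (chain (open_at_Infty s))"
proof -
  obtain k where k: "open_at_Infty s @ [Infty] = rotate k s"
    using rotate_to_open [OF assms] .
  show ?thesis
    using cell_form_word [OF open_at_Infty_in_words [OF assms]] unfolding k cell_form_rotate .
qed

lemma polygon_eq:
  assumes "s \<in> orderings l"
  shows "polygon s = polygon (open_at_Infty s @ [Infty])"
proof -
  obtain k where k: "open_at_Infty s @ [Infty] = rotate k s"
    using rotate_to_open [OF assms] .
  show ?thesis
    unfolding k polygon_def cyclic_rotate ..
qed

section \<open>Polygons modulo shuffles\<close>

abbreviation word_polygon :: "label list \<Rightarrow> label list set \<Rightarrow> rat" where
  "word_polygon W \<equiv> polygon (W @ [Infty])"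

definition polygon_spanned :: "nat \<Rightarrow> label list set \<Rightarrow> (label list set \<Rightarrow> rat) set" where
  "polygon_spanned l S =
     {v. \<exists>c. v - (\<Sum>W\<in>S. qscale (c W) (word_polygon W)) \<in> shuffle_space l}"

lemma subspace_shuffle_space: "Q.subspace (shuffle_space l)"
  unfolding shuffle_space_def by (rule Q.subspace_span)

lemma subspace_polygon_spanned: "Q.subspace (polygon_spanned l S)"
proof (rule Q.subspaceI)
  show "0 \<in> polygon_spanned l S"
    unfolding polygon_spanned_def
    using Q.subspace_0 [OF subspace_shuffle_space] by (intro CollectI exI [of _ "\<lambda>_. 0"]) simp
next
  fix v w
  assume "v \<in> polygon_spanned l S" "w \<in> polygon_spanned l S"
  then obtain c d where "v - (\<Sum>W\<in>S. qscale (c W) (word_polygon W)) \<in> shuffle_space l"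
    "w - (\<Sum>W\<in>S. qscale (d W) (word_polygon W)) \<in> shuffle_space l"
    unfolding polygon_spanned_def by blast
  from Q.subspace_add [OF subspace_shuffle_space this]
  show "v + w \<in> polygon_spanned l S"
    unfolding polygon_spanned_def
    by (intro CollectI exI [of _ "\<lambda>W. c W + d W"]) (simp add: Q.scale_left_distrib sum.distrib algebra_simps)
next
  fix r v
  assume "v \<in> polygon_spanned l S"
  then obtain c where "v - (\<Sum>W\<in>S. qscale (c W) (word_polygon W)) \<in> shuffle_space l"
    unfolding polygon_spanned_def by blast
  from Q.subspace_scale [OF subspace_shuffle_space this, of r]
  show "qscale r v \<in> polygon_spanned l S"
    unfolding polygon_spanned_def
    by (intro CollectI exI [of _ "\<lambda>W. r * c W"])
      (simp add: Q.scale_right_diff_distrib Q.scale_sum_right Q.scale_scale)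
qed

lemma shuffle_space_spanned: "shuffle_space l \<subseteq> polygon_spanned l S"
  unfolding polygon_spanned_def by (auto intro!: exI [of _ "\<lambda>_. 0"])

lemma word_polygon_spanned:
  assumes "finite S" "W \<in> S"
  shows "word_polygon W \<in> polygon_spanned l S"
proof -
  have "(\<Sum>V\<in>S. qscale (if V = W then 1 else 0) (word_polygon V)) =
      (\<Sum>V\<in>S. if V = W then word_polygon V else 0)"
    by (intro sum.cong) auto
  then show ?thesis
    unfolding polygon_spanned_def using assms Q.subspace_0 [OF subspace_shuffle_space]
    by (intro CollectI exI [of _ "\<lambda>V. if V = W then 1 else 0"]) simp
qed

definition initial_words :: "nat \<Rightarrow> label list set" where
  "initial_words l = {W \<in> words l. \<exists>w. W = Zero # w}"

lemma shuffle_in_shuffle_space: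
  assumes "A @ B \<in> words l" "A \<noteq> []" "B \<noteq> []"
  shows "(\<Sum>W\<in>shuffles A B. word_polygon W) \<in> shuffle_space l"
  unfolding shuffle_space_def
proof (rule Q.span_base, intro CollectI exI conjI)
  show "distinct (A @ B)" "set (A @ B) = labels l - {Infty}"
    using assms(1) by (auto simp: words_def labels_eq)
qed (use assms in auto)

text \<open>In the shuffle sum of \<open>u\<close> and \<open>0 v\<close>, every word other than \<open>u 0 v\<close> has fewer letters before \<open>0\<close>.\<close>

lemma word_polygon_spanned_by_initial:
  assumes "u @ Zero # v \<in> words l"
  shows "word_polygon (u @ Zero # v) \<in> polygon_spanned l (initial_words l)"
  using assms
proof (induction u arbitrary: v rule: length_induct)
  case (1 u)
  have fin: "finite (initial_words l)"
    using finite_words by (simp add: initial_words_def)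
  show ?case
  proof (cases "u = []")
    case True
    then show ?thesis
      using 1(2) fin by (intro word_polygon_spanned) (auto simp: initial_words_def)
  next
    case False
    let ?S = "shuffles u (Zero # v)"
    have notin: "Zero \<notin> set u"
      using 1(2) by (auto simp: words_def)
    have "(\<Sum>W\<in>?S. word_polygon W) =
        word_polygon (u @ Zero # v) + (\<Sum>W\<in>?S - {u @ Zero # v}. word_polygon W)"
      using append_in_shuffles by (intro sum.remove) auto
    then have eq: "word_polygon (u @ Zero # v) =
        (\<Sum>W\<in>?S. word_polygon W) - (\<Sum>W\<in>?S - {u @ Zero # v}. word_polygon W)"
      by simp
    have "(\<Sum>W\<in>?S. word_polygon W) \<in> polygon_spanned l (initial_words l)"
      using shuffle_in_shuffle_space [OF 1(2) False] shuffle_space_spanned by blast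
    moreover have "word_polygon W \<in> polygon_spanned l (initial_words l)"
      if W: "W \<in> ?S - {u @ Zero # v}" for W
    proof -
      from W shuffles_position [of W u Zero v] notin obtain u' v'
        where W': "W = u' @ Zero # v'" "length u' < length u"
        by auto
      have "W \<in> words l"
        using shuffle_in_words [of "[]" u "Zero # v" "[]" l W] W 1(2) by simp
      with 1(1) W' show ?thesis
        by simp
    qed
    ultimately show ?thesis
      unfolding eq
      by (rule Q.subspace_diff [OF subspace_polygon_spanned _ Q.subspace_sum [OF subspace_polygon_spanned]])
  qed
qed

lemma polygon_space_spanned_by_initial: "polygon_space l \<subseteq> polygon_spanned l (initial_words l)"
  unfolding polygon_space_def
proof (rule Q.span_minimal [OF _ subspace_polygon_spanned], rule image_subsetI)
  fix s assume s: "s \<in> orderings l"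
  have "Zero \<in> letters l"
    by (simp add: letters_def)
  then obtain u v where "open_at_Infty s = u @ Zero # v"
    using words_cases_at [OF open_at_Infty_in_words [OF s]] by blast
  then show "polygon s \<in> polygon_spanned l (initial_words l)"
    using word_polygon_spanned_by_initial open_at_Infty_in_words [OF s] polygon_eq [OF s] by metis
qed

text \<open>The linear map that sends a polygon to the coefficient of its cell form. A polygon is a class of lists, so
  a representative is chosen; the cell form does not depend on it.\<close>

definition polygon_function :: "nat \<Rightarrow> (label list set \<Rightarrow> rat) \<Rightarrow> ratfun" where
  "polygon_function l v = (\<Sum>C\<in>cyclic ` orderings l. of_rat (v C) *
     chain (open_at_Infty (SOME s. s \<in> orderings l \<and> cyclic s = C)))"

lemma finite_orderings: "finite (orderings l)"
proof (rule finite_subset)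
  show "orderings l \<subseteq> {W. set W \<subseteq> labels l \<and> length W \<le> card (labels l)}"
    by (auto simp: orderings_def distinct_card [symmetric])
  show "finite {W. set W \<subseteq> labels l \<and> length W \<le> card (labels l)}"
    by (rule finite_lists_length_le) (simp add: labels_eq)
qed

lemma polygon_function_add: "polygon_function l (v + w) = polygon_function l v + polygon_function l w"
  by (simp add: polygon_function_def of_rat_add distrib_right sum.distrib)

lemma polygon_function_scale: "polygon_function l (qscale c v) = of_rat c * polygon_function l v"
  by (simp add: polygon_function_def qscale_def of_rat_mult sum_distrib_left mult.assoc)

lemma polygon_function_polygon:
  assumes s: "s \<in> orderings l"
  shows "polygon_function l (polygon s) = chain (open_at_Infty s)"
proof -
  define r where "r = (SOME r. r \<in> orderings l \<and> cyclic r = cyclic s)"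
  have r: "r \<in> orderings l" "cyclic r = cyclic s"
    using someI [of "\<lambda>r. r \<in> orderings l \<and> cyclic r = cyclic s" s] s by (auto simp: r_def)
  have "r \<in> cyclic r"
    unfolding cyclic_def by (rule CollectI, rule exI [of _ 0]) simp
  then have "r \<in> cyclic s"
    unfolding r(2) .
  then obtain k where "r = rotate k s"
    by (auto simp: cyclic_def)
  then have "top_form l (chain (open_at_Infty r)) = top_form l (chain (open_at_Infty s))"
    using cell_form_eq [OF s] cell_form_eq [OF r(1)] by (simp add: cell_form_rotate)
  then have *: "chain (open_at_Infty r) = chain (open_at_Infty s)"
    by (simp add: top_form_inj)
  have "polygon_function l (polygon s) =
      (\<Sum>C\<in>cyclic ` orderings l. if C = cyclic s then chain (open_at_Infty r) else 0)"
    unfolding polygon_function_def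
  proof (intro sum.cong refl)
    fix C
    show "of_rat (polygon s C) * chain (open_at_Infty (SOME s. s \<in> orderings l \<and> cyclic s = C)) =
        (if C = cyclic s then chain (open_at_Infty r) else 0)"
      by (cases "C = cyclic s") (simp_all add: polygon_def r_def)
  qed
  also have "\<dots> = chain (open_at_Infty s)"
    using s finite_orderings by (simp add: *)
  finally show ?thesis .
qed

lemma polygon_function_word: "W \<in> words l \<Longrightarrow> polygon_function l (word_polygon W) = chain W"
proof -
  assume W: "W \<in> words l"
  then have "open_at_Infty (W @ [Infty]) = W"
    using open_at_Infty_append [of W "[]"] words_not_Infty by simp
  with W show ?thesis
    by (simp add: polygon_function_polygon word_ordering)
qed

lemma polygon_function_0: "polygon_function l 0 = 0"
  using polygon_function_scale [of l 0 0] by simp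

lemma polygon_function_sum: "polygon_function l (sum f S) = (\<Sum>x\<in>S. polygon_function l (f x))"
proof (induction S rule: infinite_finite_induct)
  case (infinite S)
  then show ?case
    by (simp only: sum.infinite [OF infinite] polygon_function_0)
next
  case (insert x S)
  then show ?case
    by (simp only: sum.insert [OF insert(1,2)] polygon_function_add)
qed (simp only: sum.empty polygon_function_0)

lemma polygon_function_diff: "polygon_function l (v - w) = polygon_function l v - polygon_function l w"
  using polygon_function_add [of l "v - w" w] by simp

lemma polygon_function_shuffle_space:
  assumes "v \<in> shuffle_space l"
  shows "polygon_function l v = 0"
  using assms unfolding shuffle_space_def
proof (induction rule: Q.span_induct_alt)
  case base
  then show ?case
    by (rule polygon_function_0)
next
  case (step c v w)
  then obtain A B where AB: "v = (\<Sum>W\<in>shuffles A B. word_polygon W)" "A \<noteq> []" "B \<noteq> []"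
    "distinct (A @ B)" "set (A @ B) = labels l - {Infty}"
    by blast
  have "A @ B \<in> words l"
    using AB by (auto simp: words_def labels_eq)
  then have "W \<in> words l" if "W \<in> shuffles A B" for W
    using shuffle_in_words [of "[]" A B "[]" l W] that by simp
  then have "polygon_function l v = (\<Sum>W\<in>shuffles A B. chain W)"
    unfolding AB(1) polygon_function_sum by (intro sum.cong) (auto simp: polygon_function_word)
  also have "\<dots> = 0"
    using AB by (intro chain_shuffles_eq_0) auto
  finally show ?case
    using step(2) by (simp only: polygon_function_add polygon_function_scale mult_zero_right add_0_right)
qed

lemma polygon_function_in_coordinate_ring: "polygon_function l v \<in> coordinate_ring l"
  unfolding polygon_function_def
proof (intro coordinate_ring_sum coordinate_ring_mult coordinate_ring_of_rat)
  fix C assume "C \<in> cyclic ` orderings l"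
  then have "(SOME s. s \<in> orderings l \<and> cyclic s = C) \<in> orderings l"
    using someI_ex [of "\<lambda>s. s \<in> orderings l \<and> cyclic s = C"] by blast
  from open_at_Infty_in_words [OF this]
  show "chain (open_at_Infty (SOME s. s \<in> orderings l \<and> cyclic s = C)) \<in> coordinate_ring l"
    by (intro chain_in_coordinate_ring) (auto simp: words_def)
qed

section \<open>Two independent families of words\<close>

lemma initial_words_independent:
  assumes "(\<Sum>W\<in>initial_words l. of_rat (c W) * chain W) \<in> exact_functions l" "W \<in> initial_words l"
  shows "c W = 0"
proof (rule chains_independent [where P = "\<lambda>W. \<exists>w. W = Zero # w"])
  fix x y :: "label list" and i
  assume "\<exists>w. x @ T i # y = Zero # w"
  then show "\<exists>w. x @ y = Zero # w"
    by (cases x) auto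
next
  fix U :: "label list" and i
  show "\<exists>k\<le>length U. \<not> (\<exists>w. insert_at k (T i) U = Zero # w)"
    by (intro exI [of _ 0]) (simp add: insert_at_def)
qed (use assms in \<open>auto simp: initial_words_def\<close>)

lemma delete_keeps_adjacency:
  assumes "x @ T i # y = u @ [Zero, One] @ v"
  shows "\<exists>u v. x @ y = u @ [Zero, One] @ v"
proof -
  from assms consider (right) us where "x = u @ us" "us @ T i # y = Zero # One # v"
    | (left) us where "u = x @ us" "T i # y = us @ Zero # One # v"
    by (auto simp: append_eq_append_conv2)
  then show ?thesis
  proof cases
    case right
    then obtain us' where "us = Zero # One # us'" "v = us' @ T i # y"
      by (auto simp: append_eq_Cons_conv)
    with right show ?thesis
      by (intro exI [of _ u] exI [of _ "us' @ y"]) simp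
  next
    case left
    then obtain us' where "us = T i # us'" "y = us' @ Zero # One # v"
      by (cases us) auto
    with left show ?thesis
      by (intro exI [of _ "x @ us'"] exI [of _ v]) simp
  qed
qed

lemma words01_independent:
  assumes "(\<Sum>W\<in>words01 l. of_rat (c W) * chain W) \<in> exact_functions l" "W \<in> words01 l"
  shows "c W = 0"
proof (rule chains_independent [where P = "\<lambda>W. \<exists>u v. W = u @ [Zero, One] @ v"])
  fix x y :: "label list" and i
  assume "\<exists>u v. x @ T i # y = u @ [Zero, One] @ v"
  then show "\<exists>u v. x @ y = u @ [Zero, One] @ v"
    using delete_keeps_adjacency by blast
next
  fix U :: "label list" and i
  assume "\<exists>u v. U = u @ [Zero, One] @ v" "distinct U"
  then obtain u v where U: "U = u @ [Zero, One] @ v" "Zero \<notin> set u" "Zero \<notin> set v"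
    by auto
  have "insert_at (Suc (length u)) (T i) U = u @ Zero # T i # One # v"
    by (simp add: insert_at_def U)
  moreover have "u @ Zero # T i # One # v \<noteq> u' @ Zero # One # v'" for u' v'
  proof
    assume "u @ Zero # T i # One # v = u' @ Zero # One # v'"
    moreover have "Zero \<notin> set (T i # One # v)"
      using U by simp
    ultimately have "T i # One # v = One # v'"
      using U(2) by (metis append_Cons_eq_iff)
    then show False
      by simp
  qed
  ultimately show "\<exists>k\<le>length U. \<not> (\<exists>u v. insert_at k (T i) U = u @ [Zero, One] @ v)"
    by (intro exI [of _ "Suc (length u)"]) (simp add: U)
next
  show "\<not> (\<exists>u v. [One, Zero] = u @ [Zero, One] @ v)"
    by (auto simp: Cons_eq_append_conv)
qed (use assms in \<open>auto simp: words01_def\<close>)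

section \<open>Words containing 01 and permutations\<close>

lemma bij_betw_permute_list:
  assumes "distinct xs"
  shows "bij_betw (\<lambda>\<sigma>. permute_list \<sigma> xs) {\<sigma>. \<sigma> permutes {..<length xs}}
    {ys. distinct ys \<and> set ys = set xs}"
  unfolding bij_betw_def
proof
  show "inj_on (\<lambda>\<sigma>. permute_list \<sigma> xs) {\<sigma>. \<sigma> permutes {..<length xs}}"
  proof (rule inj_onI, clarify, rule ext)
    fix \<sigma> \<tau> i
    assume st: "\<sigma> permutes {..<length xs}" "\<tau> permutes {..<length xs}"
      and eq: "permute_list \<sigma> xs = permute_list \<tau> xs"
    show "\<sigma> i = \<tau> i"
    proof (cases "i < length xs")
      case True
      then have "xs ! \<sigma> i = xs ! \<tau> i"
        using eq st by (metis permute_list_nth)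
      moreover have "\<sigma> i < length xs" "\<tau> i < length xs"
        using True permutes_in_image [OF st(1), of i] permutes_in_image [OF st(2), of i] by auto
      ultimately show ?thesis
        using assms nth_eq_iff_index_eq by blast
    next
      case False
      then show ?thesis
        using permutes_not_in [OF st(1)] permutes_not_in [OF st(2)] by simp
    qed
  qed
  show "(\<lambda>\<sigma>. permute_list \<sigma> xs) ` {\<sigma>. \<sigma> permutes {..<length xs}} = {ys. distinct ys \<and> set ys = set xs}"
  proof
    show "(\<lambda>\<sigma>. permute_list \<sigma> xs) ` {\<sigma>. \<sigma> permutes {..<length xs}} \<subseteq> {ys. distinct ys \<and> set ys = set xs}"
      using assms by auto
    show "{ys. distinct ys \<and> set ys = set xs} \<subseteq> (\<lambda>\<sigma>. permute_list \<sigma> xs) ` {\<sigma>. \<sigma> permutes {..<length xs}}"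
    proof clarify
      fix ys assume "distinct ys" "set ys = set xs"
      then have "mset ys = mset xs"
        using assms by (simp add: set_eq_iff_mset_eq_distinct)
      then obtain p where "p permutes {..<length xs}" "permute_list p xs = ys"
        by (rule mset_eq_permutation)
      then show "ys \<in> (\<lambda>\<sigma>. permute_list \<sigma> xs) ` {\<sigma>. \<sigma> permutes {..<length xs}}"
        by blast
    qed
  qed
qed

lemma bij_betw_words01:
  "bij_betw (\<lambda>ys. open_at_Infty ([Zero, One] @ ys)) {ys. distinct ys \<and> set ys = insert Infty (T ` {1..l})} (words01 l)"
proof (rule bij_betwI')
  fix ys zs
  assume "ys \<in> {ys. distinct ys \<and> set ys = insert Infty (T ` {1..l})}"
    "zs \<in> {ys. distinct ys \<and> set ys = insert Infty (T ` {1..l})}"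
  then have yz: "distinct ys" "set ys = insert Infty (T ` {1..l})" "distinct zs" "set zs = insert Infty (T ` {1..l})"
    by auto
  obtain u v where ys: "ys = u @ Infty # v" "Infty \<notin> set u"
    using yz(2) by (metis insertI1 split_list_first)
  obtain u' v' where zs: "zs = u' @ Infty # v'" "Infty \<notin> set u'"
    using yz(4) by (metis insertI1 split_list_first)
  have y: "open_at_Infty ([Zero, One] @ ys) = v @ Zero # One # u"
    using ys open_at_Infty_append [of "Zero # One # u" v] by simp
  have z: "open_at_Infty ([Zero, One] @ zs) = v' @ Zero # One # u'"
    using zs open_at_Infty_append [of "Zero # One # u'" v'] by simp
  have "Zero \<notin> set ys" "Zero \<notin> set zs"
    unfolding yz by auto
  then have "v = v' \<and> u = u'" if "v @ Zero # One # u = v' @ Zero # One # u'"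
    using append_Cons_eq_iff [of Zero v "One # u" v' "One # u'"] that by (auto simp: ys zs)
  moreover have "Infty \<notin> set v"
    using yz(1) by (simp add: ys(1))
  then have "v = v' \<and> u = u'" if "u @ Infty # v = u' @ Infty # v'"
    using append_Cons_eq_iff [of Infty u v u' v'] that ys(2) by simp
  ultimately show "(open_at_Infty ([Zero, One] @ ys) = open_at_Infty ([Zero, One] @ zs)) = (ys = zs)"
    unfolding y z unfolding ys(1) zs(1) by blast
next
  fix ys
  assume "ys \<in> {ys. distinct ys \<and> set ys = insert Infty (T ` {1..l})}"
  then have yz: "distinct ys" "set ys = insert Infty (T ` {1..l})"
    by auto
  then obtain u v where ys: "ys = u @ Infty # v" "Infty \<notin> set u"
    by (metis insertI1 split_list_first)
  have y: "open_at_Infty ([Zero, One] @ ys) = v @ Zero # One # u"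
    using ys open_at_Infty_append [of "Zero # One # u" v] by simp
  have "[Zero, One] @ ys \<in> orderings l"
    using yz by (auto simp: orderings_def labels_def)
  then have "open_at_Infty ([Zero, One] @ ys) \<in> words l"
    by (rule open_at_Infty_in_words)
  then show "open_at_Infty ([Zero, One] @ ys) \<in> words01 l"
    unfolding words01_def y by auto
next
  fix W assume "W \<in> words01 l"
  then obtain u v where W: "W = v @ Zero # One # u" "W \<in> words l"
    by (auto simp: words01_def)
  have "set W = {Zero, One} \<union> T ` {1..l}" "distinct W"
    using W(2) by (auto simp: words_def letters_def)
  then have uv: "distinct (u @ v)" "Zero \<notin> set (u @ v)" "One \<notin> set (u @ v)"
    "insert Zero (insert One (set (u @ v))) = insert Zero (insert One (T ` {1..l}))"
    by (auto simp: W(1))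
  have "set (u @ v) = T ` {1..l}"
  proof -
    have "insert One (set (u @ v)) = insert One (T ` {1..l})"
      using uv(2,4) by (subst (asm) insert_ident) auto
    then show ?thesis
      using uv(3) by (subst (asm) insert_ident) auto
  qed
  then have "u @ Infty # v \<in> {ys. distinct ys \<and> set ys = insert Infty (T ` {1..l})}" "Infty \<notin> set u"
    using uv(1) by auto
  moreover from this have "W = open_at_Infty ([Zero, One] @ u @ Infty # v)"
    using open_at_Infty_append [of "Zero # One # u" v] by (simp add: W)
  ultimately show "\<exists>ys\<in>{ys. distinct ys \<and> set ys = insert Infty (T ` {1..l})}.
      W = open_at_Infty ([Zero, One] @ ys)"
    by blast
qed

lemma bij_betw_permutations_words01:
  "bij_betw (\<lambda>\<sigma>. open_at_Infty ([Zero, One] @ permute_list \<sigma> (Infty # map T [1..<Suc l])))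
     {\<sigma>. \<sigma> permutes {..<Suc l}} (words01 l)"
proof -
  let ?xs = "Infty # map T [1..<Suc l]"
  have "distinct ?xs"
    by (auto simp: distinct_map inj_on_def)
  moreover have "length ?xs = Suc l" "set ?xs = insert Infty (T ` {1..l})"
    by (auto simp: atLeastLessThanSuc_atLeastAtMost simp del: upt_Suc)
  ultimately have "bij_betw (\<lambda>\<sigma>. permute_list \<sigma> ?xs) {\<sigma>. \<sigma> permutes {..<Suc l}}
      {ys. distinct ys \<and> set ys = insert Infty (T ` {1..l})}"
    using bij_betw_permute_list [of ?xs] by (simp only:)
  from bij_betw_trans [OF this bij_betw_words01] show ?thesis
    by (simp only: comp_def)
qed

section \<open>Top cohomology and cell forms\<close>

theorem theorem1p40:
  fixes n l :: nat
  assumes "n \<ge> 4" and "l = n - 3"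
  shows "(\<exists>\<phi>. linear_iso (quotient_space (polygon_space l) (shuffle_space l)) (de_Rham n l) \<phi> \<and>
              (\<forall>s \<in> orderings l.
                 \<phi> (polygon s +o shuffle_space l) = form_class n l (cell_form l s))) \<and>
         finite_basis (de_Rham n l) {\<sigma>. \<sigma> permutes {..<n - 2}}
           (\<lambda>\<sigma>. form_class n l
              (cell_form l ([Zero, One] @ permute_list \<sigma> (Infty # map T [1..<Suc l]))))"
proof
  have l: "l > 0" "n - 3 = l" "n - 2 = Suc l"
    using assms by auto
  have deRham: "de_Rham n l = quotient_space (closed_forms l l) (exact_forms l l)"
    by (simp add: de_Rham_def l)
  have form_class: "form_class n l \<omega> = \<omega> +o exact_forms l l" for \<omega>
    by (simp add: form_class_def l)
  note closed = closed_forms_top and exact = exact_forms_top [OF l(1)]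
  note subspaces = subspace_closed_forms_top subspace_exact_forms_top [OF l(1)]
  define \<Lambda> where "\<Lambda> v = top_form l (polygon_function l v)" for v
  have \<Lambda>_add: "\<Lambda> (v + w) = \<Lambda> v + \<Lambda> w" and \<Lambda>_scale: "\<Lambda> (qscale c v) = qscale c (\<Lambda> v)" for c v w
    by (simp_all add: \<Lambda>_def polygon_function_add polygon_function_scale top_form_add top_form_scale)
  have \<Lambda>_shuffle: "\<Lambda> ` shuffle_space l \<subseteq> exact_forms l l"
    using polygon_function_shuffle_space Q.subspace_0 [OF subspaces(2)]
    by (auto simp: \<Lambda>_def top_form_0)
  have iso: "linear_iso (quotient_space (polygon_space l) (shuffle_space l))
      (quotient_space (closed_forms l l) (exact_forms l l)) (\<lambda>C. \<Lambda> ` C + exact_forms l l)"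
  proof (rule linear_iso_quotient_spaces)
    show "Q.subspace (polygon_space l)"
      unfolding polygon_space_def by (rule Q.subspace_span)
    show "shuffle_space l \<subseteq> polygon_space l"
      unfolding shuffle_space_def
    proof (rule Q.span_minimal)
      show "Q.subspace (polygon_space l)"
        unfolding polygon_space_def by (rule Q.subspace_span)
      show "{\<Sum>W\<in>shuffles A B. word_polygon W |A B. A \<noteq> [] \<and> B \<noteq> [] \<and> distinct (A @ B) \<and>
          set (A @ B) = labels l - {Infty}} \<subseteq> polygon_space l"
      proof clarify
        fix A B assume AB: "distinct (A @ B)" "set (A @ B) = labels l - {Infty}"
        have "A @ B \<in> words l"
          using AB by (auto simp: words_def labels_eq)
        then have "word_polygon W \<in> polygon_space l" if "W \<in> shuffles A B" for W
          unfolding polygon_space_def using shuffle_in_words [of "[]" A B "[]" l W] that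
          by (intro Q.span_base imageI word_ordering) simp
        then show "(\<Sum>W\<in>shuffles A B. word_polygon W) \<in> polygon_space l"
          unfolding polygon_space_def by (intro Q.span_sum)
      qed
    qed
    show "\<Lambda> ` polygon_space l \<subseteq> closed_forms l l"
      using polygon_function_in_coordinate_ring by (auto simp: closed \<Lambda>_def)
    \<comment> \<open>Modulo shuffles, \<open>v\<close> is a combination of words that start with \<open>0\<close>, and their cell forms are
      independent in cohomology.\<close>
    show "v \<in> shuffle_space l" if v: "v \<in> polygon_space l" "\<Lambda> v \<in> exact_forms l l" for v
    proof -
      obtain c where c: "v - (\<Sum>W\<in>initial_words l. qscale (c W) (word_polygon W)) \<in> shuffle_space l"
        using v(1) polygon_space_spanned_by_initial unfolding polygon_spanned_def by blast
      have "polygon_function l (\<Sum>W\<in>initial_words l. qscale (c W) (word_polygon W)) =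
          (\<Sum>W\<in>initial_words l. of_rat (c W) * chain W)"
        unfolding polygon_function_sum
        by (intro sum.cong) (auto simp: polygon_function_scale polygon_function_word initial_words_def)
      then have "polygon_function l v = (\<Sum>W\<in>initial_words l. of_rat (c W) * chain W)"
        using polygon_function_shuffle_space [OF c] by (simp add: polygon_function_diff)
      moreover have "polygon_function l v \<in> exact_functions l"
        using v(2) by (auto simp: exact \<Lambda>_def top_form_inj)
      ultimately have "c W = 0" if "W \<in> initial_words l" for W
        using initial_words_independent that by simp
      then show ?thesis
        using c by simp
    qed
    show "\<exists>v\<in>polygon_space l. \<omega> - \<Lambda> v \<in> exact_forms l l" if \<omega>: "\<omega> \<in> closed_forms l l" for \<omega>
    proof -
      obtain f where f: "f \<in> coordinate_ring l" "\<omega> = top_form l f"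
        using \<omega> unfolding closed by blast
      obtain c where c: "f - (\<Sum>W\<in>words l. of_rat (c W) * chain W) \<in> exact_functions l"
        using coordinate_ring_spanned [OF f(1)] unfolding spanned_def by blast
      let ?v = "\<Sum>W\<in>words l. qscale (c W) (word_polygon W)"
      have "polygon_function l ?v = (\<Sum>W\<in>words l. of_rat (c W) * chain W)"
        unfolding polygon_function_sum
        by (intro sum.cong) (auto simp: polygon_function_scale polygon_function_word)
      then have "\<omega> - \<Lambda> ?v \<in> exact_forms l l"
        using c by (auto simp: exact f(2) \<Lambda>_def simp flip: top_form_diff)
      moreover have "?v \<in> polygon_space l"
        unfolding polygon_space_def
        by (intro Q.span_sum Q.span_scale Q.span_base imageI word_ordering)
      ultimately show ?thesis
        by blast
    qed
  qed (rule subspace_shuffle_space subspaces \<Lambda>_add \<Lambda>_scale \<Lambda>_shuffle)+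
  have "\<Lambda> ` (polygon s +o shuffle_space l) + exact_forms l l = form_class n l (cell_form l s)"
    if s: "s \<in> orderings l" for s
    unfolding form_class image_coset_plus [OF subspace_shuffle_space subspaces(2) \<Lambda>_add \<Lambda>_shuffle]
    by (simp add: \<Lambda>_def polygon_function_polygon [OF s] cell_form_eq [OF s])
  with iso show "\<exists>\<phi>. linear_iso (quotient_space (polygon_space l) (shuffle_space l)) (de_Rham n l) \<phi> \<and>
      (\<forall>s \<in> orderings l. \<phi> (polygon s +o shuffle_space l) = form_class n l (cell_form l s))"
    unfolding deRham by (intro exI [of _ "\<lambda>C. \<Lambda> ` C + exact_forms l l"]) blast
  let ?w = "\<lambda>\<sigma>. open_at_Infty ([Zero, One] @ permute_list \<sigma> (Infty # map T [1..<Suc l]))"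
  let ?b = "\<lambda>\<sigma>. cell_form l ([Zero, One] @ permute_list \<sigma> (Infty # map T [1..<Suc l]))"
  let ?S = "{\<sigma>. \<sigma> permutes {..<Suc l}}"
  note bij = bij_betw_permutations_words01 [of l]
  have b: "?b \<sigma> = top_form l (chain (?w \<sigma>))" if \<sigma>: "\<sigma> \<in> ?S" for \<sigma>
  proof (rule cell_form_eq)
    have "set (permute_list \<sigma> (Infty # map T [1..<Suc l])) = insert Infty (T ` {1..l})"
      using \<sigma> by (subst set_permute_list)
        (auto simp: atLeastLessThanSuc_atLeastAtMost simp del: upt_Suc)
    moreover have "distinct (permute_list \<sigma> (Infty # map T [1..<Suc l]))"
      using \<sigma> by (subst distinct_permute_list) (auto simp: distinct_map inj_on_def simp del: upt_Suc)
    ultimately show "[Zero, One] @ permute_list \<sigma> (Infty # map T [1..<Suc l]) \<in> orderings l"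
      by (auto simp: orderings_def labels_def)
  qed
  have sum_b: "(\<Sum>\<sigma>\<in>?S. qscale (c (?w \<sigma>)) (?b \<sigma>)) =
      top_form l (\<Sum>W\<in>words01 l. of_rat (c W) * chain W)" for c
  proof -
    have "(\<Sum>\<sigma>\<in>?S. qscale (c (?w \<sigma>)) (?b \<sigma>)) = (\<Sum>\<sigma>\<in>?S. top_form l (of_rat (c (?w \<sigma>)) * chain (?w \<sigma>)))"
      by (intro sum.cong refl) (simp only: b top_form_scale)
    also have "\<dots> = (\<Sum>W\<in>words01 l. top_form l (of_rat (c W) * chain W))"
      by (rule sum.reindex_bij_betw [OF bij])
    finally show ?thesis
      by (simp only: top_form_sum)
  qed
  have "finite_basis (quotient_space (closed_forms l l) (exact_forms l l)) ?S (\<lambda>\<sigma>. ?b \<sigma> +o exact_forms l l)"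
  proof (rule finite_basis_quotient_space [OF subspaces])
    show "finite ?S"
      by (rule finite_permutations) simp
    show "?b \<sigma> \<in> closed_forms l l" if \<sigma>: "\<sigma> \<in> ?S" for \<sigma>
    proof -
      have "?w \<sigma> \<in> words01 l"
        using bij \<sigma> by (rule bij_betwE [rule_format])
      then have "chain (?w \<sigma>) \<in> coordinate_ring l"
        by (intro chain_in_coordinate_ring) (auto simp: words01_def words_def)
      then show ?thesis
        unfolding b [OF \<sigma>] closed by blast
    qed
    show "\<exists>c. \<omega> - (\<Sum>\<sigma>\<in>?S. qscale (c \<sigma>) (?b \<sigma>)) \<in> exact_forms l l" if \<omega>: "\<omega> \<in> closed_forms l l" for \<omega>
    proof -
      obtain f where f: "f \<in> coordinate_ring l" "\<omega> = top_form l f"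
        using \<omega> unfolding closed by blast
      obtain c where c: "f - (\<Sum>W\<in>words01 l. of_rat (c W) * chain W) \<in> exact_functions l"
        using coordinate_ring_spanned_by_words01 [OF f(1)] unfolding spanned_def by blast
      have "\<omega> - (\<Sum>\<sigma>\<in>?S. qscale (c (?w \<sigma>)) (?b \<sigma>)) \<in> exact_forms l l"
        unfolding sum_b f(2) exact top_form_diff [symmetric] using c by blast
      then show ?thesis
        by (rule exI [of _ "\<lambda>\<sigma>. c (?w \<sigma>)"])
    qed
    show "c \<sigma> = 0" if "(\<Sum>\<sigma>\<in>?S. qscale (c \<sigma>) (?b \<sigma>)) \<in> exact_forms l l" "\<sigma> \<in> ?S" for c \<sigma>
    proof -
      \<comment> \<open>The coefficients, transported to words along the bijection with permutations.\<close>
      define d where "d W = c (inv_into ?S ?w W)" for W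
      have d: "d (?w \<tau>) = c \<tau>" if "\<tau> \<in> ?S" for \<tau>
        unfolding d_def using bij_betw_inv_into_left [OF bij that] by simp
      have "(\<Sum>\<sigma>\<in>?S. qscale (c \<sigma>) (?b \<sigma>)) = (\<Sum>\<sigma>\<in>?S. qscale (d (?w \<sigma>)) (?b \<sigma>))"
        by (intro sum.cong refl) (simp only: d)
      then have "top_form l (\<Sum>W\<in>words01 l. of_rat (d W) * chain W) \<in> top_form l ` exact_functions l"
        using that(1) unfolding sum_b exact by (simp only:)
      then have "(\<Sum>W\<in>words01 l. of_rat (d W) * chain W) \<in> exact_functions l"
        by (simp only: top_form_in_image_iff)
      moreover have "?w \<sigma> \<in> words01 l"
        using bij that(2) by (rule bij_betwE [rule_format])
      ultimately show ?thesis
        using words01_independent d [OF that(2)] by metis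
    qed
  qed
  then show "finite_basis (de_Rham n l) {\<sigma>. \<sigma> permutes {..<n - 2}} (\<lambda>\<sigma>. form_class n l (?b \<sigma>))"
    unfolding deRham form_class l(3) .
qed

end
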